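(* Let $q$ be a power of a prime $p$, let $K$ be the function field of a (smooth projective) curve $C_K$ defined over $\mathbb{F}_q$, and let $0\neq F\in K[x]$ be squarefree in $K[x]$. Assume that either $F$ is non-separable, or $F$ has (at least) three distinct roots $a_1,a_2,a_3$ in $\overline{K}$ such that $$\frac{a_1-a_2}{a_1-a_3}\notin\overline{\mathbb{F}}_q.$$ Then there exists a constant $\lambda$ depending on $F$ such that $$\delta(F(f))>\log_q h(f)-\lambda$$ for all $f\in K$ for which $F(f)$ is not constant.
   Context: $\overline{\mathbb{F}}_q\subseteq\overline{K}$ denote algebraic closures of $\mathbb{F}_q$ and $K$. A polynomial in $K[x]$ is separable if it has distinct roots in $\overline{K}$. For $f\in K^\times$, $(f)=(f)_0-(f)_\infty$ is its divisor, decomposed into zero and polar parts; the height of $f$ is $h(f)=\deg(f)_0=\deg(f)_\infty$ (degrees of prime divisors of $K$ are taken over $\mathbb{F}_q$). For a nonconstant $f$, $\delta(f)=\max_{P\in\operatorname{supp}(f)}\deg P$, the maximal degree of a prime divisor in the support of $(f)$. The convention $\log_q 0=-\infty$ applies when $h(f)=0$. *)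

theory Defs
  imports
    "HOL-Algebra.Algebraic_Closure_Type"
    "HOL-Algebra.Generated_Fields"
    "HOL-Algebra.Finite_Extensions"
    "HOL-Computational_Algebra.Squarefree"
    "HOL-Library.Extended_Real"
begin

text \<open>
  The function field is the whole of a type \<open>'k::field\<close>; \<open>k\<close> is the subset of \<open>'k\<close>
  playing the role of the finite base field. HOL-Algebra notions are applied to
  \<^const>\<open>ring_of_type_algebra\<close>, the type-class field seen as a HOL-Algebra record.
\<close>

abbreviation type_ring :: "'a::field ring"
  where "type_ring \<equiv> ring_of_type_algebra"

definition algebraic_over :: "'a::field set \<Rightarrow> 'a \<Rightarrow> bool"
  where "algebraic_over k x \<longleftrightarrow> (ring.algebraic type_ring over k) x"

text \<open>
  A finitely generated extension of \<open>k\<close> of transcendence degree one. It is not required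
  that \<open>k\<close> is algebraically closed in the extension (i.e. that the curve is geometrically
  irreducible), so ``constant'' below means algebraic over \<open>k\<close>.
\<close>

definition function_field_over :: "'k::field set \<Rightarrow> bool"
  where "function_field_over k \<longleftrightarrow>
    subfield k type_ring \<and>
    (\<exists>t. \<not> algebraic_over k t \<and>
         ring.finite_dimension type_ring (generate_field type_ring (insert t k)) (UNIV :: 'k set))"

definition is_constant :: "'k::field set \<Rightarrow> 'k \<Rightarrow> bool"
  where "is_constant k f \<longleftrightarrow> algebraic_over k f"

text \<open>
  Prime divisors are represented by their normalized discrete valuations. The value
  \<open>v 0 = 0\<close> is a dummy (the true value is infinite); fixing it makes \<open>v\<close> unique.
\<close>

definition prime_divisor :: "'k::field set \<Rightarrow> ('k \<Rightarrow> int) \<Rightarrow> bool"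
  where "prime_divisor k v \<longleftrightarrow>
    v 0 = 0 \<and>
    (\<forall>x y. x \<noteq> 0 \<longrightarrow> y \<noteq> 0 \<longrightarrow> v (x * y) = v x + v y) \<and>
    (\<forall>x y. x \<noteq> 0 \<longrightarrow> y \<noteq> 0 \<longrightarrow> x + y \<noteq> 0 \<longrightarrow> min (v x) (v y) \<le> v (x + y)) \<and>
    (\<forall>c\<in>k. c \<noteq> 0 \<longrightarrow> v c = 0) \<and>
    (\<exists>x. x \<noteq> 0 \<and> v x = 1)"

definition valuation_ring :: "('k::field \<Rightarrow> int) \<Rightarrow> 'k ring"
  where "valuation_ring v = type_ring \<lparr>carrier := {x. x = 0 \<or> 0 \<le> v x}\<rparr>"

definition maximal_ideal :: "('k::field \<Rightarrow> int) \<Rightarrow> 'k set"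
  where "maximal_ideal v = {x. x = 0 \<or> 0 < v x}"

definition residue_field :: "('k::field \<Rightarrow> int) \<Rightarrow> 'k set ring"
  where "residue_field v = valuation_ring v Quot maximal_ideal v"

definition pdegree :: "'k::field set \<Rightarrow> ('k \<Rightarrow> int) \<Rightarrow> nat"
  where "pdegree k v =
    ring.dim (residue_field v)
      ((\<lambda>c. maximal_ideal v +>\<^bsub>valuation_ring v\<^esub> c) ` k)
      (carrier (residue_field v))"

text \<open>
  The degree of the zero divisor \<open>(f)\<^sub>0\<close>. By the dummy value above, the height of \<open>f = 0\<close>
  is 0, as for all other constants.
\<close>

definition height :: "'k::field set \<Rightarrow> 'k \<Rightarrow> nat"
  where "height k f = (\<Sum>v | prime_divisor k v \<and> 0 < v f. nat (v f) * pdegree k v)"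

definition divisor_support :: "'k::field set \<Rightarrow> 'k \<Rightarrow> ('k \<Rightarrow> int) set"
  where "divisor_support k f = {v. prime_divisor k v \<and> v f \<noteq> 0}"

definition max_degree :: "'k::field set \<Rightarrow> 'k \<Rightarrow> nat"
  where "max_degree k f = Max (pdegree k ` divisor_support k f)"

definition separable_poly :: "'k::field poly \<Rightarrow> bool"
  where "separable_poly F \<longleftrightarrow> rsquarefree (map_poly to_ac F)"

definition constants_closure :: "'k::field set \<Rightarrow> 'k alg_closure set"
  where "constants_closure k = {a. algebraic_over (to_ac ` k) a}"

definition elog :: "nat \<Rightarrow> nat \<Rightarrow> ereal"
  where "elog q n = (if n = 0 then -\<infinity> else ereal (log (real q) (real n)))"

end

theory Submission
  imports Defs
begin

text \<open>
  No extension of \<open>K\<close> is needed. Let \<open>D\<close> be a derivation of \<open>K\<close> whose constants are the \<open>p\<close>-th powers and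
  \<open>y = F f\<close>. If \<open>F\<close> is inseparable, an irreducible factor \<open>G\<close> has \<open>G' = 0\<close>, so \<open>D (G f)\<close> is a polynomial in
  \<open>f\<close> coprime to \<open>G f\<close>: almost all zeros of \<open>G f\<close> are simple, and \<open>h f\<close> is bounded by the degree of the support
  of \<open>y\<close>. If \<open>F\<close> is separable of degree \<open>n\<close>, let \<open>P\<close> of degree \<open>< n\<close> interpolate the derivatives of the roots
  of \<open>F\<close>. Then \<open>D f - P f\<close> vanishes at the zeros of \<open>y\<close> to almost the same order as \<open>y\<close>, while its poles have
  degree about \<open>(n - 1) h f\<close>; the product formula again bounds \<open>h f\<close> unless \<open>D f = P f\<close>. In that case the poles of
  \<open>f\<close> are simple unless \<open>P\<close> is linear, and for linear \<open>P\<close> an affine substitution over \<open>K\<close> turns \<open>F\<close> into the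
  Frobenius twist of another polynomial, whose root ratio is the \<open>p\<close>-th root of that of \<open>F\<close>. This cannot be repeated
  forever: a ratio having \<open>p ^ j\<close>-th roots of bounded degree over \<open>K\<close> for all \<open>j\<close> is algebraic over the
  constants. Finally the places of degree at most \<open>\<delta>\<close> have total degree \<open>O (q ^ \<delta>)\<close>.

  The theory of function fields is obtained by counting: finite sets of expansions in powers of an
  element are compared with finite spaces of elements with bounded poles.
\<close>

section \<open>Valuations and weak approximation\<close>

text \<open>The obstacle is Frobenius. If the coefficients of \<open>F\<close> were in
  \<open>k\<close>, replacing \<open>f\<close> by \<open>f ^ q\<close> would multiply its height by
  \<open>q\<close> and raise \<open>F f\<close> to the power \<open>q\<close>, leaving the support
  unchanged, so no bound could hold. An affine change of variable over \<open>K\<close> can disguise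
  this situation; the quotient of root differences is the affine invariant that detects it.
  Derivations do not see \<open>p\<close>-th powers, which is why precisely this case escapes the
  product formula and needs a descent. The descent argues by contradiction from an unbounded
  \<open>F\<close>, so no constant has to be tracked along the chain.

  The bound proved is linear: the height of \<open>f\<close> is at most \<open>C\<close> times one
  plus the degree of the support of \<open>F f\<close>, each place counted once. The logarithm comes
  from comparing this degree with \<open>q ^ \<delta>\<close>, and \<lambda> is essentially the
  logarithm of the resulting constant.

  Counting is effective because \<open>k\<close> is finite and because
  \<open>a ^ (J + 1) \<le> B * Q ^ J\<close> for all \<open>J\<close> forces
  \<open>a \<le> Q\<close> whatever \<open>B\<close> is: crude bounds with unspecified constants
  still give sharp comparisons.\<close>

definition val_ge :: "('k::field \<Rightarrow> int) \<Rightarrow> 'k \<Rightarrow> int \<Rightarrow> bool"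
  where "val_ge v x a \<longleftrightarrow> x = 0 \<or> a \<le> v x"

text \<open>Zero counts as having infinite value here, unlike under the dummy \<open>v 0 = 0\<close>
  of \<open>prime_divisor\<close>; this frees the sum and product rules below from side
  conditions.\<close>

lemma val_ge_0 [simp]: "val_ge v 0 a"
  by (simp add: val_ge_def)

lemma val_ge_mono: "val_ge v x a \<Longrightarrow> b \<le> a \<Longrightarrow> val_ge v x b"
  by (auto simp: val_ge_def)

lemma val_ge_self: "a \<le> v x \<Longrightarrow> val_ge v x a"
  by (simp add: val_ge_def)

context
  fixes k :: "'k::field set" and v :: "'k \<Rightarrow> int"
  assumes v: "prime_divisor k v"
begin

lemma v_0: "v 0 = 0"
  using v by (simp add: prime_divisor_def)

lemma v_mult: "x \<noteq> 0 \<Longrightarrow> y \<noteq> 0 \<Longrightarrow> v (x * y) = v x + v y"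
  using v by (simp add: prime_divisor_def)

lemma v_1: "v 1 = 0"
  using v_mult[of 1 1] by simp

lemma v_uminus: "v (- x) = v x"
proof (cases "x = 0")
  case False
  have "v ((-1) * (-1)) = v (-1) + v (-1)" by (rule v_mult) auto
  hence "v (-1) = 0" using v_1 by simp
  thus ?thesis using v_mult[of "-1" x] False by simp
qed simp

lemma v_inverse: "v (inverse x) = - v x"
proof (cases "x = 0")
  case False
  thus ?thesis using v_mult[of x "inverse x"] v_1 by simp
qed (simp add: v_0)

lemma v_divide: "x \<noteq> 0 \<Longrightarrow> y \<noteq> 0 \<Longrightarrow> v (x / y) = v x - v y"
  using v_mult[of x "inverse y"] v_inverse[of y] by (simp add: divide_inverse)

lemma v_power: "v (x ^ n) = int n * v x"
proof (cases "x = 0")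
  case True
  thus ?thesis by (cases n) (auto simp: v_0 v_1)
next
  case False
  thus ?thesis by (induction n) (auto simp: v_1 v_mult algebra_simps)
qed

lemma v_const: "c \<in> k \<Longrightarrow> v c = 0"
  using v v_0 by (cases "c = 0") (auto simp: prime_divisor_def)

lemma val_ge_add: "val_ge v x a \<Longrightarrow> val_ge v y a \<Longrightarrow> val_ge v (x + y) a"
proof -
  have "x \<noteq> 0 \<Longrightarrow> y \<noteq> 0 \<Longrightarrow> x + y \<noteq> 0 \<Longrightarrow> min (v x) (v y) \<le> v (x + y)"
    using v by (simp add: prime_divisor_def)
  thus "val_ge v x a \<Longrightarrow> val_ge v y a \<Longrightarrow> val_ge v (x + y) a"
    by (cases "x = 0"; cases "y = 0"; cases "x + y = 0") (auto simp: val_ge_def)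
qed

lemma val_ge_uminus: "val_ge v (- x) a \<longleftrightarrow> val_ge v x a"
  by (simp add: val_ge_def v_uminus)

lemma val_ge_diff: "val_ge v x a \<Longrightarrow> val_ge v y a \<Longrightarrow> val_ge v (x - y) a"
  using val_ge_add[of x a "- y"] val_ge_uminus[of y a] by simp

lemma val_ge_minus_commute: "val_ge v (x - y) a \<longleftrightarrow> val_ge v (y - x) a"
  using val_ge_uminus[of "x - y" a] by simp

lemma val_ge_mult: "val_ge v x a \<Longrightarrow> val_ge v y b \<Longrightarrow> val_ge v (x * y) (a + b)"
  by (cases "x = 0"; cases "y = 0") (auto simp: val_ge_def v_mult)

lemma val_ge_mult_right: "val_ge v x a \<Longrightarrow> val_ge v (x * y) (a + v y)"
  using val_ge_mult[of x a y "v y"] by (simp add: val_ge_def)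

lemma val_ge_1: "val_ge v 1 0"
  by (simp add: val_ge_def v_1)

lemma val_ge_power: "val_ge v x a \<Longrightarrow> val_ge v (x ^ n) (int n * a)"
  by (cases "x = 0"; cases "n = 0") (auto simp: val_ge_def v_power v_1 mult_left_mono)

lemma val_ge_sum: "(\<And>i. i \<in> I \<Longrightarrow> val_ge v (f i) a) \<Longrightarrow> val_ge v (sum f I) a"
  by (induction I rule: infinite_finite_induct) (auto intro: val_ge_add)

lemma val_ge_of_nat: "val_ge v (of_nat n) 0"
  by (induction n) (auto intro: val_ge_add val_ge_1)

lemma val_ge_cancel: "y \<noteq> 0 \<Longrightarrow> val_ge v (x * y) (a + v y) \<longleftrightarrow> val_ge v x a"
  by (cases "x = 0") (auto simp: val_ge_def v_mult)

text \<open>A term of strictly smaller value cannot be cancelled. That the sum is nonzero is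
  recorded separately, because the dummy \<open>v 0 = 0\<close> would hide it.\<close>

lemma v_dominant:
  assumes "x \<noteq> 0" "val_ge v y (v x + 1)"
  shows "x + y \<noteq> 0" "v (x + y) = v x"
proof -
  show "x + y \<noteq> 0"
  proof
    assume "x + y = 0"
    hence "y = - x" by (simp add: eq_neg_iff_add_eq_0 add.commute)
    thus False using assms by (simp add: val_ge_def v_uminus)
  qed
  moreover have "val_ge v (x + y) (v x)"
    by (rule val_ge_add) (use assms in \<open>auto simp: val_ge_def\<close>)
  moreover have "\<not> val_ge v (x + y) (v x + 1)"
    using val_ge_diff[of "x + y" "v x + 1" y] assms by (auto simp: val_ge_def)
  ultimately show "v (x + y) = v x" by (auto simp: val_ge_def)
qed

lemma val_ge_trans_diff:
  "val_ge v (x - y) a \<Longrightarrow> val_ge v (y - z) a \<Longrightarrow> val_ge v (x - z) a"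
  using val_ge_add[of "x - y" a "y - z"] by simp

lemma uniformizer_exists: "\<exists>x. x \<noteq> 0 \<and> v x = 1"
  using v by (simp add: prime_divisor_def)

lemma elem_of_value_exists: "\<exists>x. x \<noteq> 0 \<and> v x = n"
proof -
  obtain x where x: "x \<noteq> 0" "v x = 1" using uniformizer_exists by blast
  have "v (x ^ m) = int m" "v (inverse (x ^ m)) = - int m" for m
    using x by (auto simp: v_power v_inverse)
  moreover have "x ^ m \<noteq> 0" "inverse (x ^ m) \<noteq> 0" for m using x by auto
  ultimately show ?thesis
    by (cases n rule: int_cases2) blast+
qed

text \<open>When the nonzero terms have distinct values, the least one decides the value of the sum,
  so a bound for the sum passes to every term.\<close>

lemma minimal_term_bounds_sum:
  assumes "finite I" and "\<And>i j. i \<in> I \<Longrightarrow> j \<in> I \<Longrightarrow> f i \<noteq> 0 \<Longrightarrow> f j \<noteq> 0 \<Longrightarrow> v (f i) = v (f j) \<Longrightarrow> i = j"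
    and "val_ge v (sum f I) b" and "i \<in> I"
  shows "val_ge v (f i) b"
proof (rule ccontr)
  assume "\<not> ?thesis"
  hence i: "f i \<noteq> 0" "v (f i) < b" by (auto simp: val_ge_def)
  define J where "J = {j \<in> I. f j \<noteq> 0}"
  have J: "finite J" "i \<in> J" using assms i by (auto simp: J_def)
  obtain m where m: "m \<in> J" "\<And>j. j \<in> J \<Longrightarrow> v (f m) \<le> v (f j)"
    using J arg_min_if_finite[of J "\<lambda>j. v (f j)"] by (metis empty_iff linorder_not_less)
  have "val_ge v (sum f (I - {m})) (v (f m) + 1)"
  proof (rule val_ge_sum)
    fix j assume j: "j \<in> I - {m}"
    show "val_ge v (f j) (v (f m) + 1)"
    proof (cases "f j = 0")
      case False
      hence "j \<in> J" using j by (auto simp: J_def)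
      moreover have "v (f j) \<noteq> v (f m)" using assms(2)[of j m] j False m by (auto simp: J_def)
      ultimately have "v (f m) + 1 \<le> v (f j)" using m(2)[of j] by linarith
      thus ?thesis by (simp add: val_ge_def)
    qed simp
  qed
  moreover have "f m \<noteq> 0" using m by (auto simp: J_def)
  ultimately have *: "f m + sum f (I - {m}) \<noteq> 0" "v (f m + sum f (I - {m})) = v (f m)"
    using v_dominant by blast+
  have "sum f I = f m + sum f (I - {m})"
    using m assms(1) by (auto simp: J_def sum.remove)
  thus False using * assms(3) m(2)[OF J(2)] i by (auto simp: val_ge_def)
qed

end

text \<open>Otherwise every unit at \<open>v\<close> is a unit at \<open>w\<close>, so
  \<open>w\<close> is an integer multiple of \<open>v\<close>; as both are normalized, the factor is
  1.\<close>

lemma distinct_places: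
  assumes v: "prime_divisor k v" and w: "prime_divisor k w" and "v \<noteq> w"
  shows "\<exists>x. x \<noteq> 0 \<and> 0 \<le> v x \<and> w x < 0"
proof (rule ccontr)
  assume "\<not> ?thesis"
  hence *: "0 \<le> w x" if "x \<noteq> 0" "0 \<le> v x" for x using that by force
  have z: "w x = 0" if "x \<noteq> 0" "v x = 0" for x
    using *[of x] *[of "inverse x"] that by (auto simp: v_inverse[OF v] v_inverse[OF w])
  obtain p where p: "p \<noteq> 0" "v p = 1" using uniformizer_exists[OF v] by blast
  have pos: "w x = v x * w p" if "x \<noteq> 0" "0 \<le> v x" for x
  proof -
    have "v (x / p ^ nat (v x)) = 0"
      using that p by (subst v_divide[OF v]) (auto simp: v_power[OF v])
    hence "w (x / p ^ nat (v x)) = 0" using z that p by simp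
    thus ?thesis using that p by (subst (asm) v_divide[OF w]) (auto simp: v_power[OF w])
  qed
  have all: "w x = v x * w p" for x
  proof (cases "x = 0")
    case False
    thus ?thesis using pos[of x] pos[of "inverse x"]
      by (cases "0 \<le> v x") (auto simp: v_inverse[OF v] v_inverse[OF w])
  qed (simp add: v_0[OF v] v_0[OF w])
  obtain y where "y \<noteq> 0" "w y = 1" using uniformizer_exists[OF w] by blast
  hence "v y * w p = 1" using all by metis
  moreover have "w p \<ge> 0" using *[of p] p by simp
  ultimately have "w p = 1" by (simp add: zmult_eq_1_iff)
  hence "w x = v x" for x using all[of x] by simp
  hence "v = w" by auto
  thus False using assms by blast
qed

text \<open>Induction on \<open>S\<close>: the new place \<open>w\<close> is corrected by an element
  \<open>b\<close> that is negative at \<open>v\<close> and positive at \<open>w\<close>, and powers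
  of \<open>a\<close> repair \<open>b\<close> at the old places.\<close>

lemma separating_element:
  assumes "finite S" and S: "\<And>w. w \<in> S \<Longrightarrow> prime_divisor k w" and v: "prime_divisor k v" and "v \<notin> S"
  shows "\<exists>a. a \<noteq> 0 \<and> v a < 0 \<and> (\<forall>w\<in>S. 0 < w a)"
  using assms(1,2,4)
proof (induction S)
  case empty
  then show ?case using elem_of_value_exists[OF v, of "-1"] by auto
next
  case (insert w S)
  then obtain a where a: "a \<noteq> 0" "v a < 0" "\<forall>u\<in>S. 0 < u a" by auto
  have w: "prime_divisor k w" and S: "\<And>u. u \<in> S \<Longrightarrow> prime_divisor k u"
    using insert.prems by auto
  obtain b1 where b1: "b1 \<noteq> 0" "0 \<le> w b1" "v b1 < 0"
    using distinct_places[OF w v] insert.prems by auto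
  obtain b2 where b2: "b2 \<noteq> 0" "0 \<le> v b2" "w b2 < 0"
    using distinct_places[OF v w] insert.prems by auto
  define b where "b = b1 / b2"
  have b: "b \<noteq> 0" "v b < 0" "0 < w b"
    using b1 b2 by (auto simp: b_def v_divide[OF v] v_divide[OF w])
  \<comment> \<open>As \<open>u a \<ge> 1\<close> on \<open>S\<close>, this power of
    \<open>a\<close> outweighs \<open>b\<close> at every place of \<open>S\<close>.\<close>
  define m where "m = Suc (nat (\<Sum>u\<in>S. \<bar>u b\<bar>))"
  have m0: "0 < m" by (simp add: m_def)
  have m: "0 < int m * u a + u b" if "u \<in> S" for u
  proof -
    have "\<bar>u b\<bar> \<le> (\<Sum>u\<in>S. \<bar>u b\<bar>)"
      using that insert.hyps by (intro member_le_sum) auto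
    hence "\<bar>u b\<bar> < int m" by (simp add: m_def)
    moreover have "int m * 1 \<le> int m * u a" using a that by (intro mult_left_mono) auto
    ultimately show ?thesis by simp
  qed
  have ma: "int m * v a < 0" using a m0 by (simp add: mult_pos_neg)
  consider "0 < w a" | "w a = 0" | "w a < 0" by linarith
  then show ?case
  proof cases
    case 1
    then show ?thesis using a by auto
  next
    case 2
    have "v (a ^ m * b) < 0"
      using ma a b by (auto simp: v_mult[OF v] v_power[OF v])
    moreover have "0 < w (a ^ m * b)"
      using a b 2 by (auto simp: v_mult[OF w] v_power[OF w])
    moreover have "0 < u (a ^ m * b)" if "u \<in> S" for u
      using a b m[OF that] by (auto simp: v_mult[OF S[OF that]] v_power[OF S[OF that]])
    ultimately show ?thesis using a b by (intro exI[of _ "a ^ m * b"]) auto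
  next
    case 3
    have neg: "1 + a ^ m \<noteq> 0 \<and> u (1 + a ^ m) = int m * u a" if "u a < 0" "prime_divisor k u" for u
    proof -
      have "int m * u a < 0" using that m0 by (simp add: mult_pos_neg)
      hence "val_ge u 1 (u (a ^ m) + 1)" by (auto simp: v_power[OF that(2)] val_ge_def v_1[OF that(2)])
      thus ?thesis using v_dominant[OF that(2), of "a ^ m" 1] a
        by (simp add: v_power[OF that(2)] add.commute)
    qed
    have pos: "u (1 + a ^ m) = 0" if "u \<in> S" for u
    proof -
      have "0 < int m * u a" using that m0 a by simp
      thus ?thesis using v_dominant(2)[OF S[OF that], of 1 "a ^ m"]
        by (auto simp: val_ge_def v_1[OF S[OF that]] v_power[OF S[OF that]])
    qed
    \<comment> \<open>The factor \<open>a ^ m / (1 + a ^ m)\<close> has value 0 at the poles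
      \<open>v\<close> and \<open>w\<close> of \<open>a\<close>, where \<open>b\<close> is already
      right, and value \<open>m * u a\<close> at the places of \<open>S\<close>.\<close>
    define c where "c = b * a ^ m / (1 + a ^ m)"
    have nz: "1 + a ^ m \<noteq> 0" using neg[OF a(2) v] by blast
    have "v c < 0" using b a neg[OF a(2) v] by (simp add: c_def v_divide[OF v] v_mult[OF v] v_power[OF v])
    moreover have "0 < w c" using b a neg[OF 3 w] by (simp add: c_def v_divide[OF w] v_mult[OF w] v_power[OF w])
    moreover have "0 < u c" if "u \<in> S" for u
      using b a nz pos[OF that] m[OF that] S[OF that]
      by (simp add: c_def v_divide[OF S[OF that]] v_mult[OF S[OF that]] v_power[OF S[OF that]])
    ultimately show ?thesis using a b nz by (intro exI[of _ c]) (auto simp: c_def)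
  qed
qed

text \<open>If \<open>a\<close> has a pole at \<open>v\<close> and zeros at the other places,
  \<open>a ^ n / (1 + a ^ n)\<close> is close to 1 at \<open>v\<close> and close to 0
  elsewhere.\<close>

lemma approximate_idempotent:
  assumes "finite S" and S: "\<And>w. w \<in> S \<Longrightarrow> prime_divisor k w" and v: "v \<in> S"
  shows "\<exists>e. val_ge v (e - 1) (int m) \<and> (\<forall>w\<in>S - {v}. val_ge w e (int m))"
proof -
  have pv: "prime_divisor k v" using S v by blast
  obtain a where a: "a \<noteq> 0" "v a < 0" "\<forall>w\<in>S-{v}. 0 < w a"
    using separating_element[of "S - {v}" k v] assms by blast
  define n where "n = Suc m"
  have nva: "int n * v a \<le> - int m - 1" 
  proof -
    have "int n * v a \<le> int n * (-1)" using a by (intro mult_left_mono) auto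
    thus ?thesis by (simp add: n_def)
  qed
  have *: "1 + a ^ n \<noteq> 0" "v (1 + a ^ n) = int n * v a"
    using v_dominant[OF pv, of "a ^ n" 1] a nva
    by (auto simp: val_ge_def v_power[OF pv] v_1[OF pv] add.commute)
  define e where "e = a ^ n / (1 + a ^ n)"
  have "e - 1 = - (1 / (1 + a ^ n))" using *(1) by (simp add: e_def field_simps)
  moreover have "v (- (1 / (1 + a ^ n))) = - int n * v a"
    using * by (simp add: v_divide[OF pv] v_uminus[OF pv] v_1[OF pv])
  ultimately have 1: "val_ge v (e - 1) (int m)" using nva by (simp add: val_ge_def)
  have 2: "val_ge w e (int m)" if w: "w \<in> S - {v}" for w
  proof -
    have pw: "prime_divisor k w" using S w by blast
    have "int n * 1 \<le> int n * w a" using a(3) w by (intro mult_left_mono) (auto dest!: bspec)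
    moreover have "int n = int m + 1" by (simp add: n_def)
    ultimately have nw: "int m + 1 \<le> int n * w a" by linarith
    hence "w (1 + a ^ n) = 0"
      using v_dominant(2)[OF pw, of 1 "a ^ n"] by (auto simp: val_ge_def v_1[OF pw] v_power[OF pw])
    hence "w e = int n * w a" using * a by (simp add: e_def v_divide[OF pw] v_power[OF pw])
    thus ?thesis using nw by (simp add: val_ge_def)
  qed
  show ?thesis using 1 2 by blast
qed

lemma weak_approximation:
  assumes "finite S" and S: "\<And>w. w \<in> S \<Longrightarrow> prime_divisor k w"
  shows "\<exists>y. \<forall>w\<in>S. val_ge w (y - x w) n"
proof -
  \<comment> \<open>The precision is raised by the worst pole among the \<open>x u\<close>, since
    each approximate idempotent is multiplied by some \<open>x u\<close>.\<close>
  define m where "m = nat (\<bar>n\<bar> + (\<Sum>u\<in>S. \<Sum>w\<in>S. \<bar>w (x u)\<bar>))"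
  have m: "n \<le> int m + w (x u)" if "u \<in> S" "w \<in> S" for u w
  proof -
    have "\<bar>w (x u)\<bar> \<le> (\<Sum>w\<in>S. \<bar>w (x u)\<bar>)"
      using that assms(1) by (intro member_le_sum) auto
    also have "\<dots> \<le> (\<Sum>u\<in>S. \<Sum>w\<in>S. \<bar>w (x u)\<bar>)"
      using that assms(1) by (intro member_le_sum) (auto intro: sum_nonneg)
    finally have "\<bar>n\<bar> + \<bar>w (x u)\<bar> \<le> \<bar>n\<bar> + (\<Sum>u\<in>S. \<Sum>w\<in>S. \<bar>w (x u)\<bar>)" by simp
    hence "\<bar>n\<bar> + \<bar>w (x u)\<bar> \<le> int m" unfolding m_def
      by (smt (verit) int_nat_eq)
    thus ?thesis by linarith
  qed
  have "\<forall>u\<in>S. \<exists>e. val_ge u (e - 1) (int m) \<and> (\<forall>w\<in>S - {u}. val_ge w e (int m))"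
    using approximate_idempotent[OF assms] by blast
  then obtain e where e: "\<And>u. u \<in> S \<Longrightarrow> val_ge u (e u - 1) (int m)"
    "\<And>u w. u \<in> S \<Longrightarrow> w \<in> S - {u} \<Longrightarrow> val_ge w (e u) (int m)" by metis
  define y where "y = (\<Sum>u\<in>S. e u * x u)"
  have "val_ge w (y - x w) n" if w: "w \<in> S" for w
  proof -
    have pw: "prime_divisor k w" using S w by blast
    have "y - x w = (\<Sum>u\<in>S. (if u = w then e w - 1 else e u) * x u)"
    proof -
      have "(\<Sum>u\<in>S. (if u = w then e w - 1 else e u) * x u)
          = (\<Sum>u\<in>S. e u * x u - (if u = w then x w else 0))"
        by (intro sum.cong) (auto simp: algebra_simps)
      thus ?thesis using w assms(1) by (simp add: sum_subtractf y_def)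
    qed
    also have "val_ge w \<dots> n"
    proof (rule val_ge_sum[OF pw])
      fix u assume u: "u \<in> S"
      have "val_ge w (if u = w then e w - 1 else e u) (int m)"
        using e u w by auto
      thus "val_ge w ((if u = w then e w - 1 else e u) * x u) n"
        using val_ge_mult_right[OF pw] m[OF u w] val_ge_mono by blast
    qed
    finally show ?thesis .
  qed
  thus ?thesis by blast
qed

text \<open>The first digits agree modulo \<open>t\<close>, hence are equal; dividing by
  \<open>t\<close> leaves a shorter expansion.\<close>

lemma digits_unique:
  assumes v: "prime_divisor k v" and t: "t \<noteq> 0" "v t = 1"
    and R: "\<And>r. r \<in> R \<Longrightarrow> val_ge v r 0" "\<And>r s. r \<in> R \<Longrightarrow> s \<in> R \<Longrightarrow> val_ge v (r - s) 1 \<Longrightarrow> r = s"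
    and "\<And>j. j < e \<Longrightarrow> r j \<in> R" "\<And>j. j < e \<Longrightarrow> s j \<in> R"
    and "val_ge v ((\<Sum>j<e. t ^ j * r j) - (\<Sum>j<e. t ^ j * s j)) (int e)"
  shows "\<forall>j<e. r j = s j"
  using assms(6-)
proof (induction e arbitrary: r s)
  case (Suc e)
  define A where "A = (\<Sum>j<e. t ^ j * r (Suc j)) - (\<Sum>j<e. t ^ j * s (Suc j))"
  have eq: "(\<Sum>j<Suc e. t ^ j * r j) - (\<Sum>j<Suc e. t ^ j * s j) = (r 0 - s 0) + A * t"
    unfolding sum.lessThan_Suc_shift A_def
    by (simp add: algebra_simps sum_distrib_left)
  have "val_ge v A 0" unfolding A_def
  proof (intro val_ge_diff[OF v] val_ge_sum[OF v])
    fix j assume "j \<in> {..<e}"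
    hence "val_ge v (r (Suc j)) 0" "val_ge v (s (Suc j)) 0" using Suc.prems R(1) by auto
    moreover have "val_ge v (t ^ j) 0" using t by (simp add: val_ge_def v_power[OF v])
    ultimately show "val_ge v (t ^ j * r (Suc j)) 0" "val_ge v (t ^ j * s (Suc j)) 0"
      using val_ge_mult[OF v] by fastforce+
  qed
  hence At: "val_ge v (A * t) 1" using val_ge_mult_right[OF v, of A 0 t] t by simp
  have big: "val_ge v ((r 0 - s 0) + A * t) (int (Suc e))"
    using Suc.prems(3) unfolding eq .
  hence "val_ge v ((r 0 - s 0) + A * t) 1" by (rule val_ge_mono) simp
  hence "val_ge v (r 0 - s 0) 1" using val_ge_diff[OF v, OF _ At] by fastforce
  hence 0: "r 0 = s 0" using R(2) Suc.prems by auto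
  hence "val_ge v (A * t) (int e + v t)" using big t by (simp add: add.commute)
  hence "val_ge v A (int e)" using val_ge_cancel[OF v t(1)] by blast
  hence "\<forall>j<e. r (Suc j) = s (Suc j)"
    unfolding A_def by (intro Suc.IH) (use Suc.prems(1,2) in blast)+
  thus ?case using 0 by (metis Suc_less_eq not0_implies_Suc)
qed simp

text \<open>Lower bound from the Chinese remainder theorem: prescribe \<open>e v\<close> digits at
  each \<open>v\<close> and realize every choice by a single element through weak approximation. The
  elements obtained will be digits of expansions.\<close>

lemma many_incongruent:
  fixes R :: "('k::field \<Rightarrow> int) \<Rightarrow> 'k set" and e :: "('k \<Rightarrow> int) \<Rightarrow> nat"
  assumes S: "finite S" "\<And>v. v \<in> S \<Longrightarrow> prime_divisor k v"
    and R: "\<And>v. v \<in> S \<Longrightarrow> finite (R v)" "\<And>v r. v \<in> S \<Longrightarrow> r \<in> R v \<Longrightarrow> val_ge v r 0"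
      "\<And>v r s. v \<in> S \<Longrightarrow> r \<in> R v \<Longrightarrow> s \<in> R v \<Longrightarrow> val_ge v (r - s) 1 \<Longrightarrow> r = s"
  obtains W where "finite W" "card W = (\<Prod>v\<in>S. card (R v) ^ e v)"
    "\<And>w v. w \<in> W \<Longrightarrow> v \<in> S \<Longrightarrow> val_ge v w 0"
    "\<And>w w'. w \<in> W \<Longrightarrow> w' \<in> W \<Longrightarrow> (\<And>v. v \<in> S \<Longrightarrow> val_ge v (w - w') (int (e v))) \<Longrightarrow> w = w'"
proof -
  define I where "I = (\<Pi>\<^sub>E v\<in>S. {..<e v} \<rightarrow>\<^sub>E R v)"
  have fin: "finite I" unfolding I_def using S R by (intro finite_PiE) auto
  have cardI: "card I = (\<Prod>v\<in>S. card (R v) ^ e v)"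
    unfolding I_def using S by (simp add: card_PiE)
  have "\<forall>v\<in>S. \<exists>t. t \<noteq> 0 \<and> v t = 1" using S uniformizer_exists by blast
  then obtain t where t: "\<And>v. v \<in> S \<Longrightarrow> t v \<noteq> 0 \<and> v (t v) = 1" by metis
  define a where "a i v = (\<Sum>j<e v. t v ^ j * i v j)" for i v
  define n where "n = int (\<Sum>v\<in>S. e v)"
  have n: "int (e v) \<le> n" if "v \<in> S" for v
    unfolding n_def using that S by (intro of_nat_mono member_le_sum) auto
  have n0: "0 \<le> n" unfolding n_def by (rule of_nat_0_le_iff)
  have "\<forall>i. \<exists>y. \<forall>v\<in>S. val_ge v (y - a i v) n"
  proof
    fix i show "\<exists>y. \<forall>v\<in>S. val_ge v (y - a i v) n"
      by (rule weak_approximation[OF S])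
  qed
  then obtain y where y: "\<And>i v. v \<in> S \<Longrightarrow> val_ge v (y i - a i v) n" by metis
  have uniq: "i = i'" if i: "i \<in> I" "i' \<in> I" and c: "\<And>v. v \<in> S \<Longrightarrow> val_ge v (y i - y i') (int (e v))" for i i'
  proof -
    have "\<forall>j<e v. i v j = i' v j" if v: "v \<in> S" for v
    proof (rule digits_unique[OF S(2)[OF v], of "t v" "R v"])
      note pv = S(2)[OF v]
      show "val_ge v ((\<Sum>j<e v. t v ^ j * i v j) - (\<Sum>j<e v. t v ^ j * i' v j)) (int (e v))"
        unfolding a_def[symmetric]
      proof (rule val_ge_trans_diff[OF pv], rule val_ge_trans_diff[OF pv])
        show "val_ge v (a i v - y i) (int (e v))"
          using y[OF v, of i] n[OF v] val_ge_mono val_ge_minus_commute[OF pv] by blast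
        show "val_ge v (y i - y i') (int (e v))" by (rule c[OF v])
        show "val_ge v (y i' - a i' v) (int (e v))"
          using y[OF v, of i'] n[OF v] val_ge_mono by blast
      qed
    qed (use R t v i in \<open>auto simp: I_def PiE_iff\<close>)
    hence "i v = i' v" if "v \<in> S" for v
      using i that unfolding I_def by (intro PiE_ext[of _ "{..<e v}" "\<lambda>_. R v"]) (auto simp: PiE_iff)
    thus ?thesis using i unfolding I_def by (intro PiE_ext[OF i[unfolded I_def]]) auto
  qed
  have inj: "inj_on y I"
  proof (rule inj_onI)
    fix i i' assume "i \<in> I" "i' \<in> I" "y i = y i'"
    thus "i = i'" by (intro uniq) auto
  qed
  show ?thesis
  proof (rule that[of "y ` I"])
    show "finite (y ` I)" using fin by simp
    show "card (y ` I) = (\<Prod>v\<in>S. card (R v) ^ e v)" using inj cardI by (simp add: card_image)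
    show "val_ge v w 0" if "w \<in> y ` I" "v \<in> S" for w v
    proof -
      obtain i where i: "i \<in> I" "w = y i" using \<open>w \<in> y ` I\<close> by blast
      note pv = S(2)[OF \<open>v \<in> S\<close>]
      have "val_ge v (a i v) 0" unfolding a_def
      proof (rule val_ge_sum[OF pv])
        fix j assume "j \<in> {..<e v}"
        hence "val_ge v (i v j) 0" using i that R(2) by (auto simp: I_def PiE_iff)
        moreover have "val_ge v (t v ^ j) 0" using t[OF that(2)] by (simp add: val_ge_def v_power[OF pv])
        ultimately show "val_ge v (t v ^ j * i v j) 0" using val_ge_mult[OF pv] by fastforce
      qed
      moreover have "val_ge v (y i - a i v) 0" using y that n0 val_ge_mono by blast
      ultimately show ?thesis using val_ge_add[OF pv] i by fastforce
    qed
    show "w = w'" if "w \<in> y ` I" "w' \<in> y ` I" "\<And>v. v \<in> S \<Longrightarrow> val_ge v (w - w') (int (e v))" for w w'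
      using that uniq by blast
  qed
qed

section \<open>Residue fields\<close>

definition residue_class :: "('k::field \<Rightarrow> int) \<Rightarrow> 'k \<Rightarrow> 'k set"
  where "residue_class v x = {y. val_ge v (y - x) 1}"

text \<open>Coordinates in a basis. This turns the dimension \<open>pdegree\<close> into the
  logarithm of a cardinality, the form in which degrees are used afterwards.\<close>

lemma (in ring) card_eq_card_subfield_power_dim:
  assumes K: "subfield K R" and fin: "finite (carrier R)"
  shows "card (carrier R) = card K ^ dim K (carrier R)"
proof -
  obtain Us where Us: "set Us = carrier R" using finite_list[OF fin] by blast
  have "Span K Us = carrier R"
    using Span_base_incl[OF K, of Us] Span_in_carrier[OF subfieldE(3)[OF K], of Us] Us by auto
  then obtain n where "dimension n K (carrier R)"
    using Span_finite_dimension[OF K, of Us] Us by (metis finite_dimensionE' subset_refl)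
  hence dim: "dim K (carrier R) = n" "dimension n K (carrier R)"
    using dimI[OF K] by (auto simp: over_def)
  then obtain Vs where Vs: "independent K Vs" "length Vs = n" "Span K Vs = carrier R"
    using exists_base[OF K] by blast
  define A where "A = {Ks. set Ks \<subseteq> K \<and> length Ks = n}"
  have "bij_betw (\<lambda>Ks. combine Ks Vs) A (carrier R)"
  proof (rule bij_betwI')
    fix Ks Ls assume *: "Ks \<in> A" "Ls \<in> A"
    show "combine Ks Vs = combine Ls Vs \<longleftrightarrow> Ks = Ls"
    proof
      assume eq: "combine Ks Vs = combine Ls Vs"
      have "set Ks \<subseteq> carrier R" using * subfieldE(3)[OF K] by (auto simp: A_def)
      hence "combine Ks Vs \<in> Span K Vs"
        unfolding Vs(3) using independent_in_carrier[OF Vs(1)] by auto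
      from unique_decomposition[OF K Vs(1) this] eq * Vs(2) show "Ks = Ls"
        by (auto simp: A_def)
    qed auto
  next
    fix Ks assume "Ks \<in> A"
    thus "combine Ks Vs \<in> carrier R"
      using independent_in_carrier[OF Vs(1)] subfieldE(3)[OF K] by (auto simp: A_def)
  next
    fix x assume "x \<in> carrier R"
    hence "x \<in> Span K Vs" using Vs by simp
    from unique_decomposition[OF K Vs(1) this] show "\<exists>Ks\<in>A. x = combine Ks Vs"
      using Vs(2) by (auto simp: A_def)
  qed
  hence "card (carrier R) = card A" by (simp add: bij_betw_same_card)
  also have "card A = card K ^ n" unfolding A_def
    using finite_subset[OF subfieldE(3)[OF K] fin] by (rule card_lists_length_eq)
  finally show ?thesis using dim by simp
qed

lemma (in field) finite_field_pow_card:
  assumes fin: "finite (carrier R)" and x: "x \<in> carrier R"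
  shows "x [^] card (carrier R) = x"
proof -
  have pos: "card (carrier R) > 0" using fin x by (auto simp: card_gt_0_iff)
  show ?thesis
  proof (cases "x = \<zero>")
    case True
    thus ?thesis using pos by (simp add: nat_pow_zero)
  next
    case False
    interpret M: group "Multiplicative_Group.mult_of R" by (rule field_mult_group)
    have "x [^]\<^bsub>Multiplicative_Group.mult_of R\<^esub> Coset.order (Multiplicative_Group.mult_of R) = \<one>\<^bsub>Multiplicative_Group.mult_of R\<^esub>"
      using False x by (intro M.pow_order_eq_1) auto
    hence "x [^] (card (carrier R) - 1) = \<one>"
      using order_mult_of[OF fin] by (simp add: Multiplicative_Group.nat_pow_mult_of Coset.order_def)
    hence "x [^] Suc (card (carrier R) - 1) = x" using x by simp
    thus ?thesis using pos by simp
  qed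
qed

text \<open>A finite subfield in terms of the type-class operations. Besides \<open>k\<close> it is
  instantiated in the algebraic closure, at images under \<open>to_ac\<close>.\<close>

locale const_field =
  fixes k :: "'k::field set" and q :: nat
  assumes finite_k: "finite k" and card_k: "card k = q"
    and k_0: "0 \<in> k" and k_1: "1 \<in> k"
    and k_add: "x \<in> k \<Longrightarrow> y \<in> k \<Longrightarrow> x + y \<in> k"
    and k_uminus: "x \<in> k \<Longrightarrow> - x \<in> k"
    and k_mult: "x \<in> k \<Longrightarrow> y \<in> k \<Longrightarrow> x * y \<in> k"
    and k_inverse: "x \<in> k \<Longrightarrow> inverse x \<in> k"
begin

lemma k_diff: "x \<in> k \<Longrightarrow> y \<in> k \<Longrightarrow> x - y \<in> k"
  using k_add[of x "- y"] k_uminus by simp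

lemma q_ge_2: "2 \<le> q"
proof -
  have "card {0, 1 :: 'k} \<le> card k" using k_0 k_1 finite_k by (intro card_mono) auto
  thus ?thesis using card_k by simp
qed

end

section \<open>Residue fields translated from cosets into congruences\<close>

lemma type_ring_simps [simp]:
  "carrier type_ring = UNIV" "\<one>\<^bsub>type_ring\<^esub> = 1" "\<zero>\<^bsub>type_ring\<^esub> = 0"
  "x \<oplus>\<^bsub>type_ring\<^esub> y = x + y" "x \<otimes>\<^bsub>type_ring\<^esub> y = x * y"
  by (auto simp: ring_of_type_algebra_def)

lemma type_ring_uminus [simp]: "\<ominus>\<^bsub>type_ring\<^esub> x = - (x :: 'a :: field)"
proof -
  interpret ring "type_ring :: 'a ring" by (rule ring_from_type_algebra)
  show ?thesis by (rule minus_equality) auto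
qed

lemma type_ring_inv [simp]: "x \<noteq> 0 \<Longrightarrow> inv\<^bsub>type_ring\<^esub> x = inverse (x :: 'a :: field)"
proof -
  assume x: "x \<noteq> 0"
  interpret cring "type_ring :: 'a ring" by (rule cring_from_type_algebra)
  show ?thesis using x by (intro comm_inv_char) auto
qed

lemma valuation_ring_simps [simp]:
  "carrier (valuation_ring v) = {x. val_ge v x 0}" "\<one>\<^bsub>valuation_ring v\<^esub> = 1"
  "\<zero>\<^bsub>valuation_ring v\<^esub> = 0"
  "x \<oplus>\<^bsub>valuation_ring v\<^esub> y = x + y" "x \<otimes>\<^bsub>valuation_ring v\<^esub> y = x * y"
  by (auto simp: valuation_ring_def val_ge_def)

lemma maximal_ideal_iff: "x \<in> maximal_ideal v \<longleftrightarrow> val_ge v x 1"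
  by (auto simp: maximal_ideal_def val_ge_def)

lemma residue_coset: "maximal_ideal v +>\<^bsub>valuation_ring v\<^esub> x = residue_class v x"
  by (auto simp: a_r_coset_def' residue_class_def maximal_ideal_iff)

lemma residue_field_carrier:
  "carrier (residue_field v) = residue_class v ` {x. val_ge v x 0}"
  by (auto simp: residue_field_def FactRing_def A_RCOSETS_def' residue_coset)

lemma cring_valuation_ring:
  assumes v: "prime_divisor k v"
  shows "cring (valuation_ring v)"
proof -
  interpret T: cring "type_ring :: 'a ring" by (rule cring_from_type_algebra)
  have "subcring {x. x = 0 \<or> 0 \<le> v x} (type_ring :: 'a ring)"
    using val_ge_1[OF v] val_ge_uminus[OF v] val_ge_mult[OF v, of _ 0 _ 0] val_ge_add[OF v]
    by (intro T.subcringI' T.subringI) (auto simp: val_ge_def[symmetric])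
  thus ?thesis unfolding valuation_ring_def by (rule T.subcring_iff[THEN iffD1, rotated]) simp
qed

lemma ideal_maximal_ideal:
  assumes v: "prime_divisor k v"
  shows "ideal (maximal_ideal v) (valuation_ring v)"
proof -
  interpret V: cring "valuation_ring v" by (rule cring_valuation_ring[OF v])
  show ?thesis
  proof (rule idealI)
    show "subgroup (maximal_ideal v) (add_monoid (valuation_ring v))"
    proof (rule V.add.subgroupI)
      show "\<ominus>\<^bsub>valuation_ring v\<^esub> a \<in> maximal_ideal v" if "a \<in> maximal_ideal v" for a
      proof -
        have "val_ge v a 0" using that by (auto simp: maximal_ideal_iff intro: val_ge_mono)
        hence "\<ominus>\<^bsub>valuation_ring v\<^esub> a = - a"
          by (intro V.minus_equality) (auto simp: val_ge_uminus[OF v])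
        thus ?thesis using that by (simp add: maximal_ideal_iff val_ge_uminus[OF v])
      qed
      show "maximal_ideal v \<noteq> {}" using maximal_ideal_iff[of 0 v] by auto
    qed (auto simp: maximal_ideal_iff intro: val_ge_mono val_ge_add[OF v])
    show "x \<otimes>\<^bsub>valuation_ring v\<^esub> a \<in> maximal_ideal v" "a \<otimes>\<^bsub>valuation_ring v\<^esub> x \<in> maximal_ideal v"
      if "a \<in> maximal_ideal v" "x \<in> carrier (valuation_ring v)" for a x
      using that val_ge_mult[OF v, of a 1 x 0] by (auto simp: maximal_ideal_iff mult.commute)
  qed (rule V.ring_axioms)
qed

lemma residue_class_eq_iff:
  assumes v: "prime_divisor k v"
  shows "residue_class v x = residue_class v y \<longleftrightarrow> val_ge v (x - y) 1"
proof
  assume "residue_class v x = residue_class v y"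
  moreover have "x \<in> residue_class v x" by (simp add: residue_class_def)
  ultimately show "val_ge v (x - y) 1" by (auto simp: residue_class_def)
next
  assume "val_ge v (x - y) 1"
  thus "residue_class v x = residue_class v y"
    unfolding residue_class_def using val_ge_trans_diff[OF v] val_ge_minus_commute[OF v] by blast
qed

text \<open>An element of the valuation ring outside the maximal ideal has value 0, so its inverse
  is integral too.\<close>

lemma field_residue_field:
  assumes v: "prime_divisor k v"
  shows "field (residue_field v)"
proof -
  interpret V: cring "valuation_ring v" by (rule cring_valuation_ring[OF v])
  interpret I: ideal "maximal_ideal v" "valuation_ring v" by (rule ideal_maximal_ideal[OF v])
  have "maximalideal (maximal_ideal v) (valuation_ring v)"
  proof (rule maximalidealI)
    show "carrier (valuation_ring v) \<noteq> maximal_ideal v"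
      using val_ge_1[OF v] by (auto simp: maximal_ideal_iff set_eq_iff val_ge_def v_1[OF v] intro!: exI[of _ 1])
    fix J assume J: "ideal J (valuation_ring v)" "maximal_ideal v \<subseteq> J" "J \<subseteq> carrier (valuation_ring v)"
    interpret J: ideal J "valuation_ring v" by (rule J)
    show "J = maximal_ideal v \<or> J = carrier (valuation_ring v)"
    proof (rule ccontr)
      assume *: "\<not> ?thesis"
      then obtain x where x: "x \<in> J" "x \<notin> maximal_ideal v" using J by blast
      hence x0: "x \<noteq> 0" "v x = 0" using J(3) by (auto simp: maximal_ideal_iff val_ge_def)
      have "inverse x \<otimes>\<^bsub>valuation_ring v\<^esub> x \<in> J"
        using x x0 by (intro J.I_l_closed) (auto simp: val_ge_def v_inverse[OF v])
      hence "\<one>\<^bsub>valuation_ring v\<^esub> \<in> J" using x0 by simp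
      hence "J = carrier (valuation_ring v)" by (rule J.one_imp_carrier)
      thus False using * by blast
    qed
  qed (rule I.ideal_axioms)
  thus ?thesis unfolding residue_field_def
    by (intro maximalideal.quotient_is_field V.is_cring)
qed

lemma residue_mult:
  assumes v: "prime_divisor k v" and "val_ge v x 0" "val_ge v y 0"
  shows "residue_class v x \<otimes>\<^bsub>residue_field v\<^esub> residue_class v y = residue_class v (x * y)"
proof -
  interpret I: ideal "maximal_ideal v" "valuation_ring v" by (rule ideal_maximal_ideal[OF v])
  show ?thesis using I.rcoset_mult_add[of x y] assms
    by (simp add: residue_field_def FactRing_def residue_coset)
qed

lemma residue_add:
  assumes v: "prime_divisor k v" and "val_ge v x 0" "val_ge v y 0"
  shows "residue_class v x \<oplus>\<^bsub>residue_field v\<^esub> residue_class v y = residue_class v (x + y)"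
proof -
  interpret I: ideal "maximal_ideal v" "valuation_ring v" by (rule ideal_maximal_ideal[OF v])
  show ?thesis using I.a_rcos_sum[of x y] assms
    by (simp add: residue_field_def FactRing_def residue_coset)
qed

lemma residue_one: "\<one>\<^bsub>residue_field v\<^esub> = residue_class v 1"
  by (simp add: residue_field_def FactRing_def residue_coset)

lemma residue_zero:
  assumes v: "prime_divisor k v"
  shows "\<zero>\<^bsub>residue_field v\<^esub> = residue_class v 0"
  by (auto simp: residue_field_def FactRing_def residue_class_def maximal_ideal_iff)

lemma residue_pow:
  assumes v: "prime_divisor k v" and x: "val_ge v x 0"
  shows "residue_class v x [^]\<^bsub>residue_field v\<^esub> (n :: nat) = residue_class v (x ^ n)"
proof (induction n)
  case (Suc n)
  interpret field "residue_field v" by (rule field_residue_field[OF v])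
  have "val_ge v (x ^ n) 0" using val_ge_power[OF v x, of n] by simp
  thus ?case using Suc residue_mult[OF v _ x] by (simp add: mult.commute)
next
  case 0
  interpret field "residue_field v" by (rule field_residue_field[OF v])
  show ?case by (simp add: residue_one)
qed

lemma residue_frobenius:
  assumes v: "prime_divisor k v" and x: "val_ge v x 0" and fin: "finite (carrier (residue_field v))"
  shows "val_ge v (x ^ card (carrier (residue_field v)) - x) 1"
proof -
  interpret field "residue_field v" by (rule field_residue_field[OF v])
  have "residue_class v x \<in> carrier (residue_field v)" using x by (auto simp: residue_field_carrier)
  from finite_field_pow_card[OF fin this] show ?thesis
    unfolding residue_pow[OF v x] residue_class_eq_iff[OF v] .
qed

context const_field
begin

text \<open>Nonzero constants have value 0, so \<open>k\<close> embeds in the residue field and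
  keeps its \<open>q\<close> elements there.\<close>

lemma card_residue_field:
  assumes v: "prime_divisor k v" and fin: "finite (carrier (residue_field v))"
  shows "card (carrier (residue_field v)) = q ^ pdegree k v"
proof -
  interpret field "residue_field v" by (rule field_residue_field[OF v])
  have kv: "val_ge v c 0" if "c \<in> k" for c using v_const[OF v that] by (simp add: val_ge_def)
  have sub: "subfield (residue_class v ` k) (residue_field v)"
  proof (rule subfieldI', rule subringI)
    show "residue_class v ` k \<subseteq> carrier (residue_field v)"
      using kv by (auto simp: residue_field_carrier)
    show "\<one>\<^bsub>residue_field v\<^esub> \<in> residue_class v ` k" using k_1 by (auto simp: residue_one)
    fix h assume "h \<in> residue_class v ` k"
    then obtain c where c: "c \<in> k" "h = residue_class v c" by blast
    have "\<ominus>\<^bsub>residue_field v\<^esub> h = residue_class v (- c)"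
      using kv c k_uminus
      by (intro minus_equality) (auto simp: residue_add[OF v] residue_zero[OF v] residue_field_carrier)
    thus "\<ominus>\<^bsub>residue_field v\<^esub> h \<in> residue_class v ` k" using c k_uminus by auto
  next
    fix h1 h2 assume "h1 \<in> residue_class v ` k" "h2 \<in> residue_class v ` k"
    then obtain c d where cd: "c \<in> k" "d \<in> k" "h1 = residue_class v c" "h2 = residue_class v d" by blast
    thus "h1 \<otimes>\<^bsub>residue_field v\<^esub> h2 \<in> residue_class v ` k" "h1 \<oplus>\<^bsub>residue_field v\<^esub> h2 \<in> residue_class v ` k"
      using kv k_add k_mult by (auto simp: residue_add[OF v] residue_mult[OF v])
  next
    fix h assume "h \<in> residue_class v ` k - {\<zero>\<^bsub>residue_field v\<^esub>}"
    then obtain c where c: "c \<in> k" "h = residue_class v c" "h \<noteq> \<zero>\<^bsub>residue_field v\<^esub>" by blast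
    hence "c \<noteq> 0" by (auto simp: residue_zero[OF v])
    hence "inv\<^bsub>residue_field v\<^esub> h = residue_class v (inverse c)"
      using kv c k_inverse
      by (intro comm_inv_char) (auto simp: residue_mult[OF v] residue_one residue_field_carrier)
    thus "inv\<^bsub>residue_field v\<^esub> h \<in> residue_class v ` k" using c k_inverse by auto
  qed
  have "inj_on (residue_class v) k"
  proof (rule inj_onI)
    fix c d assume cd: "c \<in> k" "d \<in> k" "residue_class v c = residue_class v d"
    hence "val_ge v (c - d) 1" by (simp add: residue_class_eq_iff[OF v])
    thus "c = d" using v_const[OF v k_diff[OF cd(1,2)]] by (auto simp: val_ge_def)
  qed
  hence "card (residue_class v ` k) = q" by (simp add: card_image card_k)
  moreover have "pdegree k v = dim (residue_class v ` k) (carrier (residue_field v))"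
    by (simp add: pdegree_def residue_coset)
  ultimately show ?thesis
    using card_eq_card_subfield_power_dim[OF sub fin] by simp
qed

lemma pdegree_pos:
  assumes v: "prime_divisor k v" and fin: "finite (carrier (residue_field v))"
  shows "0 < pdegree k v"
proof (rule ccontr)
  assume "\<not> ?thesis"
  hence "card (carrier (residue_field v)) = 1" using card_residue_field[OF assms] by simp
  moreover have "{residue_class v 0, residue_class v 1} \<subseteq> carrier (residue_field v)"
    using val_ge_1[OF v] by (auto simp: residue_field_carrier)
  moreover have "residue_class v 0 \<noteq> residue_class v 1"
    by (auto simp: residue_class_eq_iff[OF v] val_ge_def v_uminus[OF v] v_1[OF v])
  ultimately show False using card_mono[OF fin, of "{residue_class v 0, residue_class v 1}"] by simp
qed

end

section \<open>Expansions and finiteness\<close>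

text \<open>Only growth rates matter, not the factor \<open>B\<close>. The finiteness of residue
  fields and of zeros, and the equality of the degrees of zeros and poles, rest on this
  comparison.\<close>

lemma base_le_if_powers_bounded:
  assumes "\<And>J. a ^ Suc J \<le> B * Q ^ J"
  shows "a \<le> (Q :: nat)"
proof (rule ccontr)
  assume "\<not> a \<le> Q"
  hence aQ: "Q < a" by simp
  show False
  proof (cases "Q = 0")
    case True
    thus ?thesis using assms[of 1] aQ by simp
  next
    case False
    have "1 < real a / real Q" using aQ False by simp
    then obtain J where J: "real B < (real a / real Q) ^ J" using real_arch_pow by blast
    hence "real B * real Q ^ J < real a ^ J" using False by (simp add: power_divide field_simps)
    hence "real (B * Q ^ J) < real (a ^ J)" by simp
    hence "B * Q ^ J < a ^ J" by (simp only: of_nat_less_iff)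
    also have "a ^ J \<le> a ^ Suc J" using aQ by (intro power_increasing) auto
    finally show False using assms[of J] by simp
  qed
qed

text \<open>Reading the equality modulo \<open>x\<close> at the places of \<open>S\<close> gives the
  first digit; after cancelling \<open>x\<close> the argument repeats. \<open>W\<close> is a digit
  set: integral on \<open>S\<close> and incongruent modulo \<open>x\<close>.\<close>

lemma expansion_unique:
  fixes x :: "'k::field"
  assumes "x \<noteq> 0" and S: "\<And>v. v \<in> S \<Longrightarrow> prime_divisor k v" "\<And>v. v \<in> S \<Longrightarrow> 0 \<le> v x"
    and W: "\<And>w v. w \<in> W \<Longrightarrow> v \<in> S \<Longrightarrow> val_ge v w 0"
      "\<And>w w'. w \<in> W \<Longrightarrow> w' \<in> W \<Longrightarrow> (\<And>v. v \<in> S \<Longrightarrow> val_ge v (w - w') (v x)) \<Longrightarrow> w = w'"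
    and "\<And>j. j \<le> J \<Longrightarrow> w j \<in> W" "\<And>j. j \<le> J \<Longrightarrow> w' j \<in> W"
    and "(\<Sum>j\<le>J. x ^ j * w j) = (\<Sum>j\<le>J. x ^ j * w' j)"
  shows "\<forall>j\<le>J. w j = w' j"
  using assms(6-)
proof (induction J arbitrary: w w')
  case (Suc J)
  define A where "A = (\<Sum>j\<le>J. x ^ j * w' (Suc j)) - (\<Sum>j\<le>J. x ^ j * w (Suc j))"
  have eq: "w 0 - w' 0 = A * x"
    using Suc.prems(3) unfolding sum.atMost_Suc_shift A_def
    by (simp add: algebra_simps sum_distrib_left)
  have 0: "w 0 = w' 0"
  proof (rule W(2))
    fix v assume v: "v \<in> S"
    note pv = S(1)[OF v]
    have "val_ge v A 0" unfolding A_def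
    proof (intro val_ge_diff[OF pv] val_ge_sum[OF pv])
      fix j assume "j \<in> {..J}"
      hence "val_ge v (w (Suc j)) 0" "val_ge v (w' (Suc j)) 0" using Suc.prems v W(1) by auto
      moreover have "val_ge v (x ^ j) 0" using S(2)[OF v] by (simp add: val_ge_def v_power[OF pv])
      ultimately show "val_ge v (x ^ j * w (Suc j)) 0" "val_ge v (x ^ j * w' (Suc j)) 0"
        using val_ge_mult[OF pv] by fastforce+
    qed
    thus "val_ge v (w 0 - w' 0) (v x)" using val_ge_mult_right[OF pv, of A 0 x] eq by simp
  qed (use Suc.prems in auto)
  hence "A = 0" using eq \<open>x \<noteq> 0\<close> by auto
  hence "\<forall>j\<le>J. w (Suc j) = w' (Suc j)"
    unfolding A_def by (intro Suc.IH) (use Suc.prems(1,2) in auto)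
  thus ?case using 0 by (metis Suc_le_mono not0_implies_Suc)
next
  case 0
  thus ?case by simp
qed

text \<open>Zero or a root of unity. Over a finite \<open>k\<close> this is the same as algebraic
  over \<open>k\<close>, in a form that does not mention \<open>k\<close>.\<close>

definition torsion :: "'k::field \<Rightarrow> bool"
  where "torsion x \<longleftrightarrow> (\<exists>i j. i < j \<and> x ^ i = x ^ j)"

lemma torsion_0: "torsion 0"
  unfolding torsion_def by (rule exI[of _ 1], rule exI[of _ 2]) auto

lemma torsion_inverse: "torsion (inverse x) \<longleftrightarrow> torsion x"
  unfolding torsion_def by (simp add: power_inverse)

lemma torsion_value_0:
  assumes v: "prime_divisor k v" and "torsion x"
  shows "v x = 0"
proof -
  obtain i j where "i < j" "x ^ i = x ^ j" using assms(2) by (auto simp: torsion_def)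
  hence "int i * v x = int j * v x" using v_power[OF v] by metis
  thus ?thesis using \<open>i < j\<close> by simp
qed

context const_field
begin

abbreviation kpoly :: "'k poly \<Rightarrow> bool"
  where "kpoly P \<equiv> \<forall>i. coeff P i \<in> k"

lemma k_sum: "(\<And>i. i \<in> I \<Longrightarrow> f i \<in> k) \<Longrightarrow> sum f I \<in> k"
  by (induction I rule: infinite_finite_induct) (auto intro: k_0 k_add)

lemma kpoly_mult: "kpoly P \<Longrightarrow> kpoly R \<Longrightarrow> kpoly (P * R)"
  by (auto simp: coeff_mult intro!: k_sum k_mult)

lemma kpoly_pCons: "c \<in> k \<Longrightarrow> kpoly P \<Longrightarrow> kpoly (pCons c P)"
  by (auto simp: coeff_pCons split: nat.split)

lemma kpolys_bound:
  "finite {P. kpoly P \<and> Polynomial.degree P < d} \<and> card {P. kpoly P \<and> Polynomial.degree P < d} \<le> q ^ d"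
proof -
  let ?f = "\<lambda>P. restrict (coeff P) {..<d}"
  have inj: "inj_on ?f {P. kpoly P \<and> Polynomial.degree P < d}"
  proof (rule inj_onI, rule poly_eqI)
    fix P Q i
    assume PQ: "P \<in> {P. kpoly P \<and> Polynomial.degree P < d}" "Q \<in> {P. kpoly P \<and> Polynomial.degree P < d}" "?f P = ?f Q"
    show "coeff P i = coeff Q i"
    proof (cases "i < d")
      case True
      thus ?thesis using fun_cong[OF PQ(3), of i] by simp
    qed (use PQ in \<open>simp add: coeff_eq_0\<close>)
  qed
  have sub: "?f ` {P. kpoly P \<and> Polynomial.degree P < d} \<subseteq> {..<d} \<rightarrow>\<^sub>E k"
    by (rule image_subsetI) (simp add: restrict_PiE_iff)
  have fin: "finite ({..<d} \<rightarrow>\<^sub>E k)" using finite_k by (intro finite_PiE) auto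
  show ?thesis
    using inj_on_finite[OF inj sub fin] card_inj_on_le[OF inj sub fin] by (simp add: card_PiE card_k)
qed

text \<open>All powers of \<open>g\<close> lie in the finite set of values at \<open>g\<close> of
  polynomials over \<open>k\<close> of degree below that of \<open>P\<close>, so two of them
  coincide.\<close>

lemma torsion_if_algebraic:
  assumes P: "P \<noteq> 0" "kpoly P" and root: "poly P g = 0"
  shows "torsion g"
proof -
  define d where "d = Polynomial.degree P"
  have d: "0 < d"
  proof (rule ccontr)
    assume "\<not> 0 < d"
    then obtain c where "P = [:c:]" unfolding d_def using degree_eq_zeroE by blast
    thus False using P root by simp
  qed
  define V where "V = (\<lambda>R. poly R g) ` {R. kpoly R \<and> Polynomial.degree R < d}"
  have "g ^ n \<in> V" for n
  proof (induction n)
    case 0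
    have "kpoly 1" using k_0 k_1 by (auto simp: coeff_1)
    thus ?case unfolding V_def using d by (intro image_eqI[of _ _ 1]) auto
  next
    case (Suc n)
    then obtain R where R: "g ^ n = poly R g" "kpoly R" "Polynomial.degree R < d" by (auto simp: V_def)
    \<comment> \<open>Multiply by \<open>g\<close> and subtract the multiple of \<open>P\<close>
      that cancels the coefficient of degree \<open>d\<close>.\<close>
    define T where "T = pCons 0 R - smult (coeff R (d - 1) / Polynomial.lead_coeff P) P"
    have "poly T g = g ^ Suc n" using root R(1) by (simp add: T_def)
    moreover have "kpoly T"
      using R(2) P(2) k_0 by (auto simp: T_def divide_inverse coeff_pCons intro!: k_diff k_uminus k_mult k_inverse split: nat.split)
    moreover have "Polynomial.degree T < d"
    proof -
      have "coeff T i = 0" if "d \<le> i" for i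
      proof (cases "i = d")
        case True
        thus ?thesis using d P by (auto simp: T_def d_def coeff_pCons split: nat.split)
      next
        case False
        hence "d < i" using that by simp
        thus ?thesis using R(3) by (auto simp: T_def d_def coeff_pCons coeff_eq_0 split: nat.split)
      qed
      thus ?thesis using d by (metis degree_lessI)
    qed
    ultimately show ?case unfolding V_def by (intro image_eqI[of _ _ T]) auto
  qed
  hence "range (\<lambda>n. g ^ n) \<subseteq> V" by auto
  moreover have "finite V" unfolding V_def using kpolys_bound by blast
  ultimately have "\<not> inj (\<lambda>n. g ^ n)" using finite_subset finite_imageD infinite_UNIV_nat by blast
  then obtain i j where "i \<noteq> j" "g ^ i = g ^ j" by (auto simp: inj_def)
  thus ?thesis unfolding torsion_def by (metis nat_neq_iff)
qed

end

text \<open>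
  All that is used of a function field over a finite field \<open>k\<close>: the number of
  expansions in powers of \<open>x\<close> with \<open>J + 1\<close> digits from a finite set \<open>W\<close> grows at most like \<open>Q ^ J\<close>,
  with \<open>Q\<close> independent of \<open>W\<close>. It replaces the finiteness of the extension \<open>K / k(x)\<close>.
\<close>

locale growth_field = const_field k q for k :: "'k::field set" and q +
  assumes growth: "\<And>x :: 'k. \<exists>Q. \<forall>W. finite W \<longrightarrow>
    (\<exists>B. \<forall>J. card ((\<lambda>w. \<Sum>j\<le>J. x ^ j * w j) ` ({..J} \<rightarrow>\<^sub>E W)) \<le> B * Q ^ J)"
begin

text \<open>The digits \<open>W\<close> give \<open>card W ^ (J + 1)\<close> different expansions,
  while \<open>growth\<close> allows only \<open>B * Q ^ J\<close>. The bound \<open>Q\<close>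
  depends on \<open>x\<close> alone, not on \<open>S\<close> or \<open>W\<close>.\<close>

lemma bounded_incongruent:
  fixes x :: 'k
  assumes "x \<noteq> 0"
  obtains Q where "\<And>S W. finite W \<Longrightarrow> (\<And>v. v \<in> S \<Longrightarrow> prime_divisor k v \<and> 0 \<le> v x) \<Longrightarrow>
    (\<And>w v. w \<in> W \<Longrightarrow> v \<in> S \<Longrightarrow> val_ge v w 0) \<Longrightarrow>
    (\<And>w w'. w \<in> W \<Longrightarrow> w' \<in> W \<Longrightarrow> (\<And>v. v \<in> S \<Longrightarrow> val_ge v (w - w') (v x)) \<Longrightarrow> w = w') \<Longrightarrow>
    card W \<le> Q"
proof -
  obtain Q where Q: "\<And>W. finite W \<Longrightarrow>
    (\<exists>B. \<forall>J. card ((\<lambda>w. \<Sum>j\<le>J. x ^ j * w j) ` ({..J} \<rightarrow>\<^sub>E W)) \<le> B * Q ^ J)"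
    using growth[of x] by blast
  show ?thesis
  proof (rule that[of Q])
    fix S W assume W: "finite W" and S: "\<And>v. v \<in> S \<Longrightarrow> prime_divisor k v \<and> 0 \<le> v x"
      and Wi: "\<And>w v. w \<in> W \<Longrightarrow> v \<in> S \<Longrightarrow> val_ge v w 0"
      and Wu: "\<And>w w'. w \<in> W \<Longrightarrow> w' \<in> W \<Longrightarrow> (\<And>v. v \<in> S \<Longrightarrow> val_ge v (w - w') (v x)) \<Longrightarrow> w = w'"
    obtain B where B: "\<And>J. card ((\<lambda>w. \<Sum>j\<le>J. x ^ j * w j) ` ({..J} \<rightarrow>\<^sub>E W)) \<le> B * Q ^ J"
      using Q[OF W] by blast
    have "card W ^ Suc J \<le> B * Q ^ J" for J
    proof -
      have "inj_on (\<lambda>w. \<Sum>j\<le>J. x ^ j * w j) ({..J} \<rightarrow>\<^sub>E W)"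
      proof (rule inj_onI)
        fix w w' assume *: "w \<in> {..J} \<rightarrow>\<^sub>E W" "w' \<in> {..J} \<rightarrow>\<^sub>E W"
          "(\<Sum>j\<le>J. x ^ j * w j) = (\<Sum>j\<le>J. x ^ j * w' j)"
        have "\<forall>j\<le>J. w j = w' j"
          by (rule expansion_unique[of x S k W]) (use * S Wi Wu assms in auto)
        thus "w = w'" by (intro PiE_ext[OF *(1,2)]) auto
      qed
      hence "card ((\<lambda>w. \<Sum>j\<le>J. x ^ j * w j) ` ({..J} \<rightarrow>\<^sub>E W)) = card W ^ Suc J"
        by (simp add: card_image card_PiE)
      thus ?thesis using B by metis
    qed
    thus "card W \<le> Q" by (rule base_le_if_powers_bounded)
  qed
qed

text \<open>With a uniformizer as \<open>x\<close>, being incongruent modulo \<open>x\<close> means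
  having distinct residues.\<close>

lemma finite_residue_field:
  assumes v: "prime_divisor k v"
  shows "finite (carrier (residue_field v))"
proof (rule ccontr)
  assume inf: "infinite (carrier (residue_field v))"
  obtain x where x: "x \<noteq> 0" "v x = 1" using uniformizer_exists[OF v] by blast
  obtain Q where Q: "\<And>S W. finite W \<Longrightarrow> (\<And>v. v \<in> S \<Longrightarrow> prime_divisor k v \<and> 0 \<le> v x) \<Longrightarrow>
    (\<And>w v. w \<in> W \<Longrightarrow> v \<in> S \<Longrightarrow> val_ge v w 0) \<Longrightarrow>
    (\<And>w w'. w \<in> W \<Longrightarrow> w' \<in> W \<Longrightarrow> (\<And>v. v \<in> S \<Longrightarrow> val_ge v (w - w') (v x)) \<Longrightarrow> w = w') \<Longrightarrow>
    card W \<le> Q" using bounded_incongruent[OF x(1)] by blast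
  obtain B where B: "B \<subseteq> carrier (residue_field v)" "finite B" "card B = Suc Q"
    using infinite_arbitrarily_large[OF inf] by blast
  hence "\<forall>b\<in>B. \<exists>y. val_ge v y 0 \<and> b = residue_class v y" by (auto simp: residue_field_carrier)
  then obtain f where f: "\<And>b. b \<in> B \<Longrightarrow> val_ge v (f b) 0 \<and> b = residue_class v (f b)" by metis
  have inj: "inj_on f B" using f by (metis inj_onI)
  have "card (f ` B) \<le> Q"
  proof (rule Q[of _ "{v}"])
    show "w = w'" if "w \<in> f ` B" "w' \<in> f ` B" "\<And>u. u \<in> {v} \<Longrightarrow> val_ge u (w - w') (u x)" for w w'
      using that f x residue_class_eq_iff[OF v] by (metis image_iff singletonI)
  qed (use B f v x in auto)
  thus False using B inj by (simp add: card_image)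
qed

lemma card_residue: "prime_divisor k v \<Longrightarrow> card (carrier (residue_field v)) = q ^ pdegree k v"
  using card_residue_field finite_residue_field by blast

lemma deg_pos: "prime_divisor k v \<Longrightarrow> 0 < pdegree k v"
  using pdegree_pos finite_residue_field by blast

lemma residue_representatives:
  assumes v: "prime_divisor k v"
  shows "\<exists>R. finite R \<and> card R = q ^ pdegree k v \<and> (\<forall>r\<in>R. val_ge v r 0) \<and>
    (\<forall>r\<in>R. \<forall>s\<in>R. val_ge v (r - s) 1 \<longrightarrow> r = s)"
proof -
  have "\<forall>b\<in>carrier (residue_field v). \<exists>y. val_ge v y 0 \<and> b = residue_class v y"
    by (auto simp: residue_field_carrier)
  then obtain f where f: "\<And>b. b \<in> carrier (residue_field v) \<Longrightarrow> val_ge v (f b) 0 \<and> b = residue_class v (f b)"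
    by metis
  have inj: "inj_on f (carrier (residue_field v))" using f by (metis inj_onI)
  have "r = s" if "r \<in> f ` carrier (residue_field v)" "s \<in> f ` carrier (residue_field v)" "val_ge v (r - s) 1" for r s
    using that f residue_class_eq_iff[OF v] by (metis image_iff)
  thus ?thesis using f inj finite_residue_field[OF v] card_residue[OF v]
    by (intro exI[of _ "f ` carrier (residue_field v)"]) (auto simp: card_image)
qed

text \<open>From \<open>Q\<close> zeros one obtains \<open>2 ^ Q\<close> elements incongruent modulo
  \<open>x\<close>, by prescribing the residue 0 or 1 at each zero; this is more than
  \<open>Q\<close>.\<close>

lemma finite_zeros:
  assumes "x \<noteq> 0"
  shows "finite {v. prime_divisor k v \<and> 0 < v x}"
proof (rule ccontr)
  assume inf: "infinite {v. prime_divisor k v \<and> 0 < v x}"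
  obtain Q where Q: "\<And>S W. finite W \<Longrightarrow> (\<And>v. v \<in> S \<Longrightarrow> prime_divisor k v \<and> 0 \<le> v x) \<Longrightarrow>
    (\<And>w v. w \<in> W \<Longrightarrow> v \<in> S \<Longrightarrow> val_ge v w 0) \<Longrightarrow>
    (\<And>w w'. w \<in> W \<Longrightarrow> w' \<in> W \<Longrightarrow> (\<And>v. v \<in> S \<Longrightarrow> val_ge v (w - w') (v x)) \<Longrightarrow> w = w') \<Longrightarrow>
    card W \<le> Q" using bounded_incongruent[OF assms] by blast
  obtain S where S: "S \<subseteq> {v. prime_divisor k v \<and> 0 < v x}" "finite S" "card S = Q"
    using infinite_arbitrarily_large[OF inf] by blast
  obtain W where W: "finite W" "card W = (\<Prod>v\<in>S. card {0, 1 :: 'k} ^ 1)"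
    "\<And>w v. w \<in> W \<Longrightarrow> v \<in> S \<Longrightarrow> val_ge v w 0"
    "\<And>w w'. w \<in> W \<Longrightarrow> w' \<in> W \<Longrightarrow> (\<And>v. v \<in> S \<Longrightarrow> val_ge v (w - w') (int 1)) \<Longrightarrow> w = w'"
  proof (rule many_incongruent[of S k "\<lambda>_. {0, 1}" "\<lambda>_. 1"], goal_cases)
    case 1
    show ?case by (rule S(2))
  next
    case (2 v)
    show ?case using S(1) 2(2) by blast
  next
    case 3
    show ?case by simp
  next
    case (4 v r)
    hence "prime_divisor k v" using S by blast
    thus ?case using 4(3) val_ge_1 by fastforce
  next
    case (5 v r s)
    hence v: "prime_divisor k v" using S by blast
    show ?case using 5(3-) v_1[OF v] v_uminus[OF v, of 1] by (auto simp: val_ge_def)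
  next
    case (6 W)
    show ?case by (rule 6(1)[OF 6(2-)])
  qed
  have "card W \<le> Q"
  proof (rule Q[of _ S])
    fix w w' assume *: "w \<in> W" "w' \<in> W" "\<And>v. v \<in> S \<Longrightarrow> val_ge v (w - w') (v x)"
    show "w = w'"
    proof (rule W(4)[OF *(1,2)])
      fix v assume "v \<in> S"
      thus "val_ge v (w - w') (int 1)" using *(3)[of v] S(1) by (auto simp: val_ge_def)
    qed
  qed (use S W in force)+
  moreover have "card W = 2 ^ Q" using W(2) S(3) by (simp add: numeral_2_eq_2)
  ultimately show False using less_exp[of Q] by simp
qed

lemma finite_support: "finite {v. prime_divisor k v \<and> v x \<noteq> 0}"
proof (cases "x = 0")
  case True
  have "{v. prime_divisor k v \<and> v x \<noteq> 0} = {}" using True v_0 by auto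
  thus ?thesis by (metis finite.emptyI)
next
  case False
  have "{v. prime_divisor k v \<and> v x \<noteq> 0}
      \<subseteq> {v. prime_divisor k v \<and> 0 < v x} \<union> {v. prime_divisor k v \<and> 0 < v (inverse x)}"
    by (auto simp: v_inverse)
  thus ?thesis by (rule finite_subset) (use finite_zeros False in auto)
qed

text \<open>For transcendental \<open>g\<close> this bounds the degree of \<open>K\<close> over
  \<open>k(g)\<close>. Combinations of \<open>Q + 1\<close> elements over \<open>k\<close> serve as
  digits: there are more sequences of coefficient vectors than values of expansions, so two
  sequences collide.\<close>

lemma bounded_independence:
  fixes g :: 'k
  obtains N where "\<And>h :: nat \<Rightarrow> 'k. \<exists>P. (\<forall>i\<le>N. kpoly (P i)) \<and> (\<exists>i\<le>N. P i \<noteq> 0) \<and>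
    (\<Sum>i\<le>N. poly (P i) g * h i) = 0"
proof -
  obtain Q where Q: "\<And>W. finite W \<Longrightarrow>
    (\<exists>B. \<forall>J. card ((\<lambda>w. \<Sum>j\<le>J. g ^ j * w j) ` ({..J} \<rightarrow>\<^sub>E W)) \<le> B * Q ^ J)"
    using growth[of g] by blast
  \<comment> \<open>The left side is the growth rate of the number of values, the right side that of
    the number of coefficient sequences.\<close>
  have QQ: "Q < q ^ Suc Q"
  proof -
    have "Q < 2 ^ Q" by (rule less_exp)
    also have "\<dots> \<le> q ^ Q" using q_ge_2 by (intro power_mono) auto
    also have "\<dots> \<le> q ^ Suc Q" using q_ge_2 by (intro power_increasing) auto
    finally show ?thesis .
  qed
  show ?thesis
  proof (rule that[of Q])
    fix h :: "nat \<Rightarrow> 'k"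
    define C where "C = {..Q} \<rightarrow>\<^sub>E k"
    have C: "finite C" "card C = q ^ Suc Q" unfolding C_def using finite_k
      by (auto simp: card_PiE card_k intro: finite_PiE)
    define L where "L c = (\<Sum>i\<le>Q. c i * h i)" for c
    obtain B where B: "\<And>J. card ((\<lambda>w. \<Sum>j\<le>J. g ^ j * w j) ` ({..J} \<rightarrow>\<^sub>E L ` C)) \<le> B * Q ^ J"
      using Q[of "L ` C"] C by blast
    obtain J where J: "B * Q ^ J < (q ^ Suc Q) ^ Suc J"
      using base_le_if_powers_bounded[of "q ^ Suc Q" B Q] QQ by (meson not_le)
    define I where "I = {..J} \<rightarrow>\<^sub>E C"
    define \<Phi> where "\<Phi> c = (\<Sum>j\<le>J. g ^ j * L (c j))" for c
    have I: "finite I" "card I = (q ^ Suc Q) ^ Suc J" unfolding I_def using C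
      by (auto simp: card_PiE intro: finite_PiE)
    have "\<Phi> ` I \<subseteq> (\<lambda>w. \<Sum>j\<le>J. g ^ j * w j) ` ({..J} \<rightarrow>\<^sub>E L ` C)"
    proof (rule image_subsetI)
      fix c assume c: "c \<in> I"
      have "\<Phi> c = (\<Sum>j\<le>J. g ^ j * restrict (\<lambda>j. L (c j)) {..J} j)" by (simp add: \<Phi>_def)
      moreover have "restrict (\<lambda>j. L (c j)) {..J} \<in> {..J} \<rightarrow>\<^sub>E L ` C" using c by (auto simp: I_def)
      ultimately show "\<Phi> c \<in> (\<lambda>w. \<Sum>j\<le>J. g ^ j * w j) ` ({..J} \<rightarrow>\<^sub>E L ` C)" by blast
    qed
    hence "card (\<Phi> ` I) \<le> B * Q ^ J"
      using B[of J] card_mono[of "(\<lambda>w. \<Sum>j\<le>J. g ^ j * w j) ` ({..J} \<rightarrow>\<^sub>E L ` C)" "\<Phi> ` I"] C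
      by (meson finite_PiE finite_atMost finite_imageI le_trans)
    hence "\<not> inj_on \<Phi> I" using J I card_image by (metis not_le)
    then obtain c c' where c: "c \<in> I" "c' \<in> I" "c \<noteq> c'" "\<Phi> c = \<Phi> c'" by (auto simp: inj_on_def)
    define P where "P i = (\<Sum>j\<le>J. monom (c j i - c' j i) j)" for i
    have coeffP: "coeff (P i) j = (if j \<le> J then c j i - c' j i else 0)" for i j
      by (simp add: P_def coeff_sum)
    have "c j i \<in> k" "c' j i \<in> k" if "j \<le> J" "i \<le> Q" for i j
      using c that by (auto simp: I_def C_def PiE_iff)
    hence 1: "\<forall>i\<le>Q. kpoly (P i)" using k_0 k_diff by (auto simp: coeffP)
    have 2: "\<exists>i\<le>Q. P i \<noteq> 0"
    proof (rule ccontr)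
      assume "\<not> ?thesis"
      hence eq: "c j i = c' j i" if "i \<le> Q" "j \<le> J" for i j
        using coeffP[of i j] that by simp
      have "c = c'"
      proof (rule PiE_ext[OF c(1,2)[unfolded I_def]])
        fix j assume j: "j \<in> {..J}"
        show "c j = c' j"
          using c j eq by (intro PiE_ext[of "c j" "{..Q}" "\<lambda>_. k" "c' j"]) (auto simp: I_def C_def PiE_iff)
      qed
      thus False using c by simp
    qed
    have "(\<Sum>i\<le>Q. poly (P i) g * h i) = (\<Sum>i\<le>Q. \<Sum>j\<le>J. g ^ j * (c j i * h i) - g ^ j * (c' j i * h i))"
      unfolding P_def poly_sum poly_monom sum_distrib_right
      by (intro sum.cong refl) (simp add: algebra_simps)
    also have "\<dots> = (\<Sum>j\<le>J. \<Sum>i\<le>Q. g ^ j * (c j i * h i) - g ^ j * (c' j i * h i))"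
      by (rule sum.swap)
    also have "\<dots> = \<Phi> c - \<Phi> c'"
      by (simp add: \<Phi>_def L_def sum_subtractf sum_distrib_left)
    finally have "(\<Sum>i\<le>Q. poly (P i) g * h i) = 0" using c by simp
    thus "\<exists>P. (\<forall>i\<le>Q. kpoly (P i)) \<and> (\<exists>i\<le>Q. P i \<noteq> 0) \<and> (\<Sum>i\<le>Q. poly (P i) g * h i) = 0"
      using 1 2 by blast
  qed
qed

end

section \<open>Existence of places\<close>

lemma poly_eq_sum_atMost:
  fixes P :: "'a::comm_semiring_1 poly"
  assumes "Polynomial.degree P \<le> n"
  shows "poly P x = (\<Sum>i\<le>n. coeff P i * x ^ i)"
  unfolding poly_altdef using assms by (intro sum.mono_neutral_left) (auto simp: coeff_eq_0)

definition subring_of_field :: "'k::field set \<Rightarrow> bool"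
  where "subring_of_field R \<longleftrightarrow> 1 \<in> R \<and> (\<forall>x\<in>R. \<forall>y\<in>R. x - y \<in> R \<and> x * y \<in> R)"

text \<open>Zorn's lemma; maximality among the rings omitting \<open>g\<close> will force a
  valuation ring.\<close>

lemma maximal_subring_exists:
  assumes "subring_of_field A" "g \<notin> A"
  obtains R where "subring_of_field R" "A \<subseteq> R" "g \<notin> R"
    "\<And>R'. subring_of_field R' \<Longrightarrow> R \<subseteq> R' \<Longrightarrow> g \<notin> R' \<Longrightarrow> R' = R"
proof -
  define F where "F = {R. subring_of_field R \<and> A \<subseteq> R \<and> g \<notin> R}"
  have "\<exists>M\<in>F. \<forall>T\<in>F. M \<subseteq> T \<longrightarrow> T = M"
  proof (rule subset_Zorn_nonempty)
    show "F \<noteq> {}" using assms by (auto simp: F_def)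
    fix C assume CC: "C \<noteq> {}" "subset.chain F C"
    have "subring_of_field (\<Union>C)"
      unfolding subring_of_field_def
    proof (intro conjI ballI)
      show "1 \<in> \<Union>C" using CC by (auto simp: subset.chain_def F_def subring_of_field_def)
      fix x y assume "x \<in> \<Union>C" "y \<in> \<Union>C"
      then obtain T Y where XY: "T \<in> C" "Y \<in> C" "x \<in> T" "y \<in> Y" by blast
      hence "T \<subseteq> Y \<or> Y \<subseteq> T" using CC by (auto simp: subset.chain_def)
      then obtain Z where Z: "Z \<in> C" "x \<in> Z" "y \<in> Z" using XY by blast
      hence "subring_of_field Z" using CC by (auto simp: subset.chain_def F_def)
      thus "x - y \<in> \<Union>C" "x * y \<in> \<Union>C" using Z by (auto simp: subring_of_field_def)
    qed
    thus "\<Union>C \<in> F" using CC by (auto simp: subset.chain_def F_def)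
  qed
  then obtain M where "M \<in> F" "\<And>T. T \<in> F \<Longrightarrow> M \<subseteq> T \<Longrightarrow> T = M" by blast
  thus ?thesis by (intro that[of M]) (auto simp: F_def)
qed

text \<open>Chevalley's construction: a ring maximal among those omitting \<open>inverse s\<close>
  turns out to contain \<open>h\<close> or \<open>inverse h\<close> for every
  \<open>h\<close>.\<close>

locale maximal_subring =
  fixes R :: "'k::field set" and s :: 'k
  assumes subring: "subring_of_field R" and s: "s \<in> R" "s \<noteq> 0" "inverse s \<notin> R"
    and maximal: "subring_of_field R' \<Longrightarrow> R \<subseteq> R' \<Longrightarrow> inverse s \<notin> R' \<Longrightarrow> R' = R"
begin

lemma R_1: "1 \<in> R" and R_diff: "x \<in> R \<Longrightarrow> y \<in> R \<Longrightarrow> x - y \<in> R"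
  and R_mult: "x \<in> R \<Longrightarrow> y \<in> R \<Longrightarrow> x * y \<in> R"
  using subring by (auto simp: subring_of_field_def)

lemma R_0: "0 \<in> R" using R_diff[OF R_1 R_1] by simp

lemma R_uminus: "x \<in> R \<Longrightarrow> - x \<in> R" using R_diff[OF R_0] by fastforce

lemma R_add: "x \<in> R \<Longrightarrow> y \<in> R \<Longrightarrow> x + y \<in> R" using R_diff[OF _ R_uminus] by fastforce

lemma R_power: "x \<in> R \<Longrightarrow> x ^ n \<in> R" by (induction n) (auto intro: R_1 R_mult)

lemma R_sum: "(\<And>i. i \<in> I \<Longrightarrow> f i \<in> R) \<Longrightarrow> sum f I \<in> R"
  by (induction I rule: infinite_finite_induct) (auto intro: R_0 R_add)

abbreviation Rpoly :: "'k poly \<Rightarrow> bool" where "Rpoly P \<equiv> \<forall>i. coeff P i \<in> R"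

lemma adjoin:
  assumes "h \<notin> R"
  shows "\<exists>P. Rpoly P \<and> poly P h = inverse s"
proof (rule ccontr)
  assume no: "\<not> ?thesis"
  define R' where "R' = (\<lambda>P. poly P h) ` {P. Rpoly P}"
  have "subring_of_field R'"
    unfolding subring_of_field_def
  proof (intro conjI ballI)
    have "Rpoly 1" using R_0 R_1 by (auto simp: coeff_1)
    thus "1 \<in> R'" unfolding R'_def by (intro image_eqI[of _ _ 1]) auto
    fix x y assume "x \<in> R'" "y \<in> R'"
    then obtain P Q where PQ: "Rpoly P" "Rpoly Q" "x = poly P h" "y = poly Q h" by (auto simp: R'_def)
    have "Rpoly (P - Q)" "Rpoly (P * Q)" using PQ by (auto simp: coeff_mult intro!: R_diff R_sum R_mult)
    thus "x - y \<in> R'" "x * y \<in> R'" unfolding R'_def PQ(3,4)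
      using image_eqI[of _ "\<lambda>P. poly P h" "P - Q"] image_eqI[of _ "\<lambda>P. poly P h" "P * Q"] by simp_all
  qed
  moreover have "R \<subseteq> R'"
  proof
    fix c assume "c \<in> R"
    hence "Rpoly [:c:]" using R_0 by (auto simp: coeff_pCons split: nat.split)
    thus "c \<in> R'" unfolding R'_def by (intro image_eqI[of _ _ "[:c:]"]) auto
  qed
  moreover have "inverse s \<notin> R'" using no by (auto simp: R'_def)
  ultimately have "R' = R" by (rule maximal)
  moreover have "h \<in> R'"
  proof -
    have "Rpoly [:0, 1:]" using R_0 R_1 by (auto simp: coeff_pCons split: nat.split)
    thus ?thesis unfolding R'_def by (intro image_eqI[of _ _ "[:0, 1:]"]) auto
  qed
  ultimately show False using assms by simp
qed

text \<open>If \<open>inverse u\<close> were outside \<open>R\<close>, adjoining it would make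
  \<open>inverse s\<close> a polynomial in \<open>inverse u\<close>. Clearing denominators puts
  \<open>u ^ m / s\<close> into \<open>R\<close>; as \<open>u ^ m\<close> is 1 modulo
  \<open>s\<close>, then \<open>inverse s\<close> would be in \<open>R\<close> too.\<close>

lemma one_plus_s_unit:
  assumes a: "a \<in> R"
  shows "1 + s * a \<noteq> 0" "inverse (1 + s * a) \<in> R"
proof -
  define u where "u = 1 + s * a"
  show nz: "1 + s * a \<noteq> 0"
  proof
    assume "1 + s * a = 0"
    hence "inverse s = - a" using s(2) by (simp add: field_simps add_eq_0_iff)
    thus False using a s(3) R_uminus by simp
  qed
  show "inverse (1 + s * a) \<in> R"
  proof (rule ccontr)
    assume "inverse (1 + s * a) \<notin> R"
    then obtain P where P: "Rpoly P" "poly P (inverse u) = inverse s" using adjoin u_def by blast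
    define m where "m = Polynomial.degree P"
    have uR: "u \<in> R" using a s R_1 R_add R_mult by (auto simp: u_def)
    have u0: "u \<noteq> 0" using nz by (simp add: u_def)
    have "inverse s * u ^ m = (\<Sum>i\<le>m. coeff P i * u ^ (m - i))"
      unfolding P(2)[symmetric] poly_altdef m_def sum_distrib_right
    proof (intro sum.cong refl)
      fix i assume "i \<in> {..Polynomial.degree P}"
      hence "u ^ Polynomial.degree P = u ^ (Polynomial.degree P - i) * u ^ i" by (simp flip: power_add)
      thus "coeff P i * inverse u ^ i * u ^ Polynomial.degree P = coeff P i * u ^ (Polynomial.degree P - i)"
        using u0 by (simp add: field_simps)
    qed
    also have "\<dots> \<in> R" using P uR by (intro R_sum R_mult R_power) auto
    finally have 1: "inverse s * u ^ m \<in> R" .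
    have "\<exists>b\<in>R. u ^ m = 1 + s * b"
    proof (induction m)
      case 0
      thus ?case using R_0 by auto
    next
      case (Suc m)
      then obtain b where b: "b \<in> R" "u ^ m = 1 + s * b" by blast
      have "u ^ Suc m = 1 + s * (b + a + s * a * b)" unfolding power_Suc b(2) by (simp add: u_def algebra_simps)
      moreover have "b + a + s * a * b \<in> R" using b a s by (intro R_add R_mult)
      ultimately show ?case by blast
    qed
    then obtain b where b: "b \<in> R" "u ^ m = 1 + s * b" by blast
    have "inverse s * u ^ m - b = inverse s" using s(2) by (simp add: b field_simps)
    thus False using R_diff[OF 1 b(1)] s(3) by simp
  qed
qed

text \<open>The degree needed to show that 1 lies in the ideal generated by \<open>s\<close> in
  \<open>R[h]\<close>.\<close>

definition relation_deg :: "'k \<Rightarrow> nat \<Rightarrow> bool"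
  where "relation_deg h m \<longleftrightarrow> (\<exists>P. Rpoly P \<and> Polynomial.degree P \<le> m \<and> s * poly P h = 1)"

text \<open>With its constant term moved to the other side, the relation for
  \<open>inverse h\<close> exhibits a unit as a combination of negative powers of \<open>h\<close>.
  Multiplied by \<open>h ^ m\<close>, it rewrites the top term of the relation for \<open>h\<close>
  in lower powers.\<close>

lemma relation_deg_decrease:
  assumes h: "h \<noteq> 0" and "relation_deg h m" "relation_deg (inverse h) l" "l \<le> m"
  shows "0 < m \<and> relation_deg h (m - 1)"
proof -
  obtain P where P: "Rpoly P" "Polynomial.degree P \<le> m" "s * poly P h = 1"
    using assms(2) by (auto simp: relation_deg_def)
  obtain Q where Q: "Rpoly Q" "Polynomial.degree Q \<le> l" "s * poly Q (inverse h) = 1"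
    using assms(3) by (auto simp: relation_deg_def)
  have m: "0 < m"
  proof (rule ccontr)
    assume "\<not> 0 < m"
    then obtain c where "P = [:c:]" using P(2) degree_eq_zeroE by blast
    hence "inverse s = c" "c \<in> R" using P(1)[rule_format, of 0] P(3) s(2) by (auto simp: field_simps)
    thus False using s by simp
  qed
  define w where "w = inverse (1 + s * (- coeff Q 0))"
  have w: "w \<in> R" "1 + s * (- coeff Q 0) \<noteq> 0"
    using one_plus_s_unit[of "- coeff Q 0"] Q R_uminus by (auto simp: w_def)
  have "poly Q (inverse h) = (\<Sum>j\<le>l. coeff Q j * inverse h ^ j)"
    using Q(2) by (rule poly_eq_sum_atMost)
  also have "{..l} = insert 0 {1..l}" by auto
  finally have "poly Q (inverse h) = coeff Q 0 + (\<Sum>j\<in>{1..l}. coeff Q j * inverse h ^ j)" by simp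
  hence "1 = s * (coeff Q 0 + (\<Sum>j\<in>{1..l}. coeff Q j * inverse h ^ j))" using Q(3) by simp
  hence eq: "1 + s * (- coeff Q 0) = s * (\<Sum>j\<in>{1..l}. coeff Q j * inverse h ^ j)"
    by (simp add: algebra_simps)
  have "w * (1 + s * (- coeff Q 0)) = 1" using w(2) by (simp add: w_def)
  hence key: "w * (s * (\<Sum>j\<in>{1..l}. coeff Q j * inverse h ^ j)) = 1"
    unfolding eq .
  define c where "c = coeff P m"
  \<comment> \<open>\<open>key\<close> writes 1 with the exponents -1 to -l, so
    \<open>c * h ^ m\<close> becomes a sum of multiples of \<open>h ^ (m - j)\<close> with
    \<open>1 \<le> j\<close>.\<close>
  define P' where "P' = P - monom c m + (\<Sum>j\<in>{1..l}. monom (s * c * w * coeff Q j) (m - j))"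
  have "poly P' h = poly P h - c * h ^ m + (\<Sum>j\<in>{1..l}. s * c * w * coeff Q j * h ^ (m - j))"
    by (simp add: P'_def poly_monom poly_sum)
  also have "(\<Sum>j\<in>{1..l}. s * c * w * coeff Q j * h ^ (m - j))
      = c * h ^ m * (w * (s * (\<Sum>j\<in>{1..l}. coeff Q j * inverse h ^ j)))"
    unfolding sum_distrib_left
  proof (intro sum.cong refl)
    fix j assume "j \<in> {1..l}"
    hence "h ^ m = h ^ (m - j) * h ^ j" using assms(4) by (simp flip: power_add)
    thus "s * c * w * coeff Q j * h ^ (m - j) = c * h ^ m * (w * (s * (coeff Q j * inverse h ^ j)))"
      using h by (simp add: field_simps)
  qed
  finally have "poly P' h = poly P h" using key by simp
  moreover have "Rpoly P'"
    using P(1) Q(1) w(1) s(1) by (auto simp: P'_def c_def coeff_sum intro!: R_add R_diff R_sum R_mult R_0)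
  moreover have "Polynomial.degree P' \<le> m - 1"
  proof (rule degree_le, intro allI impI)
    fix i assume i: "m - 1 < i"
    have "coeff (\<Sum>j\<in>{1..l}. monom (s * c * w * coeff Q j) (m - j)) i = 0"
      unfolding coeff_sum using i m by (intro sum.neutral) auto
    thus "coeff P' i = 0" using i m P(2)
      by (cases "i = m") (auto simp: P'_def c_def coeff_eq_0)
  qed
  ultimately show ?thesis using P(3) m by (auto simp: relation_deg_def)
qed

text \<open>If both were outside \<open>R\<close>, both would have relations, and the longer one
  could be shortened forever.\<close>

lemma valuation_ring_dichotomy: "h \<in> R \<or> inverse h \<in> R"
proof (rule ccontr)
  assume "\<not> ?thesis"
  hence h: "h \<notin> R" "inverse h \<notin> R" by auto
  hence h0: "h \<noteq> 0" using R_0 by auto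
  have ex: "\<exists>m. relation_deg x m" if x: "x \<notin> R" for x
  proof -
    obtain P where "Rpoly P" "poly P x = inverse s" using adjoin[OF x] by blast
    hence "relation_deg x (Polynomial.degree P)" using s(2) by (auto simp: relation_deg_def)
    thus ?thesis by blast
  qed
  have "\<not> (relation_deg h m \<and> relation_deg (inverse h) l)" for m l
  proof (induction "m + l" arbitrary: m l rule: less_induct)
    case less
    show ?case
    proof
      assume *: "relation_deg h m \<and> relation_deg (inverse h) l"
      show False
      proof (cases "l \<le> m")
        case True
        hence "0 < m \<and> relation_deg h (m - 1)" using relation_deg_decrease h0 * by blast
        thus False using less[of "m - 1" l] * by simp
      next
        case False
        hence "0 < l \<and> relation_deg (inverse h) (l - 1)"
          using relation_deg_decrease[of "inverse h" l m] h0 * by simp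
        thus False using less[of m "l - 1"] * by simp
      qed
    qed
  qed
  thus False using ex h by blast
qed

section \<open>Units and divisibility in the valuation ring\<close>

definition runit :: "'k \<Rightarrow> bool"
  where "runit x \<longleftrightarrow> x \<noteq> 0 \<and> x \<in> R \<and> inverse x \<in> R"

lemma runit_1: "runit 1" using R_1 by (simp add: runit_def)

lemma runit_mult: "runit x \<Longrightarrow> runit y \<Longrightarrow> runit (x * y)"
  using R_mult by (auto simp: runit_def)

lemma runit_inverse: "runit x \<Longrightarrow> runit (inverse x)"
  by (simp add: runit_def)

lemma runit_power: "runit x \<Longrightarrow> runit (x ^ n)"
  by (induction n) (auto intro: runit_1 runit_mult)

lemma runit_uminus: "runit x \<Longrightarrow> runit (- x)"
  by (auto simp: runit_def R_uminus)

text \<open>\<open>R\<close> is local: one of \<open>x\<close>, \<open>y\<close> divides the other,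
  and if the sum were a unit so would be that divisor.\<close>

lemma not_runit_add:
  assumes "x \<in> R" "y \<in> R" "\<not> runit x" "\<not> runit y"
  shows "\<not> runit (x + y)"
proof
  assume u: "runit (x + y)"
  have *: False if "b \<noteq> 0" "a * inverse b \<in> R" "\<not> runit b" "b \<in> R" "runit (a + b)" for a b
  proof -
    have eq: "inverse b = (a * inverse b + 1) * inverse (a + b)"
      using that by (simp add: runit_def field_simps)
    have "inverse (a + b) \<in> R" using that by (simp add: runit_def)
    hence "inverse b \<in> R" by (subst eq) (intro R_mult R_add[OF that(2) R_1])
    thus False using that by (auto simp: runit_def)
  qed
  show False
  proof (cases "x = 0 \<or> y = 0")
    case True
    thus ?thesis using u assms by auto
  next
    case False
    have "x * inverse y \<in> R \<or> y * inverse x \<in> R"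
      using valuation_ring_dichotomy[of "x * inverse y"] False by (simp add: mult.commute)
    thus ?thesis using *[of y x] *[of x y] False assms u by (auto simp: add.commute)
  qed
qed

lemma not_runit_sum:
  assumes "finite I" "\<And>i. i \<in> I \<Longrightarrow> t i \<in> R \<and> \<not> runit (t i)"
  shows "\<not> runit (sum t I)"
  using assms
proof (induction I)
  case (insert i I)
  thus ?case using not_runit_add[of "t i" "sum t I"] R_sum[of I t] by auto
qed (simp add: runit_def)

lemma dominating_term:
  assumes "finite I" "I \<noteq> {}" "\<And>i. i \<in> I \<Longrightarrow> t i \<noteq> 0"
  shows "\<exists>m\<in>I. \<forall>i\<in>I. t i * inverse (t m) \<in> R"
  using assms
proof (induction I rule: finite_ne_induct)
  case (singleton i)
  thus ?case using R_1 by simp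
next
  case (insert i I)
  then obtain m where m: "m \<in> I" "\<forall>j\<in>I. t j * inverse (t m) \<in> R" by auto
  have nz: "t i \<noteq> 0" "t m \<noteq> 0" using insert.prems m by auto
  show ?case
  proof (cases "t i * inverse (t m) \<in> R")
    case True
    thus ?thesis using m by auto
  next
    case False
    hence im: "t m * inverse (t i) \<in> R"
      using valuation_ring_dichotomy[of "t i * inverse (t m)"] nz by (simp add: mult.commute)
    have "t j * inverse (t i) \<in> R" if "j \<in> I" for j
    proof -
      have "t j * inverse (t i) = (t j * inverse (t m)) * (t m * inverse (t i))" using nz by simp
      thus ?thesis using im m that R_mult by metis
    qed
    thus ?thesis using nz R_1 by (intro bexI[of _ i]) auto
  qed
qed

lemma runit_s_powi: "runit (s powi e) \<Longrightarrow> e = 0"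
proof (rule ccontr)
  assume u: "runit (s powi e)" and "e \<noteq> 0"
  have *: False if "runit (s ^ Suc n)" for n
  proof -
    have eq: "inverse s = s ^ n * inverse (s ^ Suc n)" using s(2) by (simp add: field_simps)
    have "s ^ n * inverse (s ^ Suc n) \<in> R"
      using that R_power[OF s(1)] R_mult by (simp only: runit_def)
    hence "inverse s \<in> R" by (subst eq)
    thus False using s(3) by blast
  qed
  show False
  proof (cases "0 < e")
    case True
    then obtain n where "e = int (Suc n)" by (metis zero_less_imp_eq_int gr0_implies_Suc)
    thus ?thesis using *[of n] u by (metis power_int_of_nat)
  next
    case False
    then obtain n where "- e = int (Suc n)" using \<open>e \<noteq> 0\<close>
      by (metis zero_less_imp_eq_int gr0_implies_Suc neg_0_less_iff_less linorder_neqE)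
    hence "inverse (s powi e) = s ^ Suc n" by (metis power_int_minus power_int_of_nat)
    thus ?thesis using *[of n] runit_inverse[OF u] by simp
  qed
qed

end

context growth_field
begin

text \<open>A maximal subring omitting \<open>g\<close> is a valuation ring, but its value group is
  still unknown. \<open>bounded_independence\<close> shows that every \<open>h\<close> has a power
  with exponent at most \<open>N\<close> which is a power of \<open>s\<close> up to a unit. So the
  exponent of \<open>s\<close> attached to \<open>h ^ fact N\<close> is an integral valuation, and
  dividing it by its least positive value normalizes it.\<close>

lemma exists_pole:
  assumes g: "\<not> torsion g"
  shows "\<exists>v. prime_divisor k v \<and> v g < 0"
proof -
  have g0: "g \<noteq> 0" using g torsion_0 by auto
  define s where "s = inverse g"
  have s0: "s \<noteq> 0" using g0 by (simp add: s_def)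
  have tors: "\<not> torsion s" using g by (simp add: s_def torsion_inverse)
  define A where "A = (\<lambda>P. poly P s) ` {P. kpoly P}"
  have A: "subring_of_field A"
    unfolding subring_of_field_def
  proof (intro conjI ballI)
    have "kpoly 1" using k_0 k_1 by (auto simp: coeff_1)
    thus "1 \<in> A" unfolding A_def by (intro image_eqI[of _ _ 1]) auto
    fix x y assume "x \<in> A" "y \<in> A"
    then obtain P Q where PQ: "kpoly P" "kpoly Q" "x = poly P s" "y = poly Q s" by (auto simp: A_def)
    have "kpoly (P - Q)" "kpoly (P * Q)" using PQ kpoly_mult k_diff by auto
    thus "x - y \<in> A" "x * y \<in> A" unfolding A_def PQ(3,4)
      using image_eqI[of _ "\<lambda>P. poly P s" "P - Q"] image_eqI[of _ "\<lambda>P. poly P s" "P * Q"] by simp_all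
  qed
  have gA: "g \<notin> A"
  proof
    assume "g \<in> A"
    then obtain P where P: "kpoly P" "g = poly P s" by (auto simp: A_def)
    have "poly (pCons (-1) P) s = 0" using P(2) g0 by (simp add: s_def)
    moreover have "kpoly (pCons (-1) P)" using P(1) k_1 k_uminus by (intro kpoly_pCons) auto
    ultimately show False using torsion_if_algebraic[of "pCons (-1) P" s] tors by simp
  qed
  obtain R where R: "subring_of_field R" "A \<subseteq> R" "g \<notin> R"
    "\<And>R'. subring_of_field R' \<Longrightarrow> R \<subseteq> R' \<Longrightarrow> g \<notin> R' \<Longrightarrow> R' = R"
    using maximal_subring_exists[OF A gA] by blast
  have kR: "k \<subseteq> R"
  proof
    fix c assume "c \<in> k"
    hence "kpoly [:c:]" using k_0 by (auto simp: coeff_pCons split: nat.split)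
    hence "poly [:c:] s \<in> A" unfolding A_def by blast
    thus "c \<in> R" using R(2) by auto
  qed
  have sR: "s \<in> R"
  proof -
    have "kpoly [:0, 1:]" using k_0 k_1 by (auto simp: coeff_pCons split: nat.split)
    hence "poly [:0, 1:] s \<in> A" unfolding A_def by blast
    thus "s \<in> R" using R(2) by auto
  qed
  interpret maximal_subring R s
    using R sR s0 by unfold_locales (auto simp: s_def)
  have runit_k: "runit c" if "c \<in> k" "c \<noteq> 0" for c
    using that kR k_inverse by (auto simp: runit_def)
  have polyR: "poly P s \<in> R" if "kpoly P" for P using that R(2) by (auto simp: A_def)
  \<comment> \<open>The lowest nonzero coefficient is a unit and \<open>1 + s * R\<close> consists
    of units, so up to units only powers of \<open>s\<close> occur as coefficients of the relations
    below.\<close>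
  have poly_unit: "\<exists>e u. runit u \<and> poly P s = s ^ e * u" if "P \<noteq> 0" "kpoly P" for P
    using that
  proof (induction P)
    case (pCons a P)
    have a: "a \<in> k" using pCons.prems(2)[rule_format, of 0] by simp
    have P: "kpoly P" using pCons.prems(2) by (metis coeff_pCons_Suc)
    show ?case
    proof (cases "a = 0")
      case True
      then obtain e u where "runit u" "poly P s = s ^ e * u" using pCons P by auto
      thus ?thesis using True by (intro exI[of _ "Suc e"] exI[of _ u]) auto
    next
      case False
      have "inverse a * poly P s \<in> R" using a k_inverse kR polyR[OF P] by (intro R_mult) auto
      hence "runit (1 + s * (inverse a * poly P s))"
        using one_plus_s_unit sR R_mult R_add R_1 by (simp only: runit_def) blast
      hence "runit (a * (1 + s * (inverse a * poly P s)))" using runit_mult runit_k[OF a False] by blast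
      also have "a * (1 + s * (inverse a * poly P s)) = poly (pCons a P) s"
        using False by (simp add: algebra_simps)
      finally show ?thesis by (intro exI[of _ 0] exI[of _ "poly (pCons a P) s"]) auto
    qed
  qed simp
  obtain N where N: "\<And>h :: nat \<Rightarrow> 'k. \<exists>P. (\<forall>i\<le>N. kpoly (P i)) \<and> (\<exists>i\<le>N. P i \<noteq> 0) \<and>
    (\<Sum>i\<le>N. poly (P i) s * h i) = 0" using bounded_independence[of s] by blast
  \<comment> \<open>Divide a vanishing sum by its dominating term: the remaining terms add up to -1,
    and in a local ring one of them must be a unit. Thus two terms of the relation agree up to a
    unit.\<close>
  have rel: "\<exists>d e. 0 < d \<and> d \<le> N \<and> runit (h ^ d * s powi e)" if h: "h \<noteq> 0" for h
  proof -
    obtain P where P: "\<forall>i\<le>N. kpoly (P i)" "\<exists>i\<le>N. P i \<noteq> 0" "(\<Sum>i\<le>N. poly (P i) s * h ^ i) = 0"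
      using N[of "\<lambda>i. h ^ i"] by blast
    define I where "I = {i. i \<le> N \<and> P i \<noteq> 0}"
    have I: "finite I" "I \<noteq> {}" using P(2) by (auto simp: I_def)
    have "\<forall>i\<in>I. \<exists>e u. runit u \<and> poly (P i) s = s ^ e * u" using poly_unit P(1) by (auto simp: I_def)
    then obtain e u where eu: "\<And>i. i \<in> I \<Longrightarrow> runit (u i)" "\<And>i. i \<in> I \<Longrightarrow> poly (P i) s = s ^ e i * u i"
      by metis
    define t where "t i = s ^ e i * u i * h ^ i" for i
    have t0: "t i \<noteq> 0" if "i \<in> I" for i using eu(1)[OF that] s0 h by (auto simp: t_def runit_def)
    obtain m where m: "m \<in> I" "\<forall>i\<in>I. t i * inverse (t m) \<in> R"
      using dominating_term[of I t] I t0 by blast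
    have "(\<Sum>i\<in>I. t i) = (\<Sum>i\<in>I. poly (P i) s * h ^ i)" by (intro sum.cong) (auto simp: t_def eu)
    also have "\<dots> = (\<Sum>i\<le>N. poly (P i) s * h ^ i)"
      by (intro sum.mono_neutral_left) (auto simp: I_def)
    finally have "(\<Sum>i\<in>I. t i * inverse (t m)) = 0" using P(3) by (simp flip: sum_distrib_right)
    moreover have "(\<Sum>i\<in>I. t i * inverse (t m)) = t m * inverse (t m) + (\<Sum>i\<in>I - {m}. t i * inverse (t m))"
      using I m by (intro sum.remove) auto
    ultimately have "(\<Sum>i\<in>I - {m}. t i * inverse (t m)) = - 1"
      using t0[OF m(1)] by (simp add: eq_neg_iff_add_eq_0 add.commute)
    hence "runit (\<Sum>i\<in>I - {m}. t i * inverse (t m))" using runit_uminus[OF runit_1] by simp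
    then obtain i where i: "i \<in> I" "i \<noteq> m" "runit (t i * inverse (t m))"
      using not_runit_sum[of "I - {m}" "\<lambda>i. t i * inverse (t m)"] I m by auto
    have "\<exists>d e. 0 < d \<and> d \<le> N \<and> runit (h ^ d * s powi e)"
      if ab: "a \<in> I" "b \<in> I" "a < b" "runit (t b * inverse (t a))" for a b
    proof -
      have "runit (t b * inverse (t a) * (u a * inverse (u b)))"
        using ab eu runit_mult runit_inverse by metis
      also have "t b * inverse (t a) * (u a * inverse (u b)) = h ^ (b - a) * s powi (int (e b) - int (e a))"
      proof -
        have "h ^ b = h ^ (b - a) * h ^ a" using ab(3) by (simp flip: power_add)
        moreover have "u a \<noteq> 0" "u b \<noteq> 0" using eu ab by (auto simp: runit_def)
        ultimately show ?thesis using s0 h unfolding t_def by (simp add: power_int_diff field_simps)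
      qed
      finally show ?thesis using ab by (intro exI[of _ "b - a"] exI) (auto simp: I_def)
    qed
    from this[of i m] this[of m i] show ?thesis
      using i m runit_inverse[OF i(3)] by (cases "i < m") (auto simp: mult.commute)
  qed
  \<comment> \<open>A common multiple of all exponents \<open>d \<le> N\<close>, so that one
    exponent serves every \<open>h\<close>.\<close>
  define M where "M = (fact N :: nat)"
  have M0: "0 < M" by (simp add: M_def)
  have "\<exists>e. runit (h ^ M * s powi (- e))" if h: "h \<noteq> 0" for h
  proof -
    obtain d e where de: "0 < d" "d \<le> N" "runit (h ^ d * s powi e)" using rel[OF h] by blast
    have "d dvd M" unfolding M_def using de by (intro dvd_fact) auto
    then obtain c where c: "M = d * c" by blast
    have "(h ^ d * s powi e) ^ c = h ^ M * s powi (- (- e * int c))"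
      by (simp add: c power_mult_distrib power_mult power_int_mult)
    thus ?thesis using runit_power[OF de(3), of c] by metis
  qed
  then obtain V' where V': "\<And>h. h \<noteq> 0 \<Longrightarrow> runit (h ^ M * s powi (- V' h))" by metis
  define V where "V h = (if h = 0 then 0 else V' h)" for h
  have V: "runit (h ^ M * s powi (- V h))" if "h \<noteq> 0" for h using V' that by (simp add: V_def)
  have V_eq: "V h = e" if "h \<noteq> 0" "runit (h ^ M * s powi (- e))" for h e
  proof -
    have "runit ((h ^ M * s powi (- e)) * inverse (h ^ M * s powi (- V h)))"
      using V that runit_mult runit_inverse by metis
    also have "(h ^ M * s powi (- e)) * inverse (h ^ M * s powi (- V h)) = s powi (V h - e)"
      using that s0 by (simp add: power_int_diff power_int_minus field_simps)
    finally show ?thesis using runit_s_powi by force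
  qed
  have V_mult: "V (x * y) = V x + V y" if "x \<noteq> 0" "y \<noteq> 0" for x y
  proof (rule V_eq)
    have "runit ((x ^ M * s powi (- V x)) * (y ^ M * s powi (- V y)))"
      using V that runit_mult by blast
    also have "(x ^ M * s powi (- V x)) * (y ^ M * s powi (- V y)) = (x * y) ^ M * s powi (- (V x + V y))"
      using s0 by (simp add: power_mult_distrib power_int_add power_int_minus power_int_diff field_simps)
    finally show "runit ((x * y) ^ M * s powi (- (V x + V y)))" .
  qed (use that in auto)
  have V_s: "V s = int M"
    using s0 runit_1 by (intro V_eq) (auto simp: power_int_minus)
  have V_unit: "V x = 0" if "runit x" for x
    using that runit_power[OF that, of M] by (intro V_eq) (auto simp: runit_def)
  have V_R: "0 \<le> V x" if "x \<in> R" "x \<noteq> 0" for x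
  proof (rule ccontr)
    assume "\<not> 0 \<le> V x"
    then obtain n where n: "- V x = int (Suc n)" by (metis not_le neg_0_less_iff_less zero_less_imp_eq_int gr0_implies_Suc)
    hence u: "runit (x ^ M * s ^ Suc n)" using V[OF that(2)] by (metis power_int_of_nat)
    have eq: "inverse s = x ^ M * s ^ n * inverse (x ^ M * s ^ Suc n)" using s0 that by (simp add: field_simps)
    have "x ^ M * s ^ n * inverse (x ^ M * s ^ Suc n) \<in> R"
      using u that sR by (intro R_mult R_power) (auto simp: runit_def)
    hence "inverse s \<in> R" by (subst eq)
    thus False using s(3) by blast
  qed
  have R_V: "x \<in> R" if "0 \<le> V x" "x \<noteq> 0" for x
  proof (rule ccontr)
    assume x: "x \<notin> R"
    hence ix: "inverse x \<in> R" using valuation_ring_dichotomy by blast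
    have "V x + V (inverse x) = 0" using V_mult[of x "inverse x"] that V_unit[OF runit_1] by simp
    hence "V x = 0" using V_R[OF ix] that by simp
    hence u: "runit (x ^ M)" using V[OF that(2)] by simp
    have eq: "x = x ^ M * inverse x ^ (M - 1)"
    proof -
      have "x ^ M = x ^ (M - 1) * x" using M0 by (metis Suc_diff_1 power_Suc2)
      thus ?thesis using that by (simp add: field_simps)
    qed
    have "x ^ M * inverse x ^ (M - 1) \<in> R"
      using u by (intro R_mult R_power[OF ix]) (simp add: runit_def)
    hence "x \<in> R" by (subst eq)
    thus False using x by blast
  qed
  have V_add: "min (V x) (V y) \<le> V (x + y)" if "x \<noteq> 0" "y \<noteq> 0" "x + y \<noteq> 0" for x y
  proof -
    have *: "V a \<le> V (a + b)" if "V a \<le> V b" "a \<noteq> 0" "b \<noteq> 0" "a + b \<noteq> 0" for a b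
    proof -
      have "b = a * (inverse a * b)" using that by (simp add: field_simps)
      also have "V \<dots> = V a + V (inverse a * b)" using that by (intro V_mult) auto
      finally have "V b = V a + V (inverse a * b)" .
      hence "inverse a * b \<in> R" using that by (intro R_V) auto
      hence "1 + inverse a * b \<in> R" using R_1 R_add by blast
      moreover have ab: "a + b = a * (1 + inverse a * b)" using that by (simp add: field_simps)
      ultimately have "0 \<le> V (1 + inverse a * b)" using that by (intro V_R) auto
      thus ?thesis using V_mult[of a "1 + inverse a * b"] that ab by (cases "1 + inverse a * b = 0") auto
    qed
    show ?thesis using *[of x y] *[of y x] that by (cases "V x \<le> V y") (auto simp: add.commute)
  qed
  have V_power: "V (x ^ n) = int n * V x" if "x \<noteq> 0" for x n
    using that V_unit[OF runit_1] by (induction n) (auto simp: V_mult algebra_simps)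
  have V_inv: "V (inverse x) = - V x" if "x \<noteq> 0" for x
    using V_mult[of x "inverse x"] that V_unit[OF runit_1] by simp
  \<comment> \<open>The positive generator of the value group; \<open>dvd\<close> below is division
    with remainder.\<close>
  define d where "d = (LEAST n. 0 < n \<and> (\<exists>x. x \<noteq> 0 \<and> V x = int n))"
  have "0 < d \<and> (\<exists>x. x \<noteq> 0 \<and> V x = int d)" unfolding d_def
    by (rule LeastI[of _ M]) (use M0 V_s s0 in auto)
  then obtain \<pi> where d: "0 < d" "\<pi> \<noteq> 0" "V \<pi> = int d" by blast
  have dvd: "int d dvd V x" for x
  proof (cases "x = 0")
    case False
    define z where "z = x * inverse \<pi> powi (V x div int d)"
    define n where "n = nat \<bar>V x div int d\<bar>"
    have z: "z \<noteq> 0" using False d by (simp add: z_def)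
    have "V (inverse \<pi> powi (V x div int d)) = - int d * (V x div int d)"
      using d V_power[of "inverse \<pi>" n] V_power[of \<pi> n] V_inv[of \<pi>]
      by (cases "0 \<le> V x div int d") (auto simp: power_int_def n_def)
    hence "V z = V x mod int d" using False d
      by (simp add: z_def V_mult minus_div_mult_eq_mod[symmetric])
    hence Vz: "0 \<le> V z" "V z < int d" using d by auto
    have "V z = 0"
    proof (rule ccontr)
      assume "V z \<noteq> 0"
      hence "0 < nat (V z) \<and> (\<exists>x. x \<noteq> 0 \<and> V x = int (nat (V z)))" using Vz z by auto
      hence "d \<le> nat (V z)" unfolding d_def by (rule Least_le)
      thus False using Vz by simp
    qed
    thus ?thesis using \<open>V z = V x mod int d\<close> by auto
  qed (simp add: V_def)
  define v where "v x = V x div int d" for x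
  have vd: "V x = v x * int d" for x using dvd[of x] by (simp add: v_def)
  have "prime_divisor k v"
    unfolding prime_divisor_def
  proof (intro conjI allI impI ballI)
    show "v 0 = 0" by (simp add: v_def V_def)
    show "v (x * y) = v x + v y" if "x \<noteq> 0" "y \<noteq> 0" for x y
      using V_mult[OF that] d dvd by (simp add: v_def div_plus_div_distrib_dvd_left)
    show "min (v x) (v y) \<le> v (x + y)" if "x \<noteq> 0" "y \<noteq> 0" "x + y \<noteq> 0" for x y
    proof -
      have "min (v x * int d) (v y * int d) \<le> v (x + y) * int d" using V_add[OF that] by (simp add: vd)
      thus ?thesis using d by (auto simp: min_le_iff_disj)
    qed
    show "v c = 0" if "c \<in> k" "c \<noteq> 0" for c using V_unit runit_k[OF that] by (simp add: v_def)
    show "\<exists>x. x \<noteq> 0 \<and> v x = 1" using d by (intro exI[of _ \<pi>]) (simp add: v_def)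
  qed
  moreover have "v g < 0"
  proof -
    have "V g = - int M" using V_inv[OF s0] V_s g0 by (simp add: s_def)
    hence "v g * int d < 0" using M0 vd by simp
    thus ?thesis using d by (simp add: mult_less_0_iff)
  qed
  ultimately show ?thesis by blast
qed

lemma torsion_if_no_poles: "(\<And>v. prime_divisor k v \<Longrightarrow> val_ge v g 0) \<Longrightarrow> torsion g"
  using exists_pole[of g] torsion_0 by (fastforce simp: val_ge_def)

end

section \<open>Counting and the product formula\<close>

text \<open>Subtract from each element a fixed representative of its fibre.\<close>

lemma fiber_card_bound:
  fixes U :: "'a::ab_group_add set"
  assumes "finite R" "finite Y" "\<phi> ` U \<subseteq> R"
    and "\<And>x y. x \<in> U \<Longrightarrow> y \<in> U \<Longrightarrow> \<phi> x = \<phi> y \<Longrightarrow> x - y \<in> Y"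
  shows "finite U \<and> card U \<le> card R * card Y"
proof -
  define f where "f x = (\<phi> x, x - inv_into U \<phi> (\<phi> x))" for x
  have sub: "f ` U \<subseteq> R \<times> Y"
    using assms(3,4) by (auto simp: f_def f_inv_into_f inv_into_into)
  have inj: "inj_on f U"
  proof (rule inj_onI)
    fix x y assume "f x = f y"
    hence "\<phi> x = \<phi> y" "x - inv_into U \<phi> (\<phi> x) = y - inv_into U \<phi> (\<phi> y)" by (auto simp: f_def)
    thus "x = y" by simp
  qed
  have fin: "finite (R \<times> Y)" using assms by simp
  show ?thesis
    using inj_on_finite[OF inj sub fin] card_inj_on_le[OF inj sub fin] by (simp add: card_cartesian_product)
qed

context growth_field
begin

abbreviation PD :: "('k \<Rightarrow> int) set" where "PD \<equiv> {v. prime_divisor k v}"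

abbreviation deg :: "('k \<Rightarrow> int) \<Rightarrow> nat" where "deg \<equiv> pdegree k"

lemma max_v_inverse: "v \<in> PD \<Longrightarrow> max 0 (v (inverse x)) = - min 0 (v x)"
  by (simp add: v_inverse max_def min_def)

definition fin_supp :: "(('k \<Rightarrow> int) \<Rightarrow> int) \<Rightarrow> bool"
  where "fin_supp c \<longleftrightarrow> finite {v\<in>PD. c v \<noteq> 0}"

lemma fin_supp_value: "fin_supp (\<lambda>v. v x)"
  using finite_support[of x] by (simp add: fin_supp_def)

lemma fin_supp_0: "fin_supp (\<lambda>_. 0)"
  by (simp add: fin_supp_def)

lemma fin_supp_comb:
  assumes "fin_supp c" "fin_supp d" "\<And>v. c v = 0 \<Longrightarrow> d v = 0 \<Longrightarrow> e v = 0"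
  shows "fin_supp e"
  using assms unfolding fin_supp_def
  by (auto intro: finite_subset[of _ "{v\<in>PD. c v \<noteq> 0} \<union> {v\<in>PD. d v \<noteq> 0}"])

lemma fin_supp_if_zero: "fin_supp c \<Longrightarrow> (\<And>v. c v = 0 \<Longrightarrow> e v = 0) \<Longrightarrow> fin_supp e"
  by (rule fin_supp_comb[of c c])

lemma fin_supp_add: "fin_supp c \<Longrightarrow> fin_supp d \<Longrightarrow> fin_supp (\<lambda>v. c v + d v)"
  by (rule fin_supp_comb[of c d]) auto

lemma fin_supp_sum: "(\<And>i. i \<in> I \<Longrightarrow> fin_supp (c i)) \<Longrightarrow> fin_supp (\<lambda>v. \<Sum>i\<in>I. c i v)"
  by (induction I rule: infinite_finite_induct) (auto simp: fin_supp_0 fin_supp_add)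

text \<open>Effective divisors. They are the error terms of the local estimates: by
  \<open>fin_supp_bound\<close> each contributes a bounded amount to a height.\<close>

definition adm :: "(('k \<Rightarrow> int) \<Rightarrow> int) \<Rightarrow> bool"
  where "adm c \<longleftrightarrow> fin_supp c \<and> (\<forall>v. 0 \<le> c v)"

lemma adm_add: "adm c \<Longrightarrow> adm d \<Longrightarrow> adm (\<lambda>v. c v + d v)"
  by (auto simp: adm_def fin_supp_add)

lemma adm_scale: "adm c \<Longrightarrow> adm (\<lambda>v. int n * c v)"
  by (auto simp: adm_def intro: fin_supp_if_zero)

lemma adm_abs_value: "adm (\<lambda>v. \<bar>v x\<bar>)"
  by (auto simp: adm_def intro: fin_supp_if_zero[OF fin_supp_value[of x]])

lemma adm_sum: "(\<And>i. i \<in> I \<Longrightarrow> adm (c i)) \<Longrightarrow> adm (\<lambda>v. \<Sum>i\<in>I. c i v)"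
  by (auto simp: adm_def intro: fin_supp_sum sum_nonneg)

lemma fin_supp_bound:
  assumes "fin_supp c" "\<And>v. 0 \<le> c v"
  obtains C where "0 \<le> C" "\<And>T. finite T \<Longrightarrow> T \<subseteq> PD \<Longrightarrow> (\<Sum>v\<in>T. c v * int (deg v)) \<le> C"
proof (rule that[of "\<Sum>v\<in>{v\<in>PD. c v \<noteq> 0}. c v * int (deg v)"])
  show "0 \<le> (\<Sum>v\<in>{v\<in>PD. c v \<noteq> 0}. c v * int (deg v))" using assms(2) by (intro sum_nonneg) auto
  fix T assume T: "finite T" "T \<subseteq> PD"
  have "(\<Sum>v\<in>T. c v * int (deg v)) = (\<Sum>v\<in>{v\<in>T. c v \<noteq> 0}. c v * int (deg v))"
    using T by (intro sum.mono_neutral_right) auto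
  also have "\<dots> \<le> (\<Sum>v\<in>{v\<in>PD. c v \<noteq> 0}. c v * int (deg v))"
    using assms T by (intro sum_mono2) (auto simp: fin_supp_def)
  finally show "(\<Sum>v\<in>T. c v * int (deg v)) \<le> (\<Sum>v\<in>{v\<in>PD. c v \<noteq> 0}. c v * int (deg v))" .
qed

text \<open>The Riemann-Roch space of the divisor \<open>- A\<close>.\<close>

definition RR :: "(('k \<Rightarrow> int) \<Rightarrow> int) \<Rightarrow> 'k set"
  where "RR A = {x. \<forall>v\<in>PD. val_ge v x (A v)}"

lemma RR_antimono: "(\<And>v. v \<in> PD \<Longrightarrow> B v \<le> A v) \<Longrightarrow> RR A \<subseteq> RR B"
  unfolding RR_def using val_ge_mono by blast

lemma RR_diff: "x \<in> RR A \<Longrightarrow> y \<in> RR A \<Longrightarrow> x - y \<in> RR A"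
  by (auto simp: RR_def intro: val_ge_diff)

text \<open>Raising the condition at \<open>v\<close> by one kills one coefficient in the residue
  field, which has \<open>q ^ deg v\<close> elements.\<close>

lemma RR_step:
  assumes v: "v \<in> PD" and fin: "finite (RR (A(v := A v + 1)))"
  shows "finite (RR A) \<and> card (RR A) \<le> q ^ deg v * card (RR (A(v := A v + 1)))"
proof -
  have pv: "prime_divisor k v" using v by simp
  obtain t where t: "t \<noteq> 0" "v t = A v" using elem_of_value_exists[OF pv] by blast
  have scale: "val_ge v (x / t) a \<longleftrightarrow> val_ge v x (a + A v)" for x a
    using t val_ge_cancel[OF pv t(1), of "x / t" a] by simp
  have "finite (RR A) \<and> card (RR A) \<le> card (carrier (residue_field v)) * card (RR (A(v := A v + 1)))"
  proof (rule fiber_card_bound[where \<phi> = "\<lambda>x. residue_class v (x / t)"])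
    show "(\<lambda>x. residue_class v (x / t)) ` RR A \<subseteq> carrier (residue_field v)"
      using v by (auto simp: residue_field_carrier scale RR_def)
    fix x y assume xy: "x \<in> RR A" "y \<in> RR A" "residue_class v (x / t) = residue_class v (y / t)"
    hence "val_ge v ((x - y) / t) 1" by (simp add: residue_class_eq_iff[OF pv] diff_divide_distrib)
    thus "x - y \<in> RR (A(v := A v + 1))"
      using RR_diff[OF xy(1,2)] by (auto simp: RR_def scale add.commute)
  qed (use fin finite_residue_field[OF pv] in auto)
  thus ?thesis using card_residue[OF pv] by simp
qed

lemma RR_steps:
  assumes v: "v \<in> PD" and fin: "finite (RR (A(v := A v + int n)))"
  shows "finite (RR A) \<and> card (RR A) \<le> q ^ (n * deg v) * card (RR (A(v := A v + int n)))"
  using fin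
proof (induction n arbitrary: A)
  case 0
  thus ?case by simp
next
  case (Suc n)
  define B where "B = A(v := A v + 1)"
  have eq: "B(v := B v + int n) = A(v := A v + int (Suc n))" by (auto simp: B_def)
  have IH: "finite (RR B)" "card (RR B) \<le> q ^ (n * deg v) * card (RR (A(v := A v + int (Suc n))))"
    using Suc.IH[of B] Suc.prems by (simp_all only: eq)
  have st: "finite (RR A)" "card (RR A) \<le> q ^ deg v * card (RR B)"
    using RR_step[OF v, of A] IH(1) unfolding B_def by auto
  have "q ^ deg v * card (RR B) \<le> q ^ deg v * (q ^ (n * deg v) * card (RR (A(v := A v + int (Suc n)))))"
    using IH(2) by (rule mult_le_mono2)
  with st(2) have le: "card (RR A) \<le> q ^ deg v * (q ^ (n * deg v) * card (RR (A(v := A v + int (Suc n)))))"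
    by (rule order_trans)
  have "q ^ deg v * (q ^ (n * deg v) * m) = q ^ (Suc n * deg v) * m" for m
    by (simp add: power_add)
  with le st(1) show ?case by metis
qed

text \<open>One place of \<open>T\<close> is changed at a time; at the remaining places
  \<open>A\<close> is at least as strict as \<open>B\<close>, so inclusion suffices.\<close>

lemma RR_compare:
  assumes "finite T" "T \<subseteq> PD" "\<And>v. v \<in> PD \<Longrightarrow> v \<notin> T \<Longrightarrow> B v \<le> A v"
    "\<And>v. v \<in> T \<Longrightarrow> A v \<le> B v" "finite (RR B)"
  shows "finite (RR A) \<and> card (RR A) \<le> q ^ nat (\<Sum>v\<in>T. (B v - A v) * int (deg v)) * card (RR B)"
  using assms
proof (induction T arbitrary: A)
  case empty
  hence "RR A \<subseteq> RR B" by (intro RR_antimono) auto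
  thus ?case using empty by (auto intro: finite_subset card_mono)
next
  case (insert w T)
  define A' where "A' = A(w := B w)"
  have IH: "finite (RR A') \<and> card (RR A') \<le> q ^ nat (\<Sum>v\<in>T. (B v - A' v) * int (deg v)) * card (RR B)"
    using insert.prems insert.hyps by (intro insert.IH) (auto simp: A'_def)
  have sum: "(\<Sum>v\<in>T. (B v - A' v) * int (deg v)) = (\<Sum>v\<in>T. (B v - A v) * int (deg v))"
    using insert.hyps by (intro sum.cong) (auto simp: A'_def)
  have nn: "0 \<le> (\<Sum>v\<in>T. (B v - A v) * int (deg v))"
    using insert.prems by (intro sum_nonneg) auto
  define n where "n = nat (B w - A w)"
  have n: "int n = B w - A w" using insert.prems(3)[of w] by (simp add: n_def)
  have A': "A' = A(w := A w + int n)" using n by (simp add: A'_def)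
  have st: "finite (RR A) \<and> card (RR A) \<le> q ^ (n * deg w) * card (RR A')"
    unfolding A' by (rule RR_steps) (use insert.prems IH A' in auto)
  have "q ^ (n * deg w) * card (RR A')
      \<le> q ^ (n * deg w) * (q ^ nat (\<Sum>v\<in>T. (B v - A v) * int (deg v)) * card (RR B))"
    using IH sum by (intro mult_le_mono2) simp
  also have "\<dots> = q ^ nat (\<Sum>v\<in>insert w T. (B v - A v) * int (deg v)) * card (RR B)"
  proof -
    have "nat (\<Sum>v\<in>insert w T. (B v - A v) * int (deg v))
        = n * deg w + nat (\<Sum>v\<in>T. (B v - A v) * int (deg v))"
      using insert.hyps nn by (simp add: n[symmetric] nat_add_distrib nat_mult_distrib)
    thus ?thesis by (simp add: power_add)
  qed
  finally show ?case using st by (auto intro: order_trans)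
qed

text \<open>A nonzero element without poles is torsion, hence has value 0; so these elements are
  determined by their residue at a single place.\<close>

lemma finite_RR_0:
  assumes v: "v \<in> PD"
  shows "finite (RR (\<lambda>_. 0))"
proof -
  have pv: "prime_divisor k v" using v by simp
  have "inj_on (residue_class v) (RR (\<lambda>_. 0))"
  proof (rule inj_onI)
    fix x y assume xy: "x \<in> RR (\<lambda>_. 0)" "y \<in> RR (\<lambda>_. 0)" "residue_class v x = residue_class v y"
    have "torsion (x - y)" using RR_diff[OF xy(1,2)] by (intro torsion_if_no_poles) (auto simp: RR_def)
    hence "v (x - y) = 0" by (rule torsion_value_0[OF pv])
    thus "x = y" using xy(3) by (auto simp: residue_class_eq_iff[OF pv] val_ge_def)
  qed
  moreover have "residue_class v ` RR (\<lambda>_. 0) \<subseteq> carrier (residue_field v)"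
    using v by (auto simp: residue_field_carrier RR_def)
  ultimately show ?thesis using finite_residue_field[OF pv] inj_on_finite by blast
qed

section \<open>Heights and the product formula\<close>

lemma height_eq_sum:
  assumes "finite T" "T \<subseteq> PD" "\<And>v. v \<in> PD \<Longrightarrow> 0 < v x \<Longrightarrow> v \<in> T"
  shows "int (height k x) = (\<Sum>v\<in>T. max 0 (v x) * int (deg v))"
proof -
  have "int (height k x) = (\<Sum>v\<in>{v. prime_divisor k v \<and> 0 < v x}. max 0 (v x) * int (deg v))"
    unfolding height_def of_nat_sum by (intro sum.cong) auto
  also have "\<dots> = (\<Sum>v\<in>T. max 0 (v x) * int (deg v))"
    using assms by (intro sum.mono_neutral_left) auto
  finally show ?thesis .
qed

text \<open>The intended \<open>W\<close> represents the residues modulo \<open>z\<close> at the zeros of \<open>z\<close>.\<close>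

definition expansion_family :: "'k \<Rightarrow> 'k set \<Rightarrow> (('k \<Rightarrow> int) \<Rightarrow> int) \<Rightarrow> bool"
  where "expansion_family z W c \<longleftrightarrow> finite W \<and> card W = q ^ height k z \<and> adm c \<and>
    (\<forall>J. inj_on (\<lambda>w. \<Sum>j\<le>J. z ^ j * w j) ({..J} \<rightarrow>\<^sub>E W)) \<and>
    (\<forall>w\<in>W. \<forall>v\<in>PD. val_ge v w (- c v)) \<and>
    (\<forall>J. \<forall>w\<in>{..J} \<rightarrow>\<^sub>E W. \<forall>v\<in>PD. val_ge v (\<Sum>j\<le>J. z ^ j * w j) (int J * min 0 (v z) - c v))"

lemma expansion_familyD:
  assumes "expansion_family z W c"
  shows "finite W" "card W = q ^ height k z" "fin_supp c" "0 \<le> c v"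
    "inj_on (\<lambda>w. \<Sum>j\<le>J. z ^ j * w j) ({..J} \<rightarrow>\<^sub>E W)"
    "w \<in> W \<Longrightarrow> v \<in> PD \<Longrightarrow> val_ge v w (- c v)"
    "w' \<in> {..J} \<rightarrow>\<^sub>E W \<Longrightarrow> v \<in> PD \<Longrightarrow>
      val_ge v (\<Sum>j\<le>J. z ^ j * w' j) (int J * min 0 (v z) - c v)"
  using assms unfolding expansion_family_def adm_def by blast+

text \<open>Take \<open>v z\<close> digits at each zero \<open>v\<close> of \<open>z\<close>: the
  exponents add up to the height. The divisor \<open>c\<close> bounds the poles of the finitely many
  elements of \<open>W\<close>.\<close>

lemma expansion_family_exists:
  assumes z: "z \<noteq> 0"
  shows "\<exists>W c. expansion_family z W c"
proof -
  define S where "S = {v. prime_divisor k v \<and> 0 < v z}"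
  have S: "finite S" "\<And>v. v \<in> S \<Longrightarrow> prime_divisor k v" "\<And>v. v \<in> S \<Longrightarrow> 0 < v z"
    using finite_zeros[OF z] by (auto simp: S_def)
  have "\<forall>v\<in>S. \<exists>R. finite R \<and> card R = q ^ deg v \<and> (\<forall>r\<in>R. val_ge v r 0) \<and>
    (\<forall>r\<in>R. \<forall>s\<in>R. val_ge v (r - s) 1 \<longrightarrow> r = s)" using residue_representatives S(2) by blast
  then obtain R where R: "\<And>v. v \<in> S \<Longrightarrow> finite (R v)" "\<And>v. v \<in> S \<Longrightarrow> card (R v) = q ^ deg v"
    "\<And>v r. v \<in> S \<Longrightarrow> r \<in> R v \<Longrightarrow> val_ge v r 0"
    "\<And>v r s. v \<in> S \<Longrightarrow> r \<in> R v \<Longrightarrow> s \<in> R v \<Longrightarrow> val_ge v (r - s) 1 \<Longrightarrow> r = s" by metis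
  obtain W where W: "finite W" "card W = (\<Prod>v\<in>S. card (R v) ^ nat (v z))"
    "\<And>w v. w \<in> W \<Longrightarrow> v \<in> S \<Longrightarrow> val_ge v w 0"
    "\<And>w w'. w \<in> W \<Longrightarrow> w' \<in> W \<Longrightarrow> (\<And>v. v \<in> S \<Longrightarrow> val_ge v (w - w') (int (nat (v z)))) \<Longrightarrow> w = w'"
  proof (rule many_incongruent[of S k R "\<lambda>v. nat (v z)"], goal_cases)
    case (6 W)
    show ?case by (rule 6(1)[OF 6(2-)])
  qed (use S(1,2) R(1,3,4) in blast)+
  have W': "w = w'" if "w \<in> W" "w' \<in> W" "\<And>v. v \<in> S \<Longrightarrow> val_ge v (w - w') (v z)" for w w'
  proof (rule W(4)[OF that(1,2)])
    fix v assume v: "v \<in> S"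
    thus "val_ge v (w - w') (int (nat (v z)))" using that(3)[OF v] S(3)[OF v] by simp
  qed
  have "card W = (\<Prod>v\<in>S. q ^ (nat (v z) * deg v))"
    unfolding W(2) using R(2) by (intro prod.cong) (auto simp: power_mult[symmetric] mult.commute)
  also have "\<dots> = q ^ height k z" by (simp add: height_def S_def power_sum)
  finally have card: "card W = q ^ height k z" .
  define c where "c v = (\<Sum>w\<in>W. \<bar>v w\<bar>)" for v :: "'k \<Rightarrow> int"
  have c: "val_ge v w (- c v)" if "w \<in> W" for w v
  proof -
    have "\<bar>v w\<bar> \<le> c v" unfolding c_def using that W(1) by (intro member_le_sum) auto
    hence "- c v \<le> v w" by linarith
    thus ?thesis by (rule val_ge_self)
  qed
  have "expansion_family z W c"
    unfolding expansion_family_def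
  proof (intro conjI allI ballI)
    show "adm c" unfolding c_def by (intro adm_sum adm_abs_value)
    show "inj_on (\<lambda>w. \<Sum>j\<le>J. z ^ j * w j) ({..J} \<rightarrow>\<^sub>E W)" for J
    proof (rule inj_onI)
      fix w w' assume *: "w \<in> {..J} \<rightarrow>\<^sub>E W" "w' \<in> {..J} \<rightarrow>\<^sub>E W"
        "(\<Sum>j\<le>J. z ^ j * w j) = (\<Sum>j\<le>J. z ^ j * w' j)"
      have "\<forall>j\<le>J. w j = w' j"
      proof (rule expansion_unique[of z S k W])
        show "0 \<le> v z" if "v \<in> S" for v using S(3)[OF that] by simp
      qed (use * S(2) W(3) W' z in \<open>auto simp: PiE_iff\<close>)
      thus "w = w'" by (intro PiE_ext[OF *(1,2)]) auto
    qed
    show "val_ge v (\<Sum>j\<le>J. z ^ j * w j) (int J * min 0 (v z) - c v)"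
      if "w \<in> {..J} \<rightarrow>\<^sub>E W" "v \<in> PD" for J w v
    proof (rule val_ge_sum)
      show pv: "prime_divisor k v" using that by simp
      fix j assume j: "j \<in> {..J}"
      have "val_ge v (z ^ j * w j) (int j * v z + (- c v))"
        using that j c v_power[OF pv] by (intro val_ge_mult[OF pv]) (auto simp: val_ge_def[of v "z ^ j"])
      moreover have "int J * min 0 (v z) \<le> int j * v z"
      proof -
        have "int J * min 0 (v z) \<le> int j * min 0 (v z)" using j by (intro mult_right_mono_neg) auto
        also have "\<dots> \<le> int j * v z" by (intro mult_left_mono) auto
        finally show ?thesis .
      qed
      ultimately show "val_ge v (z ^ j * w j) (int J * min 0 (v z) - c v)"
        by (rule_tac val_ge_mono) auto
    qed
  qed (use W card c in auto)
  thus ?thesis by blast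
qed

text \<open>There are \<open>q ^ (height k z * (J + 1))\<close> expansions. Their poles are at most
  \<open>J\<close> times those of \<open>z\<close> plus \<open>c\<close>, so up to a constant factor
  they fit into \<open>q ^ (height k (inverse z) * J)\<close> elements.\<close>

lemma height_le_height_inverse:
  assumes z: "z \<noteq> 0"
  shows "height k z \<le> height k (inverse z)"
proof (cases "PD = {}")
  case True
  hence "{v. prime_divisor k v \<and> 0 < v z} = {}" by blast
  hence "height k z = 0" unfolding height_def by (metis sum.empty)
  thus ?thesis by simp
next
  case False
  then obtain v0 where v0: "v0 \<in> PD" by blast
  obtain W c where "expansion_family z W c" using expansion_family_exists[OF z] by blast
  note W = expansion_familyD[OF this]
  define T where "T = {v\<in>PD. v z \<noteq> 0} \<union> {v\<in>PD. c v \<noteq> 0}"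
  have T: "finite T" "T \<subseteq> PD" using fin_supp_value[of z] W(3) by (auto simp: T_def fin_supp_def)
  define C where "C = nat (\<Sum>v\<in>T. c v * int (deg v))"
  have intC: "int C = (\<Sum>v\<in>T. c v * int (deg v))"
    unfolding C_def using W(4) by (simp add: sum_nonneg)
  have h: "int (height k (inverse z)) = (\<Sum>v\<in>T. - min 0 (v z) * int (deg v))"
  proof -
    have "int (height k (inverse z)) = (\<Sum>v\<in>T. max 0 (v (inverse z)) * int (deg v))"
      using T by (intro height_eq_sum) (auto simp: T_def v_inverse)
    also have "\<dots> = (\<Sum>v\<in>T. - min 0 (v z) * int (deg v))"
      by (intro sum.cong refl arg_cong2[where f = "(*)"] max_v_inverse) (use T(2) in blast)
    finally show ?thesis .
  qed
  have "(q ^ height k z) ^ Suc J \<le> (q ^ C * card (RR (\<lambda>_. 0))) * (q ^ height k (inverse z)) ^ J" for J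
  proof -
    define A where "A v = int J * min 0 (v z) - c v" for v
    have "finite (RR A) \<and> card (RR A) \<le> q ^ nat (\<Sum>v\<in>T. (0 - A v) * int (deg v)) * card (RR (\<lambda>_. 0))"
    proof (rule RR_compare[OF T])
      show "A v \<le> 0" for v
        using W(4)[of v] mult_nonneg_nonpos[of "int J" "min 0 (v z)"] unfolding A_def by linarith
    qed (use finite_RR_0[OF v0] in \<open>auto simp: A_def T_def\<close>)
    moreover have "nat (\<Sum>v\<in>T. (0 - A v) * int (deg v)) = J * height k (inverse z) + C"
    proof -
      have "(\<Sum>v\<in>T. (0 - A v) * int (deg v))
          = int J * (\<Sum>v\<in>T. - min 0 (v z) * int (deg v)) + (\<Sum>v\<in>T. c v * int (deg v))"
        unfolding sum_distrib_left sum.distrib[symmetric]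
        by (intro sum.cong refl) (simp add: A_def algebra_simps)
      also have "\<dots> = int (J * height k (inverse z) + C)" by (simp only: h intC of_nat_add of_nat_mult)
      finally show ?thesis by (simp only: nat_int)
    qed
    ultimately have RA: "finite (RR A)" "card (RR A) \<le> q ^ (J * height k (inverse z) + C) * card (RR (\<lambda>_. 0))"
      by auto
    have "(\<lambda>w. \<Sum>j\<le>J. z ^ j * w j) ` ({..J} \<rightarrow>\<^sub>E W) \<subseteq> RR A"
      using W(7) by (auto simp: RR_def A_def)
    hence "card ({..J} \<rightarrow>\<^sub>E W) \<le> card (RR A)"
      using W(5) RA(1) by (rule_tac card_inj_on_le) auto
    hence "(q ^ height k z) ^ Suc J \<le> card (RR A)" by (simp add: card_PiE W(2))
    also note RA(2)
    finally show ?thesis by (simp add: power_add power_mult[symmetric] mult_ac)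
  qed
  hence "q ^ height k z \<le> q ^ height k (inverse z)" by (rule base_le_if_powers_bounded)
  thus ?thesis using q_ge_2 power_le_imp_le_exp by (metis less_le_trans one_less_numeral_iff semiring_norm(76))
qed

lemma height_inverse: "height k (inverse z) = height k z"
proof (cases "z = 0")
  case False
  thus ?thesis using height_le_height_inverse[of z] height_le_height_inverse[of "inverse z"] by simp
qed simp

lemma height_eq_poles:
  assumes "finite T" "T \<subseteq> PD" "\<And>v. v \<in> PD \<Longrightarrow> v x < 0 \<Longrightarrow> v \<in> T"
  shows "int (height k x) = (\<Sum>v\<in>T. - min 0 (v x) * int (deg v))"
proof -
  have "int (height k (inverse x)) = (\<Sum>v\<in>T. max 0 (v (inverse x)) * int (deg v))"
    using assms by (intro height_eq_sum) (auto simp: v_inverse)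
  also have "\<dots> = (\<Sum>v\<in>T. - min 0 (v x) * int (deg v))"
    by (intro sum.cong refl arg_cong2[where f = "(*)"] max_v_inverse) (use assms(2) in blast)
  finally show ?thesis by (simp add: height_inverse)
qed

lemma sum_formula:
  assumes "finite T" "T \<subseteq> PD" "\<And>v. v \<in> PD \<Longrightarrow> v x \<noteq> 0 \<Longrightarrow> v \<in> T"
  shows "(\<Sum>v\<in>T. v x * int (deg v)) = 0"
proof -
  have "(\<Sum>v\<in>T. v x * int (deg v))
      = (\<Sum>v\<in>T. max 0 (v x) * int (deg v)) - (\<Sum>v\<in>T. - min 0 (v x) * int (deg v))"
    unfolding sum_subtractf[symmetric] by (intro sum.cong) (auto simp: algebra_simps max_def min_def)
  also have "\<dots> = int (height k x) - int (height k x)"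
    using height_eq_sum[of T x] height_eq_poles[of T x] assms by force
  finally show ?thesis by simp
qed

text \<open>By the product formula the space is zero once the prescribed orders have positive total
  degree; the order at \<open>v0\<close> is raised until this happens.\<close>

lemma card_RR_bound:
  assumes v0: "v0 \<in> PD" and T: "finite T" "T \<subseteq> PD" "\<And>v. v \<in> PD \<Longrightarrow> v \<notin> T \<Longrightarrow> A v = 0"
  shows "finite (RR A) \<and> card (RR A) \<le> q ^ (nat (- (\<Sum>v\<in>T. A v * int (deg v))) + deg v0)"
proof -
  define D where "D = (\<Sum>v\<in>T. A v * int (deg v))"
  \<comment> \<open>Enough steps at \<open>v0\<close> to make the degree positive, overshooting by
    at most \<open>deg v0\<close>.\<close>
  define m where "m = nat (- D) div deg v0 + 1"
  have d0: "0 < deg v0" using deg_pos v0 by simp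
  have m: "nat (- D) < m * deg v0" "m * deg v0 \<le> nat (- D) + deg v0"
    using d0 by (auto simp: m_def dividend_less_div_times)
  define B where "B = A(v0 := A v0 + int m)"
  have "RR B = {0}"
  proof (rule ccontr)
    assume "RR B \<noteq> {0}"
    moreover have "0 \<in> RR B" by (simp add: RR_def)
    ultimately obtain x where x: "x \<in> RR B" "x \<noteq> 0" by blast
    define U where "U = insert v0 (T \<union> {v\<in>PD. v x \<noteq> 0})"
    have U: "finite U" "U \<subseteq> PD" "v0 \<in> U" "T \<subseteq> U"
      using T v0 fin_supp_value[of x] by (auto simp: U_def fin_supp_def)
    have "0 < D + int m * int (deg v0)"
    proof -
      have "- D < int (m * deg v0)" using m(1) by linarith
      thus ?thesis by simp
    qed
    also have "D = (\<Sum>v\<in>U. A v * int (deg v))"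
      unfolding D_def using U T by (intro sum.mono_neutral_left) auto
    also have "int m * int (deg v0) = (\<Sum>v\<in>U. if v = v0 then int m * int (deg v0) else 0)"
      using U by simp
    also have "(\<Sum>v\<in>U. A v * int (deg v)) + \<dots> = (\<Sum>v\<in>U. B v * int (deg v))"
      unfolding sum.distrib[symmetric] by (intro sum.cong) (auto simp: B_def algebra_simps)
    also have "\<dots> \<le> (\<Sum>v\<in>U. v x * int (deg v))"
      using x U by (intro sum_mono mult_right_mono) (auto simp: RR_def val_ge_def)
    also have "\<dots> = 0" using U by (intro sum_formula) (auto simp: U_def)
    finally show False by simp
  qed
  hence "finite (RR A) \<and> card (RR A) \<le> q ^ (m * deg v0) * 1"
    using RR_steps[OF v0, of A m] unfolding B_def by simp
  moreover have "q ^ (m * deg v0) \<le> q ^ (nat (- D) + deg v0)"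
    using m(2) q_ge_2 by (intro power_increasing) auto
  ultimately show ?thesis by (auto simp: D_def)
qed

text \<open>A place of degree \<open>d\<close> that is not a pole of \<open>x\<close> is a zero of
  \<open>x ^ (q ^ d) - x\<close>, because raising to the power \<open>q ^ d\<close> is the identity
  on its residue field. That element has height at most \<open>q ^ d * height k x\<close>.\<close>

lemma places_of_bounded_degree:
  obtains C where "\<And>n. finite {v\<in>PD. deg v \<le> n}" "\<And>n. (\<Sum>v\<in>{v\<in>PD. deg v \<le> n}. deg v) \<le> C * q ^ n"
proof (cases "PD = {}")
  case True
  hence *: "{v\<in>PD. deg v \<le> n} = {}" for n by auto
  show ?thesis by (rule that[of 0]; simp only: *; simp)
next
  case False
  then obtain v0 where v0: "prime_divisor k v0" by auto
  obtain x where x: "x \<noteq> 0" "v0 x = 1" using uniformizer_exists[OF v0] by blast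
  define H where "H = height k x"
  define P where "P = {v\<in>PD. v x < 0}"
  have P: "finite P" "P \<subseteq> PD"
    using fin_supp_value[of x] by (auto simp: P_def fin_supp_def elim: rev_finite_subset)
  have PH: "(\<Sum>v\<in>P. deg v) \<le> H"
  proof -
    have "int (\<Sum>v\<in>P. deg v) = (\<Sum>v\<in>P. 1 * int (deg v))" by simp
    also have "\<dots> \<le> (\<Sum>v\<in>P. - min 0 (v x) * int (deg v))"
      by (intro sum_mono mult_right_mono) (auto simp: P_def)
    also have "\<dots> = int H" unfolding H_def using P by (intro height_eq_poles[symmetric]) (auto simp: P_def)
    finally show ?thesis by (simp only: of_nat_le_iff)
  qed
  have one: "finite {v\<in>PD. deg v = d} \<and> (\<Sum>v\<in>{v\<in>PD. deg v = d}. deg v) \<le> 2 * H * q ^ d" for d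
  proof (cases "d = 0")
    case True
    have *: "{v\<in>PD. deg v = d} = {}" using True deg_pos by fastforce
    show ?thesis by (simp only: *) simp
  next
    case False
    define y where "y = x ^ (q ^ d) - x"
    have "1 < q ^ d" using q_ge_2 False by (intro one_less_power) auto
    moreover have "v0 (x ^ (q ^ d)) = int (q ^ d)" by (simp only: v_power[OF v0] x mult_1_right)
    ultimately have "v0 (x ^ (q ^ d)) \<noteq> v0 x" using x by linarith
    hence y0: "y \<noteq> 0" by (auto simp: y_def)
    define Z where "Z = {v\<in>PD. 0 < v y}"
    have Z: "finite Z" "Z \<subseteq> PD" using finite_zeros[OF y0] by (auto simp: Z_def)
    have sub: "{v\<in>PD. deg v = d} \<subseteq> P \<union> Z"
    proof
      fix v assume v: "v \<in> {v\<in>PD. deg v = d}"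
      hence pv: "prime_divisor k v" "deg v = d" by auto
      show "v \<in> P \<union> Z"
      proof (cases "v x < 0")
        case False
        hence "val_ge v (x ^ card (carrier (residue_field v)) - x) 1"
          using finite_residue_field[OF pv(1)] by (intro residue_frobenius[OF pv(1)]) (auto simp: val_ge_def)
        hence "val_ge v y 1" unfolding y_def card_residue[OF pv(1)] pv(2) .
        thus ?thesis using y0 pv by (auto simp: Z_def val_ge_def)
      qed (use v in \<open>auto simp: P_def\<close>)
    qed
    have "height k y \<le> q ^ d * H"
    proof -
      define U where "U = {v\<in>PD. v x \<noteq> 0} \<union> {v\<in>PD. v y \<noteq> 0}"
      have U: "finite U" "U \<subseteq> PD" using fin_supp_value[of x] fin_supp_value[of y] by (auto simp: U_def fin_supp_def)
      have "int (height k y) = (\<Sum>v\<in>U. - min 0 (v y) * int (deg v))"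
        using U by (intro height_eq_poles) (auto simp: U_def)
      also have "\<dots> \<le> (\<Sum>v\<in>U. int (q ^ d) * (- min 0 (v x) * int (deg v)))"
      proof (rule sum_mono)
        fix v assume "v \<in> U"
        hence pv: "prime_divisor k v" using U by auto
        have q1: "1 \<le> int (q ^ d)" using \<open>1 < q ^ d\<close> by linarith
        have *: "int (q ^ d) * min 0 (v x) \<le> 1 * min 0 (v x)" using q1 by (intro mult_right_mono_neg) auto
        have "val_ge v y (int (q ^ d) * min 0 (v x))" unfolding y_def
        proof (rule val_ge_diff[OF pv])
          show "val_ge v (x ^ (q ^ d)) (int (q ^ d) * min 0 (v x))"
            by (rule val_ge_power[OF pv]) (simp add: val_ge_def)
          show "val_ge v x (int (q ^ d) * min 0 (v x))" using * by (simp add: val_ge_def)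
        qed
        hence "int (q ^ d) * min 0 (v x) \<le> min 0 (v y)" using y0 * by (auto simp: val_ge_def)
        hence "- min 0 (v y) * int (deg v) \<le> (- (int (q ^ d) * min 0 (v x))) * int (deg v)"
          by (intro mult_right_mono) auto
        thus "- min 0 (v y) * int (deg v) \<le> int (q ^ d) * (- min 0 (v x) * int (deg v))"
          by (simp add: mult_ac)
      qed
      also have "\<dots> = int (q ^ d) * int H"
        unfolding sum_distrib_left[symmetric] H_def
        using U by (subst height_eq_poles[of U x]) (auto simp: U_def)
      finally show ?thesis by (metis of_nat_le_iff of_nat_mult)
    qed
    moreover have "(\<Sum>v\<in>Z. deg v) \<le> height k y"
    proof -
      have "int (\<Sum>v\<in>Z. deg v) = (\<Sum>v\<in>Z. 1 * int (deg v))" by simp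
      also have "\<dots> \<le> (\<Sum>v\<in>Z. max 0 (v y) * int (deg v))"
        by (intro sum_mono mult_right_mono) (auto simp: Z_def)
      also have "\<dots> = int (height k y)" using Z by (intro height_eq_sum[symmetric]) (auto simp: Z_def)
      finally show ?thesis by (simp only: of_nat_le_iff)
    qed
    moreover have "(\<Sum>v\<in>{v\<in>PD. deg v = d}. deg v) \<le> (\<Sum>v\<in>P. deg v) + (\<Sum>v\<in>Z. deg v)"
    proof -
      have "(\<Sum>v\<in>{v\<in>PD. deg v = d}. deg v) \<le> (\<Sum>v\<in>P \<union> Z. deg v)"
        using sub P Z by (intro sum_mono2) auto
      also have "\<dots> \<le> (\<Sum>v\<in>P. deg v) + (\<Sum>v\<in>Z. deg v)" using P Z by (simp add: sum_Un_nat)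
      finally show ?thesis .
    qed
    moreover have "1 * H \<le> q ^ d * H" using \<open>1 < q ^ d\<close> by (intro mult_right_mono) auto
    moreover have "2 * H * q ^ d = q ^ d * H + q ^ d * H" by simp
    ultimately have "(\<Sum>v\<in>{v\<in>PD. deg v = d}. deg v) \<le> 2 * H * q ^ d" using PH by linarith
    thus ?thesis using finite_subset[OF sub] P Z by blast
  qed
  show ?thesis
  \<comment> \<open>Geometric series: as \<open>q \<ge> 2\<close>, the terms
    \<open>2 * H * q ^ d\<close> up to \<open>d = n\<close> add up to at most
    \<open>4 * H * q ^ n\<close>.\<close>
  proof (rule that[of "4 * H"])
    have le_Suc: "{v\<in>PD. deg v \<le> Suc n} = {v\<in>PD. deg v \<le> n} \<union> {v\<in>PD. deg v = Suc n}" for n by auto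
    show fin: "finite {v\<in>PD. deg v \<le> n}" for n
    proof (induction n)
      case 0
      thus ?case using one[of 0] by simp
    next
      case (Suc n)
      thus ?case unfolding le_Suc using one by blast
    qed
    show "(\<Sum>v\<in>{v\<in>PD. deg v \<le> n}. deg v) \<le> 4 * H * q ^ n" for n
    proof (induction n)
      case 0
      thus ?case by simp
    next
      case (Suc n)
      have "(\<Sum>v\<in>{v\<in>PD. deg v \<le> Suc n}. deg v)
          \<le> (\<Sum>v\<in>{v\<in>PD. deg v \<le> n}. deg v) + (\<Sum>v\<in>{v\<in>PD. deg v = Suc n}. deg v)"
        unfolding le_Suc using fin one by (simp add: sum_Un_nat)
      also have "\<dots> \<le> 4 * H * q ^ n + 2 * H * q ^ Suc n" using Suc one[of "Suc n"] by (intro add_mono) blast+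
      also have "\<dots> \<le> 4 * H * q ^ Suc n"
      proof -
        have "2 * q ^ n \<le> q ^ Suc n" using q_ge_2 by simp
        hence "2 * H * (2 * q ^ n) \<le> 2 * H * q ^ Suc n" by (intro mult_left_mono) auto
        thus ?thesis by simp
      qed
      finally show ?case .
    qed
  qed
qed

end

section \<open>Derivations in characteristic p\<close>

text \<open>The place \<open>v0\<close> supplies the uniformizer with respect to which one will
  differentiate.\<close>

locale char_field = growth_field k q for k :: "'k::field set" and q +
  fixes p :: nat and v0 :: "'k \<Rightarrow> int"
  assumes prime_p: "prime p" and char_p: "CHAR('k) = p" and v0: "prime_divisor k v0"
begin

lemma p_gt_1: "1 < p" using prime_p by (rule prime_gt_1_nat)

lemma frob_add: "(x + y :: 'k) ^ p = x ^ p + y ^ p"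
  by (rule freshmans_dream) (simp_all only: char_p prime_p)

lemma frob_uminus: "(- x :: 'k) ^ p = - (x ^ p)"
proof -
  have "x ^ p + (- x) ^ p = 0" using frob_add[of x "- x"] p_gt_1 by (auto simp: power_0_left split: if_splits)
  thus ?thesis by (simp add: eq_neg_iff_add_eq_0 add.commute)
qed

lemma frob_diff: "(x - y :: 'k) ^ p = x ^ p - y ^ p"
  using frob_add[of x "- y"] frob_uminus by simp

lemma frob_of_nat: "(of_nat n :: 'k) ^ p = of_nat n"
  using p_gt_1 by (induction n) (auto simp: frob_add)

lemma of_nat_p_eq_0: "(of_nat n :: 'k) = 0 \<longleftrightarrow> p dvd n"
  using char_p by (simp add: of_nat_eq_0_iff_char_dvd)

definition Kp :: "'k set" where "Kp = range (\<lambda>a. a ^ p)"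

lemma Kp_power: "a ^ p \<in> Kp" by (simp add: Kp_def)

lemma Kp_0: "0 \<in> Kp" and Kp_1: "1 \<in> Kp"
  using Kp_power[of 0] Kp_power[of 1] p_gt_1 by (auto simp: power_0_left split: if_splits)

lemma Kp_add: "x \<in> Kp \<Longrightarrow> y \<in> Kp \<Longrightarrow> x + y \<in> Kp"
  by (auto simp: Kp_def frob_add[symmetric])

lemma Kp_diff: "x \<in> Kp \<Longrightarrow> y \<in> Kp \<Longrightarrow> x - y \<in> Kp"
  by (auto simp: Kp_def frob_diff[symmetric])

lemma Kp_mult: "x \<in> Kp \<Longrightarrow> y \<in> Kp \<Longrightarrow> x * y \<in> Kp"
  by (auto simp: Kp_def power_mult_distrib[symmetric])

lemma Kp_sum: "(\<And>i. i \<in> I \<Longrightarrow> f i \<in> Kp) \<Longrightarrow> sum f I \<in> Kp"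
  by (induction I rule: infinite_finite_induct) (auto intro: Kp_0 Kp_add)

text \<open>The values of the nonzero terms are pairwise incongruent modulo \<open>p\<close>.\<close>

lemma p_expansion_terms:
  assumes v: "prime_divisor k v" "v t = 1"
    and b: "val_ge v (\<Sum>i<p. a i ^ p * t ^ i) b" and i: "i < p"
  shows "val_ge v (a i ^ p * t ^ i) b"
proof (rule minimal_term_bounds_sum[OF v(1) _ _ b])
  have t: "t \<noteq> 0" using v v_0[OF v(1)] by auto
  fix i j assume ij: "i \<in> {..<p}" "j \<in> {..<p}" "a i ^ p * t ^ i \<noteq> 0" "a j ^ p * t ^ j \<noteq> 0"
    "v (a i ^ p * t ^ i) = v (a j ^ p * t ^ j)"
  hence eq: "int p * v (a i) + int i = int p * v (a j) + int j"
    using v t by (simp add: v_mult[OF v(1)] v_power[OF v(1)])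
  have "int i = (int p * v (a i) + int i) mod int p" using ij by simp
  also have "\<dots> = (int p * v (a j) + int j) mod int p" using eq by simp
  also have "\<dots> = int j" using ij by simp
  finally show "i = j" by simp
qed (use i in auto)

text \<open>Zero satisfies every lower bound, in particular one exceeding the value of a nonzero
  term.\<close>

lemma p_expansion_zero:
  assumes v: "prime_divisor k v" "v t = 1" and 0: "(\<Sum>i<p. a i ^ p * t ^ i) = 0" and i: "i < p"
  shows "a i = 0"
proof (rule ccontr)
  assume a: "a i \<noteq> 0"
  have t: "t \<noteq> 0" using v v_0[OF v(1)] by auto
  have "val_ge v (a i ^ p * t ^ i) (v (a i ^ p * t ^ i) + 1)"
    by (rule p_expansion_terms[OF v]) (use 0 i in auto)
  thus False using a t by (auto simp: val_ge_def)
qed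

text \<open>Together with \<open>p_expansion_zero\<close> this says that \<open>K\<close> has degree
  \<open>p\<close> over \<open>Kp\<close>. Let \<open>f\<close> run through \<open>p + 1\<close>
  independent choices of expansions: there are about \<open>q ^ (n * J * (p + 1))\<close> of them,
  while the poles of \<open>F f\<close> are about \<open>p * J\<close> times those of
  \<open>t\<close> and leave room for about \<open>q ^ (n * J * p)\<close> values. A collision is a
  relation over \<open>Kp\<close>.\<close>

lemma p_expansion_exists:
  assumes v: "prime_divisor k v" "v t = 1"
  shows "\<exists>a. g = (\<Sum>i<p. a i ^ p * t ^ i)"
proof -
  have t: "t \<noteq> 0" using v v_0[OF v(1)] by auto
  obtain W c where "expansion_family t W c" using expansion_family_exists[OF t] by blast
  note W = expansion_familyD[OF this]
  define n where "n = height k t"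
  define e where "e v = int p * c v + ((\<Sum>i<p. \<bar>v (t ^ i)\<bar>) + \<bar>v g\<bar>)" for v :: "'k \<Rightarrow> int"
  have e0: "0 \<le> e v" for v using W(4)[of v] by (auto simp: e_def intro!: add_nonneg_nonneg sum_nonneg)
  have e_fin: "fin_supp e"
  proof -
    have "fin_supp (\<lambda>v. int p * c v)" by (rule fin_supp_if_zero[OF W(3)]) simp
    moreover have "fin_supp (\<lambda>v. \<Sum>i<p. \<bar>v (t ^ i)\<bar>)"
      by (rule fin_supp_sum) (rule fin_supp_if_zero[OF fin_supp_value], simp)
    moreover have "fin_supp (\<lambda>v. \<bar>v g\<bar>)" by (rule fin_supp_if_zero[OF fin_supp_value], simp)
    ultimately show ?thesis unfolding e_def by (intro fin_supp_add)
  qed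
  define U where "U = insert v ({v\<in>PD. v t \<noteq> 0} \<union> {v\<in>PD. e v \<noteq> 0})"
  have U: "finite U" "U \<subseteq> PD" using fin_supp_value[of t] e_fin v(1) by (auto simp: U_def fin_supp_def)
  have n: "int n = (\<Sum>v\<in>U. - min 0 (v t) * int (deg v))"
    unfolding n_def using U by (intro height_eq_poles) (auto simp: U_def)
  have n1: "1 \<le> n"
  proof -
    have "int n = (\<Sum>v\<in>U. max 0 (v t) * int (deg v))"
      unfolding n_def using U by (intro height_eq_sum) (auto simp: U_def)
    also have "\<dots> \<ge> max 0 (v t) * int (deg v)"
      using U by (intro member_le_sum) (auto simp: U_def)
    finally have "int (deg v) \<le> int n" using v by simp
    thus ?thesis using deg_pos[OF v(1)] by linarith
  qed
  define C where "C = nat (\<Sum>v\<in>U. e v * int (deg v))"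
  have C: "int C = (\<Sum>v\<in>U. e v * int (deg v))" unfolding C_def using e0 by (simp add: sum_nonneg)
  \<comment> \<open>Large enough for the surplus \<open>n * J\<close> in the exponent to beat
    \<open>C + deg v\<close>.\<close>
  define J where "J = C + deg v"
  define M where "M = (\<lambda>w. \<Sum>j\<le>J. t ^ j * w j) ` ({..J} \<rightarrow>\<^sub>E W)"
  have M: "finite M" "card M = q ^ (n * (J + 1))"
    unfolding M_def using W by (auto simp: card_image card_PiE n_def power_add power_mult[symmetric] intro: finite_PiE)
  have Mval: "val_ge u m (int J * min 0 (u t) - c u)" if "m \<in> M" "u \<in> PD" for m u
    using that W(7) by (auto simp: M_def)
  define A where "A u = int p * int J * min 0 (u t) - e u" for u
  have RRA: "finite (RR A)" "card (RR A) \<le> q ^ (p * J * n + C + deg v)"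
  proof -
    have "finite (RR A) \<and> card (RR A) \<le> q ^ (nat (- (\<Sum>v\<in>U. A v * int (deg v))) + deg v)"
      using U v(1) by (intro card_RR_bound) (auto simp: A_def U_def)
    moreover have "- (\<Sum>v\<in>U. A v * int (deg v)) = int (p * J * n + C)"
    proof -
      have "- (\<Sum>v\<in>U. A v * int (deg v))
          = int p * int J * (\<Sum>v\<in>U. - min 0 (v t) * int (deg v)) + (\<Sum>v\<in>U. e v * int (deg v))"
        unfolding sum_distrib_left sum.distrib[symmetric] sum_negf[symmetric]
        by (intro sum.cong refl) (simp add: A_def algebra_simps)
      thus ?thesis by (simp only: n C of_nat_add of_nat_mult)
    qed
    ultimately show "finite (RR A)" "card (RR A) \<le> q ^ (p * J * n + C + deg v)" by (simp_all only: nat_int)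
  qed
  define F where "F f = (\<Sum>i<p. f i ^ p * t ^ i) + f p ^ p * g" for f :: "nat \<Rightarrow> 'k"
  have "F ` ({..p} \<rightarrow>\<^sub>E M) \<subseteq> RR A"
  proof
    fix y assume "y \<in> F ` ({..p} \<rightarrow>\<^sub>E M)"
    then obtain f where f: "f \<in> {..p} \<rightarrow>\<^sub>E M" "y = F f" by blast
    show "y \<in> RR A" unfolding RR_def
    proof (intro CollectI ballI)
      fix u assume u: "u \<in> PD"
      hence pu: "prime_divisor k u" by simp
      have ft: "val_ge u (f i ^ p * h) (A u)" if "i \<le> p" "- ((\<Sum>i<p. \<bar>u (t ^ i)\<bar>) + \<bar>u g\<bar>) \<le> u h" for i h
      proof -
        have "val_ge u (f i ^ p * h) (int p * (int J * min 0 (u t) - c u) + - ((\<Sum>i<p. \<bar>u (t ^ i)\<bar>) + \<bar>u g\<bar>))"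
        proof (intro val_ge_mult[OF pu] val_ge_power[OF pu])
          show "val_ge u (f i) (int J * min 0 (u t) - c u)" using f that(1) u by (intro Mval) auto
          show "val_ge u h (- ((\<Sum>i<p. \<bar>u (t ^ i)\<bar>) + \<bar>u g\<bar>))" using that(2) by (rule val_ge_self)
        qed
        also have "int p * (int J * min 0 (u t) - c u) + - ((\<Sum>i<p. \<bar>u (t ^ i)\<bar>) + \<bar>u g\<bar>) = A u"
          by (simp add: A_def e_def algebra_simps)
        finally show ?thesis .
      qed
      have ti: "\<bar>u (t ^ i)\<bar> \<le> (\<Sum>i<p. \<bar>u (t ^ i)\<bar>)" if "i < p" for i
        using that by (intro member_le_sum) auto
      show "val_ge u y (A u)" unfolding f(2) F_def
      proof (intro val_ge_add[OF pu] val_ge_sum[OF pu] ft)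
        show "- ((\<Sum>i<p. \<bar>u (t ^ i)\<bar>) + \<bar>u g\<bar>) \<le> u (t ^ i)" if "i \<in> {..<p}" for i
          using ti[of i] that by auto
        have "0 \<le> (\<Sum>i<p. \<bar>u (t ^ i)\<bar>)" by (intro sum_nonneg) auto
        thus "- ((\<Sum>i<p. \<bar>u (t ^ i)\<bar>) + \<bar>u g\<bar>) \<le> u g" by linarith
      qed auto
    qed
  qed
  hence "card (F ` ({..p} \<rightarrow>\<^sub>E M)) \<le> q ^ (p * J * n + C + deg v)"
    using card_mono[OF RRA(1)] RRA(2) le_trans by blast
  also have "\<dots> < q ^ (n * (J + 1) * (p + 1))"
  proof (rule power_strict_increasing)
    have "J \<le> n * J" using n1 by simp
    moreover have "0 < n * (p + 1)" using n1 by simp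
    ultimately have "C + deg v < n * J + n * (p + 1)" unfolding J_def by linarith
    moreover have "n * (J + 1) * (p + 1) = p * J * n + (n * J + n * (p + 1))" by (simp add: algebra_simps)
    ultimately show "p * J * n + C + deg v < n * (J + 1) * (p + 1)" by linarith
  qed (use q_ge_2 in simp)
  also have "q ^ (n * (J + 1) * (p + 1)) = card ({..p} \<rightarrow>\<^sub>E M)"
  proof -
    have "card ({..p} \<rightarrow>\<^sub>E M) = card M ^ (p + 1)" by (simp add: card_PiE)
    thus ?thesis by (simp only: M(2) power_mult)
  qed
  finally have "\<not> inj_on F ({..p} \<rightarrow>\<^sub>E M)" using card_image by fastforce
  then obtain f f' where f: "f \<in> {..p} \<rightarrow>\<^sub>E M" "f' \<in> {..p} \<rightarrow>\<^sub>E M" "f \<noteq> f'" "F f = F f'"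
    by (auto simp: inj_on_def)
  define d where "d i = f i - f' i" for i
  have d: "(\<Sum>i<p. d i ^ p * t ^ i) + d p ^ p * g = 0"
    using f(4) by (simp add: F_def d_def frob_diff algebra_simps sum_subtractf)
  \<comment> \<open>Otherwise the relation would involve only powers of \<open>t\<close>, which are
    independent over \<open>Kp\<close>.\<close>
  have dp: "d p \<noteq> 0"
  proof
    assume dp: "d p = 0"
    hence "(\<Sum>i<p. d i ^ p * t ^ i) = 0" using d p_gt_1 by (simp add: power_0_left)
    hence "d i = 0" if "i < p" for i using p_expansion_zero[OF v _ that] by blast
    hence "d i = 0" if "i \<le> p" for i using dp that by (cases "i = p") auto
    hence "f = f'" by (intro PiE_ext[OF f(1,2)]) (auto simp: d_def)
    thus False using f(3) by simp
  qed
  have "g = (\<Sum>i<p. (- d i / d p) ^ p * t ^ i)"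
  proof -
    have "(\<Sum>i<p. (- d i / d p) ^ p * t ^ i) = - ((\<Sum>i<p. d i ^ p * t ^ i) / d p ^ p)"
      unfolding sum_divide_distrib sum_negf[symmetric]
      by (intro sum.cong refl) (simp add: power_divide frob_uminus)
    also have "(\<Sum>i<p. d i ^ p * t ^ i) = - (d p ^ p * g)" using d by (simp add: eq_neg_iff_add_eq_0)
    finally show ?thesis using dp by simp
  qed
  thus ?thesis by (intro exI[of _ "\<lambda>i. - d i / d p"])
qed

definition Kp_poly :: "'k poly \<Rightarrow> bool" where "Kp_poly A \<longleftrightarrow> (\<forall>i. coeff A i \<in> Kp)"

text \<open>The divisor is the polynomial \<open>X ^ p - t ^ p\<close> over \<open>Kp\<close>
  vanishing at \<open>t\<close>; the point is that the remainder keeps its coefficients in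
  \<open>Kp\<close>.\<close>

lemma Kp_poly_division:
  assumes "Kp_poly A"
  shows "\<exists>B R. Kp_poly R \<and> Polynomial.degree R < p \<and> A = (monom 1 p - [:t ^ p:]) * B + R"
  using assms
proof (induction A)
  case 0
  have "Kp_poly 0" using Kp_0 by (simp add: Kp_poly_def)
  thus ?case using p_gt_1 by (intro exI[of _ 0] exI[of _ "0 :: 'k poly"]) auto
next
  case (pCons a A)
  have a: "a \<in> Kp" using pCons.prems by (metis Kp_poly_def coeff_pCons_0)
  have "Kp_poly A" using pCons.prems by (metis Kp_poly_def coeff_pCons_Suc)
  then obtain B R where R: "Kp_poly R" "Polynomial.degree R < p" "A = (monom 1 p - [:t ^ p:]) * B + R"
    using pCons.IH by blast
  define c where "c = coeff R (p - 1)"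
  define R' where "R' = pCons a R - smult c (monom 1 p - [:t ^ p:])"
  have c: "c \<in> Kp" using R(1) by (simp add: c_def Kp_poly_def)
  have "Kp_poly R'" unfolding Kp_poly_def
  proof
    fix i
    have "coeff (pCons a R) i \<in> Kp" using a R(1) by (cases i) (auto simp: Kp_poly_def)
    moreover have "coeff (monom 1 p - [:t ^ p:]) i \<in> Kp"
      using Kp_0 Kp_1 Kp_power[of t] Kp_diff[OF Kp_0] p_gt_1 by (auto simp: coeff_pCons Kp_diff split: nat.split)
    moreover have "coeff R' i = coeff (pCons a R) i - c * coeff (monom 1 p - [:t ^ p:]) i"
      by (simp add: R'_def)
    ultimately show "coeff R' i \<in> Kp" using c Kp_diff Kp_mult by metis
  qed
  moreover have "Polynomial.degree R' < p"
  proof -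
    have "coeff R' i = 0" if "p \<le> i" for i
    proof (cases "i = p")
      case True
      thus ?thesis using p_gt_1 by (auto simp: R'_def c_def coeff_pCons split: nat.split)
    next
      case False
      thus ?thesis using that R(2) by (auto simp: R'_def coeff_pCons coeff_eq_0 split: nat.split)
    qed
    thus ?thesis using p_gt_1 by (metis degree_lessI gr_implies_not0 neq0_conv)
  qed
  moreover have "pCons a A = (monom 1 p - [:t ^ p:]) * (pCons c B) + R'"
  proof -
    have "pCons a (N * B + R) = N * pCons c B + (pCons a R - smult c N)" for N
      by (simp add: mult_pCons_right)
    thus ?thesis unfolding R(3) R'_def .
  qed
  ultimately show ?case by blast
qed

text \<open>Makes formal differentiation at \<open>t\<close> well defined. A relation for
  \<open>t\<close> over \<open>Kp\<close> has remainder 0 by independence, so it is a multiple of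
  \<open>X ^ p - t ^ p\<close>, whose derivative vanishes.\<close>

lemma Kp_poly_pderiv_root:
  assumes v: "prime_divisor k v" "v t = 1" and A: "Kp_poly A" "poly A t = 0"
  shows "poly (pderiv A) t = 0"
proof -
  obtain B R where R: "Kp_poly R" "Polynomial.degree R < p" "A = (monom 1 p - [:t ^ p:]) * B + R"
    using Kp_poly_division[OF A(1)] by blast
  have M: "poly (monom 1 p - [:t ^ p:]) t = 0" by (simp add: poly_monom)
  have "poly R t = 0" using A(2) M unfolding R(3) by simp
  moreover have "\<forall>i. \<exists>a. coeff R i = a ^ p" using R(1) by (auto simp: Kp_poly_def Kp_def)
  then obtain a where a: "\<And>i. coeff R i = a i ^ p" by metis
  moreover have "poly R t = (\<Sum>i<p. coeff R i * t ^ i)"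
    using R(2) poly_eq_sum_atMost[of R "p - 1" t] p_gt_1 lessThan_Suc_atMost[of "p - 1"] by simp
  ultimately have "(\<Sum>i<p. a i ^ p * t ^ i) = 0" by simp
  hence "a i = 0" if "i < p" for i using p_expansion_zero[OF v _ that] by blast
  hence "coeff R i = 0" for i
  proof (cases "i < p")
    case True
    thus ?thesis using a[of i] \<open>\<And>i. i < p \<Longrightarrow> a i = 0\<close> p_gt_1 by (simp add: power_0_left)
  next
    case False
    thus ?thesis using R(2) by (intro coeff_eq_0) simp
  qed
  hence "R = 0" by (simp add: poly_eq_iff)
  moreover have "pderiv (monom 1 p - [:t ^ p:]) = 0"
    using of_nat_p_eq_0[of p] by (simp add: pderiv_diff pderiv_monom pderiv_pCons)
  ultimately show ?thesis using M unfolding R(3) by (simp add: pderiv_mult pderiv_add)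
qed

text \<open>\<open>D\<close> is differentiation with respect to a uniformizer \<open>t\<close> at
  \<open>v0\<close>, via \<open>K = Kp[t]\<close>.\<close>

lemma derivation_exists:
  obtains D :: "'k \<Rightarrow> 'k" where "\<And>x y. D (x + y) = D x + D y" "\<And>x y. D (x * y) = D x * y + x * D y"
    "\<And>x. D x = 0 \<longleftrightarrow> (\<exists>a. x = a ^ p)"
proof -
  obtain t where t: "t \<noteq> 0" "v0 t = 1" using uniformizer_exists[OF v0] by blast
  have lift: "\<exists>A. Kp_poly A \<and> poly A t = g" for g
  proof -
    obtain a where a: "g = (\<Sum>i<p. a i ^ p * t ^ i)" using p_expansion_exists[OF v0 t(2)] by blast
    have "Kp_poly (\<Sum>i<p. monom (a i ^ p) i)"
      unfolding Kp_poly_def coeff_sum by (auto intro!: Kp_sum simp: Kp_0 Kp_power)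
    thus ?thesis using a by (intro exI[of _ "\<Sum>i<p. monom (a i ^ p) i"]) (simp add: poly_sum poly_monom)
  qed
  define D where "D g = poly (pderiv (SOME A. Kp_poly A \<and> poly A t = g)) t" for g
  have D: "D (poly A t) = poly (pderiv A) t" if "Kp_poly A" for A
  proof -
    define B where "B = (SOME B. Kp_poly B \<and> poly B t = poly A t)"
    have B: "Kp_poly B \<and> poly B t = poly A t" unfolding B_def by (rule someI_ex) (rule lift)
    have "Kp_poly (A - B)" using that B by (auto simp: Kp_poly_def Kp_diff)
    hence "poly (pderiv (A - B)) t = 0" using B by (intro Kp_poly_pderiv_root[OF v0 t(2)]) auto
    thus ?thesis by (simp add: D_def B_def[symmetric] pderiv_diff)
  qed
  show ?thesis
  proof (rule that[of D])
    fix x y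
    obtain A where A: "Kp_poly A" "poly A t = x" using lift by blast
    obtain B where B: "Kp_poly B" "poly B t = y" using lift by blast
    have "Kp_poly (A + B)" using A B by (auto simp: Kp_poly_def Kp_add)
    from D[OF this] D[OF A(1)] D[OF B(1)] show "D (x + y) = D x + D y"
      by (simp add: A B pderiv_add)
    have "Kp_poly (A * B)" using A B by (auto simp: Kp_poly_def coeff_mult intro!: Kp_sum Kp_mult)
    from D[OF this] D[OF A(1)] D[OF B(1)] show "D (x * y) = D x * y + x * D y"
      by (simp add: A B pderiv_mult mult_ac)
  next
    fix x
    show "D x = 0 \<longleftrightarrow> (\<exists>a. x = a ^ p)"
    proof
      assume Dx: "D x = 0"
      obtain a where a: "x = (\<Sum>i<p. a i ^ p * t ^ i)" using p_expansion_exists[OF v0 t(2)] by blast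
      define A where "A = (\<Sum>i<p. monom (a i ^ p) i)"
      have "Kp_poly A" unfolding A_def Kp_poly_def coeff_sum by (auto intro!: Kp_sum simp: Kp_0 Kp_power)
      moreover have "poly A t = x" by (simp add: A_def a poly_sum poly_monom)
      ultimately have "poly (pderiv A) t = 0" using D Dx by metis
      \<comment> \<open>Multiplying by \<open>t\<close> restores the exponents, and
        \<open>of_nat i\<close> is its own \<open>p\<close>-th power, so independence applies with
        coefficients \<open>of_nat i * a i\<close>.\<close>
      hence "0 = t * poly (pderiv A) t" by simp
      also have "pderiv A = (\<Sum>i<p. pderiv (monom (a i ^ p) i))"
        unfolding A_def by (rule higher_pderiv_sum[of 1, simplified])
      also have "t * poly \<dots> t = (\<Sum>i<p. (of_nat i * a i) ^ p * t ^ i)"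
        unfolding poly_sum sum_distrib_left
      proof (intro sum.cong refl)
        fix i
        show "t * poly (pderiv (monom (a i ^ p) i)) t = (of_nat i * a i) ^ p * t ^ i"
          using p_gt_1 by (cases i) (auto simp: pderiv_monom poly_monom power_mult_distrib frob_of_nat frob_add)
      qed
      finally have z: "of_nat i * a i = 0" if "i < p" for i
        using p_expansion_zero[OF v0 t(2) _ that, of "\<lambda>i. of_nat i * a i"] by simp
      have "a i = 0" if "0 < i" "i < p" for i
        using z[OF that(2)] of_nat_p_eq_0[of i] that nat_dvd_not_less by auto
      moreover have "{..<p} = insert 0 {0<..<p}" using p_gt_1 by auto
      ultimately have "x = a 0 ^ p" using a p_gt_1 by (simp add: power_0_left)
      thus "\<exists>a. x = a ^ p" by blast
    next
      assume "\<exists>a. x = a ^ p"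
      then obtain a where a: "x = a ^ p" by blast
      have "Kp_poly [:x:]" using Kp_0 Kp_power[of a] by (auto simp: Kp_poly_def coeff_pCons a split: nat.split)
      from D[OF this] show "D x = 0" by (simp add: pderiv_pCons)
    qed
  qed
qed

end

locale derivation_field = char_field k q p v0 for k :: "'k::field set" and q p v0 +
  fixes D :: "'k \<Rightarrow> 'k"
  assumes D_add: "\<And>x y. D (x + y) = D x + D y"
    and D_mult: "\<And>x y. D (x * y) = D x * y + x * D y"
    and D_eq_0_iff: "\<And>x. D x = 0 \<longleftrightarrow> (\<exists>a. x = a ^ p)"
begin

section \<open>Orders of derivatives at the places\<close>

lemma D_0: "D 0 = 0" using D_add[of 0 0] by (metis add.right_neutral add_left_cancel)

lemma D_1: "D 1 = 0" using D_mult[of 1 1] by (metis add.right_neutral add_left_cancel mult_1 mult_1_right)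

lemma D_uminus: "D (- x) = - D x"
  using D_add[of x "- x"] D_0 by (simp add: eq_neg_iff_add_eq_0 add.commute)

lemma D_diff: "D (x - y) = D x - D y"
  using D_add[of x "- y"] D_uminus by simp

lemma D_sum: "D (sum f I) = (\<Sum>i\<in>I. D (f i))"
  by (induction I rule: infinite_finite_induct) (auto simp: D_0 D_add)

lemma D_frob: "D (a ^ p) = 0" using D_eq_0_iff by blast

lemma D_frob_mult: "D (a ^ p * x) = a ^ p * D x"
  by (simp add: D_mult D_frob)

lemma D_power: "D (x ^ n) = of_nat n * x ^ (n - 1) * D x"
proof (induction n)
  case (Suc n)
  thus ?case by (cases n) (auto simp: D_mult algebra_simps)
qed (simp add: D_1)

lemma D_uniformizer:
  assumes v: "prime_divisor k v" "v t = 1"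
  shows "D t \<noteq> 0"
proof
  assume "D t = 0"
  then obtain a where "t = a ^ p" using D_eq_0_iff by blast
  hence "int p * v a = 1" using v v_power[OF v(1)] by metis
  hence "int p = 1" by (simp add: zmult_eq_1_iff)
  thus False using p_gt_1 by simp
qed

text \<open>Nothing cancels in the expansion of \<open>g\<close> in powers of \<open>t\<close>, so
  each term inherits the bound for \<open>g\<close>, and \<open>D\<close> changes a term only by the
  factor \<open>of_nat i * D t / t\<close>.\<close>

lemma D_val_bound:
  assumes v: "prime_divisor k v" "v t = 1" and g: "val_ge v g b"
  shows "val_ge v (D g) (b - 1 + v (D t))"
    and "0 \<le> b \<Longrightarrow> val_ge v (D g) (v (D t))"
proof -
  have t: "t \<noteq> 0" using v v_0[OF v(1)] by auto
  obtain a where a: "g = (\<Sum>i<p. a i ^ p * t ^ i)" using p_expansion_exists[OF v] by blast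
  have terms: "val_ge v (a i ^ p * t ^ i) b" if "i < p" for i
    using p_expansion_terms[OF v _ that] g a by blast
  have Dg: "D g = (\<Sum>i<p. of_nat i * (a i ^ p * t ^ (i - 1)) * D t)"
    unfolding a D_sum by (intro sum.cong refl) (simp only: D_frob_mult D_power, simp only: mult_ac)
  have *: "val_ge v (D g) (b' + v (D t))"
    if "\<And>i. 0 < i \<Longrightarrow> i < p \<Longrightarrow> val_ge v (a i ^ p * t ^ (i - 1)) b'" for b'
    unfolding Dg
  proof (rule val_ge_sum[OF v(1)])
    fix i assume i: "i \<in> {..<p}"
    show "val_ge v (of_nat i * (a i ^ p * t ^ (i - 1)) * D t) (b' + v (D t))"
    proof (cases "i = 0")
      case False
      hence "val_ge v (of_nat i * (a i ^ p * t ^ (i - 1))) (0 + b')"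
        using i that by (intro val_ge_mult[OF v(1)] val_ge_of_nat[OF v(1)]) auto
      thus ?thesis using val_ge_mult_right[OF v(1)] by simp
    qed simp
  qed
  show "val_ge v (D g) (b - 1 + v (D t))"
  proof (rule *)
    fix i assume i: "0 < i" "i < p"
    have "val_ge v (a i ^ p * t ^ (i - 1) * t) (b - 1 + v t)"
      using terms[OF i(2)] i v(2) by (simp add: mult.assoc flip: power_Suc2)
    thus "val_ge v (a i ^ p * t ^ (i - 1)) (b - 1)" using val_ge_cancel[OF v(1) t] by blast
  qed
  show "val_ge v (D g) (v (D t))" if b: "0 \<le> b"
  proof -
    have "val_ge v (a i ^ p * t ^ (i - 1)) 0" if i: "0 < i" "i < p" for i
    proof (cases "a i = 0")
      case False
      have "0 \<le> v (a i ^ p * t ^ i)" using terms[OF i(2)] b False t by (auto simp: val_ge_def)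
      hence "0 \<le> int p * v (a i) + int i"
        using False t v by (simp add: v_mult[OF v(1)] v_power[OF v(1)])
      \<comment> \<open>As \<open>i < p\<close>, integrality of the term forces \<open>a i\<close>
        to be integral; with \<open>0 < i\<close> the division by \<open>t\<close> then costs
        nothing.\<close>
      hence "- int p < int p * v (a i)" using i by linarith
      hence "0 < int p * (v (a i) + 1)" by (simp add: algebra_simps)
      hence "0 \<le> v (a i)" using p_gt_1 by (simp add: zero_less_mult_iff)
      thus ?thesis using False t v by (simp add: v_mult[OF v(1)] v_power[OF v(1)] val_ge_def)
    qed (use p_gt_1 in \<open>simp add: power_0_left\<close>)
    from *[OF this] show ?thesis by simp
  qed
qed

text \<open>Where \<open>D\<close> does not preserve the valuation ring. At all other places it
  lowers orders by at most one.\<close>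

definition bad_places :: "('k \<Rightarrow> int) set"
  where "bad_places = {v\<in>PD. \<exists>h. val_ge v h 0 \<and> \<not> val_ge v (D h) 0}"

text \<open>If \<open>g\<close> were a uniformizer with \<open>D g\<close> integral,
  \<open>D_val_bound\<close> would make \<open>D\<close> preserve integrality at
  \<open>v\<close>.\<close>

lemma bad_place_no_uniformizer:
  assumes v: "v \<in> bad_places" and g: "val_ge v g 1" "val_ge v (D g) 0"
  shows "val_ge v g 2"
proof (rule ccontr)
  assume "\<not> ?thesis"
  hence vg: "v g = 1" using g by (auto simp: val_ge_def)
  have pv: "prime_divisor k v" using v by (simp add: bad_places_def)
  obtain h where h: "val_ge v h 0" "\<not> val_ge v (D h) 0" using v by (auto simp: bad_places_def)
  have "val_ge v (D h) (v (D g))" by (rule D_val_bound(2)[OF pv vg h(1)]) simp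
  moreover have "0 \<le> v (D g)" using g(2) D_uniformizer[OF pv vg] by (auto simp: val_ge_def)
  ultimately show False using h(2) val_ge_mono by blast
qed

text \<open>
  At bad places the elements \<open>m\<close> of a large family with \<open>D m\<close> integral never have value \<open>1\<close>;
  counting them shows that the total degree of the bad places is bounded.
\<close>

lemma finite_bad_places: "finite bad_places"
proof -
  obtain z where z: "z \<noteq> 0" "v0 z = 1" using uniformizer_exists[OF v0] by blast
  obtain W c where "expansion_family z W c" using expansion_family_exists[OF z(1)] by blast
  note W = expansion_familyD[OF this]
  define n where "n = height k z"
  define e where "e v = c v + (\<bar>v z\<bar> + (\<bar>v (D z)\<bar> + (\<Sum>w\<in>W. \<bar>v (D w)\<bar>)))" for v :: "'k \<Rightarrow> int"
  have e_fin: "fin_supp e"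
    unfolding e_def
    by (intro fin_supp_add fin_supp_sum W(3); rule fin_supp_if_zero[OF fin_supp_value]; simp)
  have e0: "c v = 0" "v z = 0" "v (D z) = 0" "\<And>w. w \<in> W \<Longrightarrow> v (D w) = 0" if "e v = 0" for v
  proof -
    have nn: "0 \<le> c v" "0 \<le> \<bar>v z\<bar>" "0 \<le> \<bar>v (D z)\<bar>" "0 \<le> (\<Sum>w\<in>W. \<bar>v (D w)\<bar>)"
      using W(4) by (auto intro: sum_nonneg)
    hence *: "c v = 0" "\<bar>v z\<bar> = 0" "\<bar>v (D z)\<bar> = 0" "(\<Sum>w\<in>W. \<bar>v (D w)\<bar>) = 0"
      using that unfolding e_def by linarith+
    show "c v = 0" "v z = 0" "v (D z) = 0" using * by auto
    show "v (D w) = 0" if "w \<in> W" for w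
      using *(4) that W(1) sum_nonneg_eq_0_iff[of W "\<lambda>w. \<bar>v (D w)\<bar>"] by auto
  qed
  \<comment> \<open>Outside \<open>T0\<close> the element \<open>z\<close>, the digits and the
    derivatives of all of these are free of poles.\<close>
  define T0 where "T0 = {v\<in>PD. e v \<noteq> 0}"
  have T0: "finite T0" "T0 \<subseteq> PD" using e_fin by (auto simp: T0_def fin_supp_def)
  have pole: "v \<in> T0" if "v \<in> PD" "v z \<noteq> 0" for v using that e0(2)[of v] by (auto simp: T0_def)
  have n: "int n = (\<Sum>v\<in>T0. - min 0 (v z) * int (deg v))"
    unfolding n_def using T0 pole by (intro height_eq_poles) auto
  have n1: "1 \<le> n"
  proof -
    have "int n = (\<Sum>v\<in>T0. max 0 (v z) * int (deg v))"
      unfolding n_def using T0 pole by (intro height_eq_sum) auto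
    also have "\<dots> \<ge> max 0 (v0 z) * int (deg v0)"
      using T0 pole[of v0] v0 z by (intro member_le_sum) auto
    finally have "int (deg v0) \<le> int n" using z by simp
    thus ?thesis using deg_pos[OF v0] by linarith
  qed
  define C where "C = nat (\<Sum>v\<in>T0. c v * int (deg v))"
  have C: "int C = (\<Sum>v\<in>T0. c v * int (deg v))" unfolding C_def using W(4) by (simp add: sum_nonneg)
  have key: "card T \<le> C + deg v0" if T: "finite T" "T \<subseteq> bad_places - T0" for T
  proof -
    have TP: "T \<subseteq> PD" using T by (auto simp: bad_places_def)
    have Te: "e v = 0" if "v \<in> T" for v using T TP that by (auto simp: T0_def)
    define d where "d = (\<Sum>v\<in>T. deg v)"
    \<comment> \<open>Twice \<open>d\<close>, so that the truncated subtraction of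
      \<open>2 * d\<close> below is exact.\<close>
    define J where "J = 2 * d"
    define M where "M = (\<lambda>w. \<Sum>j\<le>J. z ^ j * w j) ` ({..J} \<rightarrow>\<^sub>E W)"
    have M: "finite M" "card M = q ^ (n * (J + 1))"
      unfolding M_def using W by (auto simp: card_image card_PiE n_def power_add power_mult[symmetric] intro: finite_PiE)
    define A where "A v = int J * min 0 (v z) - c v" for v
    have MA: "M \<subseteq> RR A" using W(7) by (auto simp: M_def A_def RR_def)
    have DM: "val_ge v (D m) 0" if m: "m \<in> M" and v: "v \<in> T" for m v
    proof -
      have pv: "prime_divisor k v" using v TP by auto
      note ev = e0[OF Te[OF v]]
      obtain w where w: "w \<in> {..J} \<rightarrow>\<^sub>E W" "m = (\<Sum>j\<le>J. z ^ j * w j)" using m by (auto simp: M_def)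
      have zj: "val_ge v (z ^ j) 0" for j using ev by (simp add: val_ge_def v_power[OF pv])
      have "val_ge v (D (z ^ j * w j)) 0" if j: "j \<in> {..J}" for j
      proof -
        have wj: "w j \<in> W" using w j by (auto simp: PiE_iff)
        have "val_ge v (D (z ^ j)) (0 + 0 + 0)" unfolding D_power
          using ev by (intro val_ge_mult[OF pv] val_ge_of_nat[OF pv] zj) (auto simp: val_ge_def)
        moreover have "val_ge v (w j) 0" using W(6)[OF wj, of v] pv ev by simp
        moreover have "val_ge v (D (w j)) 0" using ev(4)[OF wj] by (simp add: val_ge_def)
        ultimately have "val_ge v (D (z ^ j) * w j) (0 + 0)" "val_ge v (z ^ j * D (w j)) (0 + 0)"
          using zj val_ge_mult[OF pv] by fastforce+
        thus ?thesis unfolding D_mult using val_ge_add[OF pv] by simp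
      qed
      thus ?thesis unfolding w(2) D_sum by (intro val_ge_sum[OF pv])
    qed
    \<comment> \<open>Elements of \<open>M\<close> with equal residues on \<open>T\<close> differ by
      one with a double zero at each place of \<open>T\<close>. Fixing the residues costs
      \<open>d\<close>, the double zeros gain \<open>2 * d\<close>, and the net gain
      \<open>d\<close> cannot exceed the constants.\<close>
    define B where "B v = (if v \<in> T then 2 else A v)" for v
    define U where "U = T \<union> T0"
    have U: "finite U" "U \<subseteq> PD" using T T0 TP by (auto simp: U_def)
    have B: "finite (RR B)" "card (RR B) \<le> q ^ (J * n + C - 2 * d + deg v0)"
    proof -
      have "B v = 0" if "v \<in> PD" "v \<notin> U" for v
        using that e0[of v] by (auto simp: B_def A_def U_def T0_def)
      hence RB: "finite (RR B) \<and> card (RR B) \<le> q ^ (nat (- (\<Sum>v\<in>U. B v * int (deg v))) + deg v0)"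
        using U v0 by (intro card_RR_bound) auto
      have disj: "T \<inter> T0 = {}" using T by blast
      have "(\<Sum>v\<in>U. B v * int (deg v)) = (\<Sum>v\<in>T. B v * int (deg v)) + (\<Sum>v\<in>T0. B v * int (deg v))"
        unfolding U_def using T T0 disj by (intro sum.union_disjoint) auto
      also have "(\<Sum>v\<in>T. B v * int (deg v)) = 2 * int d"
        by (simp add: B_def d_def sum_distrib_left)
      also have "(\<Sum>v\<in>T0. B v * int (deg v)) = (\<Sum>v\<in>T0. A v * int (deg v))"
        using disj by (intro sum.cong) (auto simp: B_def)
      also have "\<dots> = - (int J * (\<Sum>v\<in>T0. - min 0 (v z) * int (deg v)) + (\<Sum>v\<in>T0. c v * int (deg v)))"
        unfolding sum_distrib_left sum.distrib[symmetric] sum_negf[symmetric]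
        by (intro sum.cong refl) (simp add: A_def algebra_simps)
      also have "\<dots> = - (int J * int n + int C)" by (simp only: n C)
      finally have "- (\<Sum>v\<in>U. B v * int (deg v)) = int (J * n + C) - int (2 * d)" by simp
      hence "nat (- (\<Sum>v\<in>U. B v * int (deg v))) = J * n + C - 2 * d" by linarith
      thus "finite (RR B)" "card (RR B) \<le> q ^ (J * n + C - 2 * d + deg v0)" using RB by auto
    qed
    define R where "R = (\<Pi>\<^sub>E v\<in>T. carrier (residue_field v))"
    have R: "finite R" "card R = q ^ d"
    proof -
      show "finite R" unfolding R_def using T TP finite_residue_field by (intro finite_PiE) auto
      have "card R = (\<Prod>v\<in>T. q ^ deg v)"
        unfolding R_def using T TP card_residue by (subst card_PiE) (auto intro!: prod.cong)
      thus "card R = q ^ d" by (simp add: d_def power_sum)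
    qed
    have "finite M \<and> card M \<le> card R * card (RR B)"
    proof (rule fiber_card_bound[where \<phi> = "\<lambda>m. restrict (\<lambda>v. residue_class v m) T", OF R(1) B(1)])
      have "val_ge v m 0" if "m \<in> M" "v \<in> T" for m v
      proof -
        have "val_ge v m (A v)" using MA that TP unfolding RR_def by blast
        thus ?thesis using e0[OF Te[OF that(2)]] by (simp add: A_def)
      qed
      thus "(\<lambda>m. restrict (\<lambda>v. residue_class v m) T) ` M \<subseteq> R"
        by (auto simp: R_def residue_field_carrier)
      fix x y assume xy: "x \<in> M" "y \<in> M"
        "restrict (\<lambda>v. residue_class v x) T = restrict (\<lambda>v. residue_class v y) T"
      have "val_ge v (x - y) 2" if v: "v \<in> T" for v
      proof (rule bad_place_no_uniformizer)
        have pv: "prime_divisor k v" using v TP by auto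
        show "v \<in> bad_places" using v T by blast
        have "residue_class v x = residue_class v y" using xy(3) v by (metis restrict_apply')
        thus "val_ge v (x - y) 1" by (simp add: residue_class_eq_iff[OF pv])
        show "val_ge v (D (x - y)) 0" unfolding D_diff using DM xy v by (intro val_ge_diff[OF pv]) auto
      qed
      moreover have "x - y \<in> RR A" using xy MA RR_diff by blast
      ultimately show "x - y \<in> RR B" by (auto simp: RR_def B_def)
    qed
    hence "q ^ (n * (J + 1)) \<le> q ^ d * q ^ (J * n + C - 2 * d + deg v0)"
      using M B R by (metis le_trans mult_le_mono2)
    hence "q ^ (n * (J + 1)) \<le> q ^ (d + (J * n + C - 2 * d + deg v0))" by (simp add: power_add)
    hence "n * (J + 1) \<le> d + (J * n + C - 2 * d + deg v0)"
      by (rule power_le_imp_le_exp[of q, rotated]) (use q_ge_2 in linarith)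
    moreover have "2 * d \<le> J * n" using n1 by (simp add: J_def)
    moreover have "n * (J + 1) = J * n + n" by simp
    ultimately have "d \<le> C + deg v0" by linarith
    moreover have "card T \<le> d"
    proof -
      have "card T = (\<Sum>v\<in>T. 1)" by simp
      also have "\<dots> \<le> d" unfolding d_def using deg_pos TP by (intro sum_mono) (auto simp: Suc_le_eq)
      finally show ?thesis .
    qed
    ultimately show ?thesis by simp
  qed
  have "finite (bad_places - T0)"
  proof (rule ccontr)
    assume "infinite (bad_places - T0)"
    then obtain T where "T \<subseteq> bad_places - T0" "finite T" "card T = Suc (C + deg v0)"
      using infinite_arbitrarily_large by blast
    thus False using key[of T] by simp
  qed
  thus ?thesis using T0 by simp
qed

text \<open>At a good place the order drops only where \<open>g\<close> has a zero or a pole, and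
  then by at most one; \<open>c\<close> absorbs the bad places.\<close>

lemma D_bound: "\<exists>c. adm c \<and> (\<forall>v\<in>PD. \<forall>g. val_ge v (D g) (v g - of_bool (v g \<noteq> 0) - c v))"
proof -
  have "\<forall>v\<in>PD. \<exists>t. t \<noteq> 0 \<and> v t = 1" using uniformizer_exists by blast
  then obtain t where t: "\<And>v. v \<in> PD \<Longrightarrow> v (t v) = 1" by metis
  define c where "c v = (if v \<in> bad_places then 1 + \<bar>v (D (t v))\<bar> else 0)" for v
  show ?thesis
  proof (intro exI[of _ c] conjI ballI allI)
    show "adm c" unfolding adm_def fin_supp_def
      by (intro conjI finite_subset[OF _ finite_bad_places]) (auto simp: c_def)
    fix v g assume v: "v \<in> PD"
    hence pv: "prime_divisor k v" by simp
    have b: "val_ge v (D g) (v g - 1 + v (D (t v)))"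
      by (rule D_val_bound(1)[OF pv t[OF v]]) (simp add: val_ge_def)
    show "val_ge v (D g) (v g - of_bool (v g \<noteq> 0) - c v)"
    proof (cases "v \<in> bad_places")
      case True
      thus ?thesis by (intro val_ge_mono[OF b]) (auto simp: c_def)
    next
      case False
      hence good: "val_ge v (D h) 0" if "val_ge v h 0" for h using that v by (auto simp: bad_places_def)
      show ?thesis
      proof (cases "v g = 0")
        case True
        thus ?thesis using good[of g] False by (simp add: c_def val_ge_def)
      next
        case g0: False
        have "val_ge v (D (t v)) 0" using good t[OF v] by (simp add: val_ge_def)
        hence "0 \<le> v (D (t v))" using D_uniformizer[OF pv t[OF v]] by (simp add: val_ge_def)
        thus ?thesis using g0 False by (intro val_ge_mono[OF b]) (auto simp: c_def)
      qed
    qed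
  qed
qed

end

section \<open>Values of polynomials\<close>

lemma poly_bezout:
  fixes a b :: "'a::field poly"
  shows "\<exists>s t. (s * a + t * b) dvd a \<and> (s * a + t * b) dvd b"
proof (induction b arbitrary: a rule: measure_induct_rule[of "\<lambda>b. if b = 0 then 0 else Suc (Polynomial.degree b)"])
  case (less b)
  show ?case
  proof (cases "b = 0")
    case True
    thus ?thesis by (intro exI[of _ 1] exI[of _ 0]) auto
  next
    case False
    hence "(if a mod b = 0 then 0 else Suc (Polynomial.degree (a mod b))) < (if b = 0 then 0 else Suc (Polynomial.degree b))"
      using degree_mod_less[of b a] by auto
    from less[OF this, of b] obtain s t where st: "(s * b + t * (a mod b)) dvd b" "(s * b + t * (a mod b)) dvd a mod b"
      by blast
    have eq: "s * b + t * (a mod b) = t * a + (s - t * (a div b)) * b"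
    proof -
      have "t * a = t * (a div b * b) + t * (a mod b)" by (metis div_mult_mod_eq distrib_left)
      thus ?thesis by (simp add: algebra_simps)
    qed
    have "(s * b + t * (a mod b)) dvd a" using st by (metis dvd_mod_imp_dvd)
    thus ?thesis using st(1) unfolding eq by blast
  qed
qed

text \<open>The Bezout form, because such an identity can be evaluated at \<open>f\<close>, composed
  with substitutions and estimated at each place.\<close>

definition poly_coprime :: "'a::field poly \<Rightarrow> 'a poly \<Rightarrow> bool"
  where "poly_coprime a b \<longleftrightarrow> (\<exists>s t. s * a + t * b = 1)"

lemma poly_coprime_if_gcd_const:
  fixes a b :: "'a::field poly"
  assumes "\<And>d. d dvd a \<Longrightarrow> d dvd b \<Longrightarrow> Polynomial.degree d = 0" "a \<noteq> 0"
  shows "poly_coprime a b"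
proof -
  obtain s t where st: "(s * a + t * b) dvd a" "(s * a + t * b) dvd b" using poly_bezout by blast
  then obtain c where c: "s * a + t * b = [:c:]" using assms(1) degree_eq_zeroE by blast
  have "c \<noteq> 0" using st(1) assms(2) unfolding c by auto
  have "[:1 / c:] * (s * a + t * b) = 1" unfolding c using \<open>c \<noteq> 0\<close> by (simp add: pCons_one)
  hence "([:1 / c:] * s) * a + ([:1 / c:] * t) * b = 1" by (simp only: distrib_left mult.assoc)
  thus ?thesis unfolding poly_coprime_def by blast
qed

context growth_field
begin

text \<open>Degree of the reduced divisor: each zero or pole counts once, whatever its
  order.\<close>

definition degsupp :: "'k \<Rightarrow> nat"
  where "degsupp y = (\<Sum>v\<in>divisor_support k y. deg v)"

lemma finite_divisor_support: "finite (divisor_support k y)"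
  unfolding divisor_support_def by (rule finite_support)

lemma degsupp_mono_sum:
  assumes "\<And>v. v \<in> PD \<Longrightarrow> v x \<noteq> 0 \<Longrightarrow> v y \<noteq> 0 \<or> v z \<noteq> 0"
  shows "degsupp x \<le> degsupp y + degsupp z"
proof -
  have "degsupp x \<le> (\<Sum>v\<in>divisor_support k y \<union> divisor_support k z. deg v)"
    unfolding degsupp_def using assms finite_divisor_support
    by (intro sum_mono2) (auto simp: divisor_support_def)
  also have "\<dots> \<le> degsupp y + degsupp z"
    unfolding degsupp_def using finite_divisor_support by (simp add: sum_Un_nat)
  finally show ?thesis .
qed

text \<open>By the product formula the terms \<open>v y\<close> and \<open>v z\<close> disappear from the sum over all places.\<close>

lemma local_height_bound:
  assumes "adm c"
  shows "\<exists>C. \<forall>f y z w. (\<forall>v\<in>PD. v y - min 0 (v f) \<le> v z + of_bool (v w \<noteq> 0) + c v) \<longrightarrow>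
    height k f \<le> degsupp w + C"
proof -
  obtain C where C: "0 \<le> C" "\<And>T. finite T \<Longrightarrow> T \<subseteq> PD \<Longrightarrow> (\<Sum>v\<in>T. c v * int (deg v)) \<le> C"
    using fin_supp_bound[of c] assms unfolding adm_def by blast
  have "height k f \<le> degsupp w + nat C"
    if loc: "\<forall>v\<in>PD. v y - min 0 (v f) \<le> v z + of_bool (v w \<noteq> 0) + c v" for f y z w
  proof -
    define T where "T = {v\<in>PD. v y \<noteq> 0} \<union> {v\<in>PD. v z \<noteq> 0} \<union> {v\<in>PD. v f \<noteq> 0} \<union> {v\<in>PD. v w \<noteq> 0}"
    have T: "finite T" "T \<subseteq> PD"
      using fin_supp_value[of y] fin_supp_value[of z] fin_supp_value[of f] fin_supp_value[of w]
      by (auto simp: T_def fin_supp_def)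
    have y: "(\<Sum>v\<in>T. v y * int (deg v)) = 0" using T by (intro sum_formula) (auto simp: T_def)
    have z: "(\<Sum>v\<in>T. v z * int (deg v)) = 0" using T by (intro sum_formula) (auto simp: T_def)
    have f: "int (height k f) = (\<Sum>v\<in>T. - min 0 (v f) * int (deg v))"
      using T by (intro height_eq_poles) (auto simp: T_def)
    have w: "(\<Sum>v\<in>T. of_bool (v w \<noteq> 0) * int (deg v)) = int (degsupp w)"
    proof -
      have "(\<Sum>v\<in>T. of_bool (v w \<noteq> 0) * int (deg v)) = (\<Sum>v\<in>divisor_support k w. of_bool (v w \<noteq> 0) * int (deg v))"
        using T by (intro sum.mono_neutral_right) (auto simp: T_def divisor_support_def)
      also have "\<dots> = (\<Sum>v\<in>divisor_support k w. int (deg v))"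
        by (intro sum.cong) (auto simp: divisor_support_def)
      finally show ?thesis by (simp add: degsupp_def)
    qed
    have "(\<Sum>v\<in>T. (v y - min 0 (v f)) * int (deg v))
        \<le> (\<Sum>v\<in>T. (v z + of_bool (v w \<noteq> 0) + c v) * int (deg v))"
      using loc T(2) by (intro sum_mono mult_right_mono) auto
    moreover have "(\<Sum>v\<in>T. (v y - min 0 (v f)) * int (deg v)) = int (height k f)"
      unfolding f using y by (simp add: algebra_simps sum.distrib sum_subtractf sum_negf)
    moreover have "(\<Sum>v\<in>T. (v z + of_bool (v w \<noteq> 0) + c v) * int (deg v))
        = int (degsupp w) + (\<Sum>v\<in>T. c v * int (deg v))"
      using z w by (simp add: distrib_right sum.distrib)
    ultimately show ?thesis using C(2)[OF T] C(1) by linarith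
  qed
  thus ?thesis by blast
qed

section \<open>Local estimates for polynomial values\<close>

lemma poly_lower_bound:
  assumes "Polynomial.degree P \<le> n"
  shows "\<exists>c. adm c \<and> (\<forall>v\<in>PD. \<forall>f. val_ge v (poly P f) (int n * min 0 (v f) - c v))"
proof -
  define c where "c v = (\<Sum>i\<le>n. \<bar>v (coeff P i)\<bar>)" for v :: "'k \<Rightarrow> int"
  have "adm c" unfolding c_def by (intro adm_sum adm_abs_value)
  moreover have "val_ge v (poly P f) (int n * min 0 (v f) - c v)" if "v \<in> PD" for v f
  proof -
    have pv: "prime_divisor k v" using that by simp
    show ?thesis unfolding poly_eq_sum_atMost[OF assms]
    proof (rule val_ge_sum[OF pv])
      fix i assume i: "i \<in> {..n}"
      have "\<bar>v (coeff P i)\<bar> \<le> c v" unfolding c_def using i by (intro member_le_sum) auto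
      hence "- c v \<le> v (coeff P i)" by linarith
      hence 1: "val_ge v (coeff P i) (- c v)" by (rule val_ge_self)
      have "val_ge v f (min 0 (v f))" by (simp add: val_ge_def)
      hence "val_ge v (f ^ i) (int i * min 0 (v f))" by (rule val_ge_power[OF pv])
      moreover have "int n * min 0 (v f) \<le> int i * min 0 (v f)" using i by (intro mult_right_mono_neg) auto
      ultimately have "val_ge v (f ^ i) (int n * min 0 (v f))" by (rule val_ge_mono)
      from val_ge_mult[OF pv 1 this] show "val_ge v (coeff P i * f ^ i) (int n * min 0 (v f) - c v)"
        by (simp add: algebra_simps)
    qed
  qed
  ultimately show ?thesis by blast
qed

text \<open>A large pole of \<open>f\<close> makes the leading term dominate; otherwise
  \<open>c\<close> absorbs the claim. Quantifying over bounds \<open>a \<le> 0\<close> treats poles,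
  zeros and vanishing of \<open>poly P f\<close> at once.\<close>

lemma poly_upper_bound:
  assumes "P \<noteq> 0" "d = Polynomial.degree P"
  shows "\<exists>c. adm c \<and> (\<forall>v\<in>PD. \<forall>f a. a \<le> 0 \<longrightarrow> val_ge v (poly P f) a \<longrightarrow> a \<le> int d * min 0 (v f) + c v)"
proof (cases "d = 0")
  case True
  have "adm (\<lambda>v. 0)" by (simp add: adm_def fin_supp_0)
  thus ?thesis using True by (intro exI[of _ "\<lambda>v. 0"]) auto
next
  case False
  define l where "l = Polynomial.lead_coeff P"
  have l: "l \<noteq> 0" using assms by (simp add: l_def)
  define R where "R = P - monom l d"
  have "Polynomial.degree R \<le> d - 1"
  proof (rule degree_le, intro allI impI)
    fix i assume "d - 1 < i"
    thus "coeff R i = 0" using False assms(2) by (cases "i = d") (auto simp: R_def l_def coeff_eq_0)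
  qed
  from poly_lower_bound[OF this] obtain c where c: "adm c"
    "\<And>v f. v \<in> PD \<Longrightarrow> val_ge v (poly R f) (int (d - 1) * min 0 (v f) - c v)" by blast
  \<comment> \<open>One copy of \<open>c v + \<bar>v l\<bar>\<close> pays for the leading
    coefficient, the other \<open>d\<close> copies for a pole of \<open>f\<close> of at most that
    order.\<close>
  define e where "e v = int (Suc d) * (c v + \<bar>v l\<bar>)" for v :: "'k \<Rightarrow> int"
  have "adm e" unfolding e_def by (intro adm_scale adm_add c(1) adm_abs_value)
  moreover have "a \<le> int d * min 0 (v f) + e v" if v: "v \<in> PD" and a: "a \<le> 0" "val_ge v (poly P f) a" for v f a
  proof -
    have pv: "prime_divisor k v" using v by simp
    define b where "b = c v + \<bar>v l\<bar>"
    have b: "0 \<le> b" using c(1) by (simp add: b_def adm_def)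
    have e: "e v = int d * b + b" by (simp add: e_def b_def algebra_simps)
    show ?thesis
    proof (cases "- b \<le> v f")
      case True
      hence "- b \<le> min 0 (v f)" using b by simp
      hence "int d * (- b) \<le> int d * min 0 (v f)" by (intro mult_left_mono) auto
      thus ?thesis using a b e by simp
    next
      case False
      hence f: "f \<noteq> 0" "v f < - b" using v_0[OF pv] b by auto
      have vl: "v (l * f ^ d) = v l + int d * v f" using l f by (simp add: v_mult[OF pv] v_power[OF pv])
      have "int d * v f = int (d - 1) * v f + v f" using \<open>d \<noteq> 0\<close> by (simp add: of_nat_diff algebra_simps)
      hence "v (l * f ^ d) + 1 \<le> int (d - 1) * min 0 (v f) - c v" using f b vl unfolding b_def by simp
      hence "val_ge v (poly R f) (v (l * f ^ d) + 1)" using c(2)[OF v] val_ge_mono by blast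
      hence "l * f ^ d + poly R f \<noteq> 0 \<and> v (l * f ^ d + poly R f) = v (l * f ^ d)"
        using v_dominant[OF pv, of "l * f ^ d"] l f by simp
      moreover have "poly P f = l * f ^ d + poly R f" by (simp add: R_def poly_monom)
      ultimately have "a \<le> v l + int d * v f" using a(2) vl by (auto simp: val_ge_def)
      moreover have "0 \<le> c v" using c(1) by (simp add: adm_def)
      hence "v l \<le> b" unfolding b_def by linarith
      moreover have "0 \<le> int d * b" using b by simp
      moreover have "min 0 (v f) = v f" using f b by simp
      ultimately show ?thesis using e by simp
    qed
  qed
  ultimately show ?thesis by blast
qed

lemma height_poly_le:
  "\<exists>C. \<forall>f. height k (poly P f) \<le> Polynomial.degree P * height k f + C"
proof -
  define n where "n = Polynomial.degree P"
  obtain c where c: "adm c" "\<And>v f. v \<in> PD \<Longrightarrow> val_ge v (poly P f) (int n * min 0 (v f) - c v)"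
    using poly_lower_bound[of P n] by (auto simp: n_def)
  obtain C where C: "0 \<le> C" "\<And>T. finite T \<Longrightarrow> T \<subseteq> PD \<Longrightarrow> (\<Sum>v\<in>T. c v * int (deg v)) \<le> C"
    using fin_supp_bound[of c] c(1) unfolding adm_def by blast
  have "height k (poly P f) \<le> n * height k f + nat C" for f
  proof -
    define T where "T = {v\<in>PD. v f \<noteq> 0} \<union> {v\<in>PD. v (poly P f) \<noteq> 0}"
    have T: "finite T" "T \<subseteq> PD"
      using fin_supp_value[of f] fin_supp_value[of "poly P f"] by (auto simp: T_def fin_supp_def)
    have "int (height k (poly P f)) = (\<Sum>v\<in>T. - min 0 (v (poly P f)) * int (deg v))"
      using T by (intro height_eq_poles) (auto simp: T_def)
    also have "\<dots> \<le> (\<Sum>v\<in>T. int n * (- min 0 (v f) * int (deg v)) + c v * int (deg v))"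
    proof (rule sum_mono)
      fix v assume "v \<in> T"
      hence v: "v \<in> PD" using T by blast
      hence pv: "prime_divisor k v" by simp
      have c0: "0 \<le> c v" using c(1) by (simp add: adm_def)
      have m0: "int n * min 0 (v f) \<le> 0" by (simp add: mult_nonneg_nonpos)
      have "int n * min 0 (v f) - c v \<le> min 0 (v (poly P f))"
        using c(2)[OF v, of f] v_0[OF pv] c0 m0 by (auto simp: val_ge_def)
      hence "- min 0 (v (poly P f)) * int (deg v) \<le> (int n * (- min 0 (v f)) + c v) * int (deg v)"
        by (intro mult_right_mono) auto
      thus "- min 0 (v (poly P f)) * int (deg v) \<le> int n * (- min 0 (v f) * int (deg v)) + c v * int (deg v)"
        by (simp add: algebra_simps)
    qed
    also have "\<dots> = int n * int (height k f) + (\<Sum>v\<in>T. c v * int (deg v))"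
      unfolding sum.distrib sum_distrib_left[symmetric]
      using T height_eq_poles[of T f] by (auto simp: T_def)
    finally show ?thesis using C(2)[OF T] C(1) by (simp add: nat_le_iff le_nat_iff zle_int[symmetric] del: zle_int)
  qed
  thus ?thesis unfolding n_def by blast
qed

text \<open>If \<open>y\<close> vanishes to order above \<open>e\<close>, then \<open>a * y\<close>
  has positive value, so \<open>b * x\<close> is a unit and \<open>x\<close> vanishes at most as far
  as \<open>b\<close> has a pole.\<close>

lemma v_cofactor_bound:
  assumes v: "prime_divisor k v" and one: "a * y + b * x = 1"
    and a: "val_ge v a (- e)" and b: "val_ge v b (- e)" and y: "y \<noteq> 0" "e < v y"
  shows "x \<noteq> 0 \<and> v x \<le> e"
proof -
  have "val_ge v (a * y) (- e + v y)" using val_ge_mult_right[OF v a] .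
  hence ay: "val_ge v (- (a * y)) (v 1 + 1)"
    using y by (auto simp: v_1[OF v] val_ge_uminus[OF v] intro: val_ge_mono)
  have "b * x = 1 + - (a * y)" using one by (simp add: algebra_simps)
  moreover have "1 + - (a * y) \<noteq> 0 \<and> v (1 + - (a * y)) = 0"
    using v_dominant[OF v _ ay] v_1[OF v] by simp
  ultimately have "b \<noteq> 0" "x \<noteq> 0" "v (b * x) = 0" by auto
  thus ?thesis using b v_mult[OF v, of b x] by (auto simp: val_ge_def)
qed

end

context derivation_field
begin

lemma coeff_map_poly_D: "coeff (map_poly D P) i = D (coeff P i)"
  by (simp add: coeff_map_poly D_0)

lemma map_poly_D_pCons: "map_poly D (pCons a P) = pCons (D a) (map_poly D P)"
  by (rule map_poly_pCons[of D, OF D_0])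

lemma map_poly_D_add: "map_poly D (P + Q) = map_poly D P + map_poly D Q"
  by (simp add: poly_eq_iff coeff_map_poly_D D_add)

lemma map_poly_D_mult: "map_poly D (P * Q) = map_poly D P * Q + P * map_poly D Q"
  by (simp add: poly_eq_iff coeff_map_poly_D coeff_mult D_sum D_mult sum.distrib)

lemma D_poly: "D (poly P f) = poly (map_poly D P) f + poly (pderiv P) f * D f"
proof (induction P)
  case (pCons a P)
  thus ?case by (simp add: map_poly_D_pCons pderiv_pCons D_add D_mult algebra_simps)
qed (simp add: D_0)

lemma degree_map_poly_D: "Polynomial.degree (map_poly D P) \<le> Polynomial.degree P"
  by (rule degree_le) (simp add: coeff_map_poly_D coeff_eq_0 D_0)

text \<open>The factor \<open>C\<close> leaves room for the descent: pulling back along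
  \<open>p\<close>-th powers multiplies heights by \<open>p\<close> but changes the support only by
  a fixed set.\<close>

definition bounded_by_support :: "'k poly \<Rightarrow> bool"
  where "bounded_by_support F \<longleftrightarrow>
    (\<exists>C. \<forall>f. poly F f \<noteq> 0 \<longrightarrow> height k f \<le> C * (1 + degsupp (poly F f)))"

lemma bounded_by_support_additive:
  assumes "\<And>f. poly F f \<noteq> 0 \<Longrightarrow> height k f \<le> degsupp (poly F f) + C"
  shows "bounded_by_support F"
  unfolding bounded_by_support_def
proof (intro exI[of _ "Suc C"] allI impI)
  fix f assume "poly F f \<noteq> 0"
  thus "height k f \<le> Suc C * (1 + degsupp (poly F f))" using assms[of f] by simp
qed

text \<open>
  If \<open>G\<close> is inseparable, \<open>D (G f)\<close> does not involve \<open>D f\<close>, hence is coprime to \<open>G f\<close> outside finitely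
  many places, where therefore all zeros of \<open>G f\<close> are simple.
\<close>

lemma inseparable_factor_bound:
  assumes F: "F = G * H" and G: "G \<noteq> 0" "0 < Polynomial.degree G" "pderiv G = 0"
    and cop: "poly_coprime G (map_poly D G)"
  shows "bounded_by_support F"
proof -
  obtain A B where AB: "A * G + B * map_poly D G = 1" using cop by (auto simp: poly_coprime_def)
  define n where "n = Polynomial.degree G"
  define N where "N = Polynomial.degree A + Polynomial.degree B + Polynomial.degree H"
  obtain c1 where c1: "adm c1" "\<And>v g. v \<in> PD \<Longrightarrow> val_ge v (D g) (v g - of_bool (v g \<noteq> 0) - c1 v)"
    using D_bound by blast
  obtain c2 where c2: "adm c2" "\<And>v f a. v \<in> PD \<Longrightarrow> a \<le> 0 \<Longrightarrow> val_ge v (poly G f) a \<Longrightarrow> a \<le> int n * min 0 (v f) + c2 v"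
    using poly_upper_bound[OF G(1) n_def] by blast
  obtain c3 where c3: "adm c3" "\<And>v f. v \<in> PD \<Longrightarrow> val_ge v (poly A f) (int N * min 0 (v f) - c3 v)"
    using poly_lower_bound[of A N] by (auto simp: N_def)
  obtain c4 where c4: "adm c4" "\<And>v f. v \<in> PD \<Longrightarrow> val_ge v (poly B f) (int N * min 0 (v f) - c4 v)"
    using poly_lower_bound[of B N] by (auto simp: N_def)
  obtain c5 where c5: "adm c5" "\<And>v f. v \<in> PD \<Longrightarrow> val_ge v (poly H f) (int N * min 0 (v f) - c5 v)"
    using poly_lower_bound[of H N] by (auto simp: N_def)
  define c where "c v = c1 v + (c2 v + (c3 v + (c4 v + c5 v)))" for v
  have c: "adm c" unfolding c_def by (intro adm_add c1 c2 c3 c4 c5)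
  have le: "c1 v \<le> c v" "c2 v \<le> c v" "c3 v \<le> c v" "c4 v \<le> c v" "c5 v \<le> c v" "0 \<le> c v" for v
  proof -
    have "0 \<le> c1 v" "0 \<le> c2 v" "0 \<le> c3 v" "0 \<le> c4 v" "0 \<le> c5 v"
      using c1 c2 c3 c4 c5 by (auto simp: adm_def)
    thus "c1 v \<le> c v" "c2 v \<le> c v" "c3 v \<le> c v" "c4 v \<le> c v" "c5 v \<le> c v" "0 \<le> c v"
      by (auto simp: c_def)
  qed
  \<comment> \<open>At a zero of \<open>g\<close> the estimate will be
    \<open>1 + (N + 3) * c v\<close>; the fourth \<open>c v\<close> pays for the 1 where
    \<open>c v\<close> is positive.\<close>
  obtain C where C: "\<And>f y z w. (\<And>v. v \<in> PD \<Longrightarrow> v y - min 0 (v f) \<le> v z + of_bool (v w \<noteq> 0) + int (N + 4) * c v)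
      \<Longrightarrow> height k f \<le> degsupp w + C"
    using local_height_bound[OF adm_scale[OF c, of "N + 4"]] by blast
  show ?thesis
  proof (rule bounded_by_support_additive)
    fix f assume Ff: "poly F f \<noteq> 0"
    define g where "g = poly G f"
    define h where "h = poly H f"
    have gh: "g \<noteq> 0" "h \<noteq> 0" "poly F f = g * h" using Ff by (auto simp: F g_def h_def)
    have Dg: "D g = poly (map_poly D G) f" by (simp add: g_def D_poly G(3))
    have one: "poly A f * g + poly B f * D g = 1"
    proof -
      have "poly (A * G + B * map_poly D G) f = 1" by (simp only: AB poly_1)
      thus ?thesis unfolding Dg by (simp add: g_def)
    qed
    show "height k f \<le> degsupp (poly F f) + C"
    \<comment> \<open>The values of \<open>g\<close> add up to zero. Up to errors a pole of
      \<open>g\<close> outweighs the pole of \<open>f\<close>, as the degree of \<open>G\<close> is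
      positive, and a zero of \<open>g\<close> contributes at most 1.\<close>
    proof (rule C[of g f 1])
      fix v assume v: "v \<in> PD"
      hence pv: "prime_divisor k v" by simp
      define m where "m = min 0 (v f)"
      have m: "m \<le> 0" by (simp add: m_def)
      have nm: "int n * m \<le> m"
        using mult_right_mono_neg[of 1 "int n" m] G(2) m by (simp add: n_def)
      have Nc0: "0 \<le> int N * c v" using le(6)[of v] by simp
      have exp: "int (N + 4) * c v = int N * c v + 4 * c v" by (simp add: algebra_simps)
      have "v g - m \<le> of_bool (v (poly F f) \<noteq> 0) + int (N + 4) * c v"
      proof (cases "v g \<le> 0")
        case True
        have "v g \<le> int n * m + c2 v"
          unfolding m_def using c2(2)[OF v True, of f] by (simp add: g_def val_ge_def)
        hence "v g - m \<le> c v" using nm le(2)[of v] by linarith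
        moreover have "0 \<le> (of_bool (v (poly F f) \<noteq> 0) :: int)" by simp
        ultimately show ?thesis using exp Nc0 le(6)[of v] by linarith
      next
        case False
        have "0 \<le> int n * m + c2 v"
          unfolding m_def by (rule c2(2)[OF v]) (use False in \<open>auto simp: g_def[symmetric] val_ge_def\<close>)
        hence mc: "- c v \<le> m" using nm le(2)[of v] by linarith
        define e where "e = int N * c v + c v"
        have Nm: "- (int N * c v) \<le> int N * m" using mc mult_left_mono[OF mc, of "int N"] by simp
        have A: "val_ge v (poly A f) (- e)" "val_ge v (poly B f) (- e)" "val_ge v h (- e)"
          using c3(2)[OF v, of f] c4(2)[OF v, of f] c5(2)[OF v, of f] Nm le[of v]
          unfolding m_def[symmetric] e_def h_def by (auto intro: val_ge_mono)
        have vg: "v g \<le> 1 + e + c v"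
        proof (cases "e < v g")
          case True
          have "D g \<noteq> 0 \<and> v (D g) \<le> e" by (rule v_cofactor_bound[OF pv one A(1,2) gh(1) True])
          moreover have "val_ge v (D g) (v g - 1 - c1 v)" using c1(2)[OF v, of g] False by simp
          ultimately show ?thesis using le(1)[of v] by (auto simp: val_ge_def)
        qed (use le(6)[of v] in linarith)
        show ?thesis
        \<comment> \<open>Without error at \<open>v\<close> the cofactor \<open>h\<close> is
          integral, so the zero of \<open>g\<close> belongs to the support of \<open>F f\<close>;
          otherwise \<open>c v \<ge> 1\<close> pays for it.\<close>
        proof (cases "c v = 0")
          case True
          have "0 \<le> v h" using A(3) gh True by (simp add: val_ge_def e_def)
          hence "v (poly F f) \<noteq> 0" using gh False by (simp add: v_mult[OF pv])
          thus ?thesis using True vg mc m by (simp add: e_def)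
        next
          case False
          hence "1 \<le> c v" using le(6)[of v] by linarith
          moreover have "0 \<le> (of_bool (v (poly F f) \<noteq> 0) :: int)" by simp
          ultimately show ?thesis using vg mc exp unfolding e_def by linarith
        qed
      qed
      thus "v g - min 0 (v f) \<le> v 1 + of_bool (v (poly F f) \<noteq> 0) + int (N + 4) * c v"
        by (simp add: m_def v_1[OF pv])
    qed
  qed
qed

text \<open>
  Here \<open>P\<close> interpolates the derivatives of the roots of \<open>F\<close>, so that at the zeros of \<open>y = F f\<close>, up to
  finitely many places, \<open>z = D f - P f\<close> vanishes to almost the same order as \<open>y\<close>.
\<close>

lemma separable_bound:
  assumes n: "n = Polynomial.degree F" "2 \<le> n" and AB: "A * F + B * pderiv F = 1"
    and P: "Polynomial.degree P < n" "map_poly D F + pderiv F * P = F * Q"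
  shows "\<exists>C. \<forall>f. poly F f \<noteq> 0 \<longrightarrow> D f \<noteq> poly P f \<or> 2 \<le> Polynomial.degree P \<longrightarrow>
    height k f \<le> degsupp (poly F f) + C"
proof -
  define N where "N = Polynomial.degree A + Polynomial.degree B + Polynomial.degree Q"
  define d where "d = Polynomial.degree P"
  have F0: "F \<noteq> 0" using n by auto
  obtain c1 where c1: "adm c1" "\<And>v g. v \<in> PD \<Longrightarrow> val_ge v (D g) (v g - of_bool (v g \<noteq> 0) - c1 v)"
    using D_bound by blast
  obtain c2 where c2: "adm c2" "\<And>v f a. v \<in> PD \<Longrightarrow> a \<le> 0 \<Longrightarrow> val_ge v (poly F f) a \<Longrightarrow> a \<le> int n * min 0 (v f) + c2 v"
    using poly_upper_bound[OF F0 n(1)] by blast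
  obtain c3 where c3: "adm c3" "\<And>v f. v \<in> PD \<Longrightarrow> val_ge v (poly A f) (int N * min 0 (v f) - c3 v)"
    using poly_lower_bound[of A N] by (auto simp: N_def)
  obtain c4 where c4: "adm c4" "\<And>v f. v \<in> PD \<Longrightarrow> val_ge v (poly B f) (int N * min 0 (v f) - c4 v)"
    using poly_lower_bound[of B N] by (auto simp: N_def)
  obtain c5 where c5: "adm c5" "\<And>v f. v \<in> PD \<Longrightarrow> val_ge v (poly Q f) (int N * min 0 (v f) - c5 v)"
    using poly_lower_bound[of Q N] by (auto simp: N_def)
  obtain c6 where c6: "adm c6" "\<And>v f. v \<in> PD \<Longrightarrow> val_ge v (poly P f) (int (n - 1) * min 0 (v f) - c6 v)"
  proof -
    have "Polynomial.degree P \<le> n - 1" using P(1) by simp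
    from poly_lower_bound[OF this] show ?thesis using that by blast
  qed
  obtain c7 where c7: "adm c7" "\<And>v f a. 2 \<le> d \<Longrightarrow> v \<in> PD \<Longrightarrow> a \<le> 0 \<Longrightarrow> val_ge v (poly P f) a \<Longrightarrow> a \<le> int d * min 0 (v f) + c7 v"
  proof (cases "P = 0")
    case True
    thus ?thesis by (intro that[of c6] c6) (simp add: d_def)
  next
    case False
    thus ?thesis using poly_upper_bound[OF False d_def] that by blast
  qed
  define c where "c v = c1 v + (c2 v + (c3 v + (c4 v + (c5 v + (c6 v + c7 v)))))" for v
  have c: "adm c" unfolding c_def by (intro adm_add c1 c2 c3 c4 c5 c6 c7)
  have le: "c1 v \<le> c v" "c2 v \<le> c v" "c3 v \<le> c v" "c4 v \<le> c v" "c5 v \<le> c v" "c6 v \<le> c v" "c7 v \<le> c v" "0 \<le> c v" for v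
  proof -
    have "0 \<le> c1 v" "0 \<le> c2 v" "0 \<le> c3 v" "0 \<le> c4 v" "0 \<le> c5 v" "0 \<le> c6 v" "0 \<le> c7 v"
      using c1 c2 c3 c4 c5 c6 c7 by (auto simp: adm_def)
    thus "c1 v \<le> c v" "c2 v \<le> c v" "c3 v \<le> c v" "c4 v \<le> c v" "c5 v \<le> c v" "c6 v \<le> c v" "c7 v \<le> c v" "0 \<le> c v"
      by (auto simp: c_def)
  qed
  define K where "K = n + 2 * N + 8"
  obtain C where C: "\<And>f y z w. (\<And>v. v \<in> PD \<Longrightarrow> v y - min 0 (v f) \<le> v z + of_bool (v w \<noteq> 0) + int K * c v)
      \<Longrightarrow> height k f \<le> degsupp w + C"
    using local_height_bound[OF adm_scale[OF c, of K]] by blast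
  have "height k f \<le> degsupp (poly F f) + C"
    if y0: "poly F f \<noteq> 0" and alt: "D f \<noteq> poly P f \<or> 2 \<le> Polynomial.degree P" for f
  proof -
    define y where "y = poly F f"
    define z where "z = D f - poly P f"
    have y: "y \<noteq> 0" using y0 by (simp add: y_def)
    \<comment> \<open>The identity for \<open>P\<close> removes \<open>D f\<close> from the chain
      rule. Both terms on the right vanish almost as far as \<open>y\<close>, and
      \<open>F' (f)\<close> on the left is coprime to \<open>y\<close>.\<close>
    have Dy: "poly (pderiv F) f * z = D y - poly Q f * y"
    proof -
      have "poly (map_poly D F) f + poly (pderiv F) f * poly P f = poly F f * poly Q f"
        unfolding poly_mult[symmetric] poly_add[symmetric] P(2) ..
      thus ?thesis unfolding y_def z_def D_poly by (simp add: algebra_simps)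
    qed
    have one: "poly A f * y + poly B f * poly (pderiv F) f = 1"
      unfolding y_def poly_mult[symmetric] poly_add[symmetric] AB by simp
    have local: "v y \<le> 0 \<Longrightarrow> v y \<le> int n * m + c v" "0 < v y \<Longrightarrow> - c v \<le> m"
      "val_ge v (D f) (m - of_bool (m < 0) - c v)"
      "(of_bool (m < 0) :: int) \<le> of_bool (v y \<noteq> 0) + c v" "int n * m \<le> m" "m \<le> 0"
      if v: "v \<in> PD" and m: "m = min 0 (v f)" for v m
    proof -
      have pv: "prime_divisor k v" using v by simp
      show m0: "m \<le> 0" by (simp add: m)
      show nm: "int n * m \<le> m"
        using mult_right_mono_neg[of 1 "int n" m] n(2) m0 by linarith
      show neg: "v y \<le> int n * m + c v" if "v y \<le> 0"
        unfolding m using c2(2)[OF v that, of f] le(2)[of v] by (simp add: y_def val_ge_def)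
      show pos: "- c v \<le> m" if "0 < v y"
      proof -
        have "0 \<le> int n * m + c2 v"
          unfolding m by (rule c2(2)[OF v]) (use that in \<open>auto simp: y_def[symmetric] val_ge_def\<close>)
        thus ?thesis using nm le(2)[of v] by linarith
      qed
      show "val_ge v (D f) (m - of_bool (m < 0) - c v)"
        by (rule val_ge_mono[OF c1(2)[OF v]]) (use le(1)[of v] in \<open>auto simp: m min_def of_bool_def\<close>)
      show "(of_bool (m < 0) :: int) \<le> of_bool (v y \<noteq> 0) + c v"
      proof (cases "v y = 0 \<and> m < 0")
        case True
        hence "1 \<le> c v" using neg nm by linarith
        thus ?thesis using True by simp
      qed (use le(8)[of v] in \<open>auto simp: of_bool_def\<close>)
    qed
    show ?thesis
    proof (cases "z = 0")
      case False
      show ?thesis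
      proof (rule C[of y f z], fold y_def)
        fix v assume v: "v \<in> PD"
        hence pv: "prime_divisor k v" by simp
        define m where "m = min 0 (v f)"
        note loc = local[OF v m_def]
        have n1: "int (n - 1) * m = int n * m - m" using n(2) by (simp add: of_nat_diff algebra_simps)
        have n1m: "int (n - 1) * m \<le> m"
        proof -
          have "int (n - 1) * m \<le> 1 * m" using n(2) loc(6) by (intro mult_right_mono_neg) auto
          thus ?thesis by simp
        qed
        have z1: "int n * m - m - of_bool (m < 0) - c v \<le> v z"
        proof -
          have "val_ge v (D f) (int n * m - m - of_bool (m < 0) - c v)"
            using n1 n1m by (intro val_ge_mono[OF loc(3)]) auto
          moreover have "val_ge v (poly P f) (int n * m - m - of_bool (m < 0) - c v)"
            using c6(2)[OF v, of f] n1 le(6)[of v] unfolding m_def[symmetric]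
            by (rule_tac val_ge_mono) auto
          ultimately have "val_ge v z (int n * m - m - of_bool (m < 0) - c v)"
            unfolding z_def by (rule val_ge_diff[OF pv])
          thus ?thesis using False by (simp add: val_ge_def)
        qed
        have Nc0: "0 \<le> int N * c v" "0 \<le> int n * c v" using le(8)[of v] by auto
        have expK: "int K * c v = int n * c v + 2 * (int N * c v) + 8 * c v"
          by (simp add: K_def algebra_simps)
        have "v y - m \<le> v z + of_bool (v y \<noteq> 0) + int K * c v"
        \<comment> \<open>Here \<open>y\<close> has a pole of order at least \<open>- n * m\<close>
          up to errors, and \<open>z\<close> one of order at most \<open>- (n - 1) * m + 1\<close>.
          The difference covers the pole \<open>- m\<close> of \<open>f\<close>, and the 1, which
          arises only if \<open>f\<close> has a pole, falls into the support of
          \<open>y\<close>.\<close>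
        proof (cases "v y \<le> 0")
          case True
          show ?thesis using loc(1)[OF True] z1 loc(4) expK Nc0 le(8)[of v] by linarith
        next
          case pos: False
          have mc: "- c v \<le> m" using loc(2) pos by simp
          define e where "e = int N * c v + c v"
          have Nm: "- (int N * c v) \<le> int N * m" using mult_left_mono[OF mc, of "int N"] by simp
          have nmc: "- (int n * c v) \<le> int n * m" using mult_left_mono[OF mc, of "int n"] by simp
          have E: "val_ge v (poly A f) (- e)" "val_ge v (poly B f) (- e)" "val_ge v (poly Q f) (- e)"
            using c3(2)[OF v, of f] c4(2)[OF v, of f] c5(2)[OF v, of f] Nm le[of v]
            unfolding m_def[symmetric] e_def by (auto intro: val_ge_mono)
          have ob: "(of_bool (v y \<noteq> 0) :: int) = 1" using pos by simp
          have obm: "(of_bool (m < 0) :: int) \<le> 1" by simp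
          show ?thesis
          proof (cases "e < v y")
            case True
            have F': "poly (pderiv F) f \<noteq> 0" "v (poly (pderiv F) f) \<le> e"
              using v_cofactor_bound[OF pv one E(1,2) y True] by auto
            have "val_ge v (D y) (v y - 1 - c v - e)"
            proof (rule val_ge_mono[OF c1(2)[OF v]])
              show "v y - 1 - c v - e \<le> v y - of_bool (v y \<noteq> 0) - c1 v"
                using le(1,8)[of v] Nc0 ob unfolding e_def by linarith
            qed
            moreover have "val_ge v (poly Q f * y) (v y - 1 - c v - e)"
              using le(8)[of v] by (intro val_ge_mono[OF val_ge_mult_right[OF pv E(3)]]) auto
            ultimately have "val_ge v (poly (pderiv F) f * z) (v y - 1 - c v - e)"
              unfolding Dy by (rule val_ge_diff[OF pv])
            hence "v y - 1 - c v - e \<le> v (poly (pderiv F) f) + v z"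
              using F' False by (simp add: val_ge_def v_mult[OF pv])
            thus ?thesis using F'(2) mc ob expK Nc0 le(8)[of v] unfolding e_def by linarith
          next
            case False
            thus ?thesis using z1 nmc mc obm ob expK Nc0 le(8)[of v] loc(6) unfolding e_def by linarith
          qed
        qed
        thus "v y - min 0 (v f) \<le> v z + of_bool (v y \<noteq> 0) + int K * c v" by (simp add: m_def)
      qed
    next
      case True
      hence Df: "D f = poly P f" and d2: "2 \<le> d" using alt by (auto simp: z_def d_def)
      show ?thesis
      \<comment> \<open>\<open>D f\<close> has a pole of order at most \<open>1 - m\<close>, while
        \<open>P f\<close> has one of order about \<open>- d * m\<close> with
        \<open>d \<ge> 2\<close>. So up to errors the poles of \<open>f\<close> are simple, and they
        are poles of \<open>y\<close>.\<close>
      proof (rule C[of 1 f 1], fold y_def)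
        fix v assume v: "v \<in> PD"
        hence pv: "prime_divisor k v" by simp
        define m where "m = min 0 (v f)"
        note loc = local[OF v m_def]
        have "m - of_bool (m < 0) - c v \<le> int d * min 0 (v f) + c7 v"
          using loc(3,6) le(8)[of v] unfolding Df by (intro c7(2)[OF d2 v]) auto
        moreover have "int d * m \<le> 2 * m" using d2 loc(6) by (intro mult_right_mono_neg) auto
        moreover have "0 \<le> int n * c v" "0 \<le> int N * c v" using le(8)[of v] by auto
        moreover have "int K * c v = int n * c v + 2 * (int N * c v) + 8 * c v"
          by (simp add: K_def algebra_simps)
        ultimately have "- m \<le> of_bool (v y \<noteq> 0) + int K * c v"
          using loc(4) le(7,8)[of v] unfolding m_def[symmetric] by linarith
        thus "v 1 - min 0 (v f) \<le> v 1 + of_bool (v y \<noteq> 0) + int K * c v"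
          by (simp add: m_def)
      qed
    qed
  qed
  thus ?thesis by blast
qed

end

section \<open>Descent along p-th powers\<close>

lemma CHAR_poly_eq: "CHAR('a::field poly) = CHAR('a)"
proof (rule CHAR_eqI)
  show "of_nat CHAR('a) = (0 :: 'a poly)" by (simp add: of_nat_poly)
  show "CHAR('a) dvd n" if "of_nat n = (0 :: 'a poly)" for n
    using that by (simp add: of_nat_poly of_nat_eq_0_iff_char_dvd)
qed

lemma degree_eq_0_if_dvd_1: "d dvd (1 :: 'a::field poly) \<Longrightarrow> Polynomial.degree d = 0"
  using dvd_imp_degree_le[of d 1] by simp

context derivation_field
begin

text \<open>The Frobenius twist: its value at \<open>x ^ p\<close> is
  \<open>poly G x ^ p\<close>.\<close>

definition frob_poly :: "'k poly \<Rightarrow> 'k poly" where "frob_poly = map_poly (\<lambda>x. x ^ p)"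

lemma p_pos: "0 < p" using p_gt_1 by simp

lemma coeff_frob_poly: "coeff (frob_poly G) i = coeff G i ^ p"
  by (simp add: frob_poly_def coeff_map_poly p_pos power_0_left)

lemma frob_sum: "(sum f I :: 'k) ^ p = (\<Sum>i\<in>I. f i ^ p)"
  by (induction I rule: infinite_finite_induct) (auto simp: frob_add power_0_left p_pos)

lemma frob_poly_mult: "frob_poly (G * H) = frob_poly G * frob_poly H"
  by (simp add: poly_eq_iff coeff_frob_poly coeff_mult frob_sum power_mult_distrib)

lemma degree_frob_poly: "Polynomial.degree (frob_poly G) = Polynomial.degree G"
  unfolding frob_poly_def by (rule degree_map_poly) (simp add: p_pos)

lemma frob_poly_eval: "poly (frob_poly G) (x ^ p) = poly G x ^ p"
  by (simp add: poly_altdef degree_frob_poly coeff_frob_poly frob_sum power_mult_distrib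
    power_mult[symmetric] mult.commute)

lemma pderiv_frob_poly: "pderiv (frob_poly G) = frob_poly (pderiv G)"
proof (rule poly_eqI)
  fix i
  show "coeff (pderiv (frob_poly G)) i = coeff (frob_poly (pderiv G)) i"
    using frob_of_nat[of "Suc i"] unfolding coeff_pderiv coeff_frob_poly by (simp only: power_mult_distrib)
qed

lemma frob_poly_dvd: "G dvd H \<Longrightarrow> frob_poly G dvd frob_poly H"
  by (auto simp: dvd_def frob_poly_mult)

lemma poly_coprime_unfrob:
  assumes "poly_coprime (frob_poly G) (pderiv (frob_poly G))" "G \<noteq> 0"
  shows "poly_coprime G (pderiv G)"
proof (rule poly_coprime_if_gcd_const)
  fix d assume "d dvd G" "d dvd pderiv G"
  hence "frob_poly d dvd frob_poly G" "frob_poly d dvd pderiv (frob_poly G)"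
    by (auto simp: pderiv_frob_poly frob_poly_dvd)
  moreover obtain s t where "s * frob_poly G + t * pderiv (frob_poly G) = 1"
    using assms(1) by (auto simp: poly_coprime_def)
  ultimately have "frob_poly d dvd 1" by (metis dvd_add dvd_mult)
  hence "Polynomial.degree (frob_poly d) = 0" by (rule degree_eq_0_if_dvd_1)
  thus "Polynomial.degree d = 0" by (simp add: degree_frob_poly)
qed (rule assms)

lemma poly_eq_frob_polyI:
  assumes "\<And>i. D (coeff F i) = 0"
  obtains G where "F = frob_poly G"
proof -
  have "\<forall>i. \<exists>a. coeff F i = a ^ p" using assms D_eq_0_iff by blast
  then obtain b where b: "\<And>i. coeff F i = b i ^ p" by metis
  define G where "G = (\<Sum>i\<le>Polynomial.degree F. monom (b i) i)"
  have "coeff (frob_poly G) i = coeff F i" for i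
    using b[of i] coeff_eq_0[of F i] p_pos by (auto simp: coeff_frob_poly G_def coeff_sum power_0_left)
  thus ?thesis using that by (metis poly_eqI)
qed

text \<open>A common divisor of \<open>F\<close> and \<open>F'\<close> of least positive degree
  behaves like an irreducible factor. Squarefreeness gives \<open>G' = 0\<close> and prevents
  \<open>G\<close> from being a \<open>p\<close>-th power, so \<open>D\<close> cannot kill all its
  coefficients.\<close>

lemma not_coprime_bounded_by_support:
  assumes F0: "F \<noteq> 0" and sq: "squarefree F" and nc: "\<not> poly_coprime F (pderiv F)"
  shows "bounded_by_support F"
proof -
  define Pr where "Pr d \<longleftrightarrow> d dvd F \<and> d dvd pderiv F \<and> 0 < Polynomial.degree d" for d
  have "\<exists>d. Pr d"
  proof (rule ccontr)
    assume "\<not> ?thesis"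
    hence "Polynomial.degree d = 0" if "d dvd F" "d dvd pderiv F" for d using that by (simp add: Pr_def)
    thus False using poly_coprime_if_gcd_const F0 nc by blast
  qed
  then obtain G0 where G0: "Pr G0" "\<And>d. Pr d \<Longrightarrow> Polynomial.degree G0 \<le> Polynomial.degree d"
    using ex_has_least_nat[of Pr _ Polynomial.degree] by blast
  \<comment> \<open>Monic, so that applying \<open>D\<close> to the coefficients lowers the
    degree.\<close>
  define G where "G = smult (inverse (Polynomial.lead_coeff G0)) G0"
  have G00: "G0 \<noteq> 0" using G0 by (auto simp: Pr_def)
  have G: "G dvd F" "G dvd pderiv F" "0 < Polynomial.degree G" "Polynomial.lead_coeff G = 1" "G \<noteq> 0"
    using G0(1) G00 by (auto simp: G_def Pr_def smult_dvd_iff)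
  have min: "Polynomial.degree e = 0" if "e dvd G" "Polynomial.degree e < Polynomial.degree G" for e
  proof (rule ccontr)
    assume "Polynomial.degree e \<noteq> 0"
    hence "Pr e" using that(1) G(1,2) dvd_trans unfolding Pr_def by blast
    hence "Polynomial.degree G0 \<le> Polynomial.degree e" by (rule G0(2))
    thus False using that(2) G00 by (simp add: G_def)
  qed
  have cop: "poly_coprime G A" if "A \<noteq> 0" "Polynomial.degree A < Polynomial.degree G" for A
  proof (rule poly_coprime_if_gcd_const[OF _ G(5)])
    fix d assume "d dvd G" "d dvd A"
    thus "Polynomial.degree d = 0" using min[of d] dvd_imp_degree_le[OF _ that(1), of d] that(2) by linarith
  qed
  have not_sq: "\<not> A ^ 2 dvd F" if "0 < Polynomial.degree A" for A
  proof
    assume "A ^ 2 dvd F"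
    hence "A dvd 1" using sq by (simp add: squarefree_def)
    hence "Polynomial.degree A = 0" by (rule degree_eq_0_if_dvd_1)
    thus False using that by simp
  qed
  obtain H where H: "F = G * H" using G(1) by blast
  \<comment> \<open>Otherwise \<open>G\<close> is coprime to \<open>G'\<close>, and
    \<open>G dvd G' * H\<close> yields \<open>G dvd H\<close>, a square factor of
    \<open>F\<close>.\<close>
  have G': "pderiv G = 0"
  proof (rule ccontr)
    assume *: "pderiv G \<noteq> 0"
    have "Polynomial.degree (pderiv G) \<le> Polynomial.degree G - 1"
      by (rule degree_le) (auto simp: coeff_pderiv coeff_eq_0)
    hence "Polynomial.degree (pderiv G) < Polynomial.degree G" using G(3) by linarith
    then obtain s t where st: "s * G + t * pderiv G = 1" using cop[OF *] by (auto simp: poly_coprime_def)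
    have "G dvd pderiv G * H"
      using G(2) unfolding H pderiv_mult by (metis dvd_add_right_iff dvd_triv_left mult.commute)
    moreover have "H = G * (s * H) + t * (pderiv G * H)"
      using st by (metis (no_types, lifting) distrib_right mult.assoc mult.commute mult_1)
    ultimately have "G dvd H" by (metis dvd_add dvd_mult dvd_triv_left)
    hence "G ^ 2 dvd F" unfolding H power2_eq_square by (rule mult_dvd_mono[OF dvd_refl])
    thus False using not_sq G(3) by blast
  qed
  \<comment> \<open>If \<open>D\<close> kills all coefficients they are \<open>p\<close>-th powers,
    and \<open>G' = 0\<close> leaves only exponents divisible by \<open>p\<close>; then
    \<open>G = R ^ p\<close>, against squarefreeness.\<close>
  have "map_poly D G \<noteq> 0"
  proof
    assume "map_poly D G = 0"
    hence "D (coeff G i) = 0" for i using coeff_map_poly_D[of G i] by simp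
    then obtain B where B: "G = frob_poly B" using poly_eq_frob_polyI by blast
    have zero: "coeff B i = 0" if "\<not> p dvd i" for i
    proof (cases i)
      case (Suc j)
      have "of_nat (Suc j) * coeff G (Suc j) = 0" using G' coeff_pderiv[of G j] by simp
      hence "coeff G i = 0" using that of_nat_p_eq_0[of i] Suc by auto
      thus ?thesis by (simp add: B coeff_frob_poly)
    qed (use that in simp)
    define n where "n = Polynomial.degree G"
    define R where "R = (\<Sum>j\<le>n. monom (coeff B (p * j)) j)"
    have "R ^ p = (\<Sum>j\<le>n. monom (coeff B (p * j)) j ^ p)"
      unfolding R_def by (rule freshmans_dream_sum) (simp_all only: CHAR_poly_eq char_p prime_p)
    also have "\<dots> = (\<Sum>j\<le>n. monom (coeff B (p * j) ^ p) (p * j))"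
      by (simp add: monom_power mult.commute)
    also have "\<dots> = G"
    proof (rule poly_eqI)
      fix i
      have "coeff (\<Sum>j\<le>n. monom (coeff B (p * j) ^ p) (p * j)) i = (\<Sum>j\<le>n. if p * j = i then coeff G i else 0)"
        unfolding coeff_sum by (intro sum.cong) (auto simp: B coeff_frob_poly)
      also have "\<dots> = coeff G i"
      proof (cases "p dvd i")
        case True
        then obtain j where j: "i = p * j" by blast
        have "(\<Sum>j'\<le>n. if p * j' = i then coeff G i else 0) = (\<Sum>j'\<le>n. if j' = j then coeff G i else 0)"
          using p_pos by (intro sum.cong) (auto simp: j)
        also have "\<dots> = coeff G i"
        proof (cases "j \<le> n")
          case False
          have "1 * j \<le> p * j" using p_pos by (intro mult_le_mono1) simp
          hence "n < p * j" using False by linarith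
          hence "coeff G i = 0" unfolding j n_def by (rule coeff_eq_0)
          thus ?thesis by simp
        qed simp
        finally show ?thesis .
      next
        case False
        hence "coeff G i = 0" using zero p_pos by (simp add: B coeff_frob_poly power_0_left)
        thus ?thesis by (auto intro!: sum.neutral)
      qed
      finally show "coeff (\<Sum>j\<le>n. monom (coeff B (p * j) ^ p) (p * j)) i = coeff G i" .
    qed
    finally have Rp: "R ^ p = G" .
    have "R ^ 2 dvd R ^ p" using p_gt_1 by (intro le_imp_power_dvd) simp
    hence "R ^ 2 dvd F" using Rp G(1) dvd_trans by blast
    hence "Polynomial.degree R = 0" using not_sq by blast
    hence "Polynomial.degree G = 0" using Rp by (metis degree_power_le le_zero_eq mult_zero_left)
    thus False using G(3) by simp
  qed
  moreover have "Polynomial.degree (map_poly D G) < Polynomial.degree G"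
  proof (rule ccontr)
    assume "\<not> ?thesis"
    hence eq: "Polynomial.degree (map_poly D G) = Polynomial.degree G" using degree_map_poly_D[of G] by linarith
    have "Polynomial.lead_coeff (map_poly D G) = 0"
      unfolding eq coeff_map_poly_D G(4) by (rule D_1)
    thus False using calculation by simp
  qed
  ultimately have "poly_coprime G (map_poly D G)" by (rule cop)
  thus ?thesis using inseparable_factor_bound[OF H G(5,3) G'] by blast
qed

lemma map_poly_D_pcompose:
  "map_poly D (pcompose F r) = pcompose (map_poly D F) r + pcompose (pderiv F) r * map_poly D r"
proof (induction F)
  case (pCons a F)
  have "map_poly D [:a:] = [:D a:]" by (simp add: map_poly_D_pCons)
  thus ?case
    by (simp add: pcompose_pCons map_poly_D_add map_poly_D_mult map_poly_D_pCons pderiv_pCons pCons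
      pcompose_add algebra_simps)
qed (simp add: poly_eq_iff coeff_map_poly_D D_0)

text \<open>\<open>B\<close> inverts \<open>F'\<close> modulo \<open>F\<close>. At a root
  \<open>a\<close> of \<open>F\<close> the remainder \<open>P\<close> takes the value
  \<open>- (D F)(a) / F'(a)\<close>, which is what differentiating \<open>F(a) = 0\<close> gives for
  \<open>D a\<close>.\<close>

lemma interpolating_poly_exists:
  assumes AB: "A * F + B * pderiv F = 1" and F: "0 < Polynomial.degree F"
  obtains P Q where "Polynomial.degree P < Polynomial.degree F" "map_poly D F + pderiv F * P = F * Q"
proof -
  define E where "E = map_poly D F"
  define S where "S = (- (E * B)) div F"
  define P where "P = (- (E * B)) mod F"
  have "- (E * B) = S * F + P" unfolding S_def P_def by (rule div_mult_mod_eq[symmetric])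
  hence P: "P = - (E * B) - S * F" by (simp add: algebra_simps)
  have "E + pderiv F * P = E * (A * F + B * pderiv F) - E * (B * pderiv F) - pderiv F * (S * F)"
    unfolding AB P by (simp add: algebra_simps)
  also have "\<dots> = F * (E * A - pderiv F * S)" by (simp add: algebra_simps)
  finally have 1: "map_poly D F + pderiv F * P = F * (E * A - pderiv F * S)" by (simp add: E_def)
  have 2: "Polynomial.degree P < Polynomial.degree F"
    unfolding P_def using F degree_mod_less[of F "- (E * B)"] by fastforce
  show ?thesis by (rule that[OF 2 1])
qed

text \<open>
  If the solutions of \<open>D f = P f\<close> with \<open>P\<close> linear are not unique, they are \<open>f0 + \<gamma> g ^ p\<close>, and in the coordinate
  given by \<open>f0\<close> and \<open>\<gamma>\<close> all roots of \<open>F\<close> have derivative zero.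
\<close>

lemma linear_case_reduction:
  assumes F: "0 < Polynomial.degree F" "poly_coprime F (pderiv F)"
    and P: "Polynomial.degree P \<le> 1" "map_poly D F + pderiv F * P = F * Q"
    and f: "D f0 = poly P f0" "D f1 = poly P f1" "f0 \<noteq> f1"
  obtains c G where "c \<noteq> 0" "pcompose F [:f0, f1 - f0:] = smult c (frob_poly G)"
    "Polynomial.degree G = Polynomial.degree F" "poly_coprime G (pderiv G)"
    "\<And>f. D f = poly P f \<Longrightarrow> \<exists>g. f = f0 + (f1 - f0) * g ^ p"
proof -
  define \<gamma> where "\<gamma> = f1 - f0"
  have \<gamma>: "\<gamma> \<noteq> 0" using f by (simp add: \<gamma>_def)
  define \<alpha> where "\<alpha> = coeff P 1"
  have Px: "poly P x = coeff P 0 + \<alpha> * x" for x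
    using poly_eq_sum_atMost[OF P(1)] by (simp add: \<alpha>_def)
  \<comment> \<open>As \<open>P\<close> is linear, differences of solutions satisfy a homogeneous
    equation, and the quotient of two such differences has derivative zero.\<close>
  have diff: "D (f - f0) = \<alpha> * (f - f0)" if "D f = poly P f" for f
    using that f(1) by (simp add: D_diff Px algebra_simps)
  have D\<gamma>: "D \<gamma> = \<alpha> * \<gamma>" unfolding \<gamma>_def by (rule diff[OF f(2)])
  have sol: "\<exists>g. f = f0 + \<gamma> * g ^ p" if "D f = poly P f" for f
  proof -
    define w where "w = (f - f0) / \<gamma>"
    have w: "f - f0 = \<gamma> * w" using \<gamma> by (simp add: w_def)
    have "D \<gamma> * w + \<gamma> * D w = \<alpha> * (\<gamma> * w)" using diff[OF that] unfolding w D_mult .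
    hence "\<gamma> * D w = 0" by (simp add: D\<gamma>)
    hence "D w = 0" using \<gamma> by simp
    then obtain g where "w = g ^ p" using D_eq_0_iff by blast
    thus ?thesis using w by (metis add.commute diff_add_cancel)
  qed
  define r where "r = [:f0, \<gamma>:]"
  define F1 where "F1 = pcompose F r"
  have degr: "Polynomial.degree r = 1" using \<gamma> by (simp add: r_def)
  have deg1: "Polynomial.degree F1 = Polynomial.degree F" by (simp add: F1_def degree_pcompose degr)
  have F10: "F1 \<noteq> 0" using deg1 F(1) by auto
  \<comment> \<open>\<open>f0\<close> solves the equation and \<gamma> its homogeneous part. Hence
    the term with \<open>F'\<close> is absorbed in the new coordinate, and \<open>D\<close> sends
    \<open>F1\<close> to a multiple of itself.\<close>
  have Dr: "map_poly D r = pcompose P r"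
  proof -
    have "P = [:coeff P 0, \<alpha>:]"
      using P(1) by (auto simp: poly_eq_iff \<alpha>_def coeff_pCons coeff_eq_0 split: nat.split)
    hence "pcompose P r = pcompose [:coeff P 0, \<alpha>:] r" by simp
    also have "\<dots> = [:D f0, D \<gamma>:]" unfolding f(1) D\<gamma> Px by (simp add: pcompose_pCons r_def)
    finally show ?thesis by (simp add: r_def map_poly_D_pCons)
  qed
  have DF1: "map_poly D F1 = F1 * pcompose Q r"
    unfolding F1_def map_poly_D_pcompose Dr pcompose_mult[symmetric] pcompose_add[symmetric] P(2) ..
  define c where "c = Polynomial.lead_coeff F1"
  have c: "c \<noteq> 0" using F10 by (simp add: c_def)
  \<comment> \<open>Once the leading coefficient is 1, applying \<open>D\<close> lowers the degree,
    so the multiple of \<open>F2\<close> must be zero.\<close>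
  define F2 where "F2 = smult (inverse c) F1"
  have F12: "F1 = smult c F2" using c by (simp add: F2_def)
  have F2: "Polynomial.degree F2 = Polynomial.degree F" "Polynomial.lead_coeff F2 = 1"
    using c deg1 by (auto simp: F2_def c_def)
  have "map_poly D F1 = [:D c:] * F2 + [:c:] * map_poly D F2"
  proof -
    have "F1 = [:c:] * F2" by (simp add: F12)
    hence "map_poly D F1 = map_poly D [:c:] * F2 + [:c:] * map_poly D F2" by (simp only: map_poly_D_mult)
    thus ?thesis by (simp add: map_poly_D_pCons)
  qed
  hence "smult c (map_poly D F2) = F2 * (smult c (pcompose Q r) - [:D c:])"
    unfolding DF1 by (simp add: F12 algebra_simps)
  hence "F2 dvd smult c (map_poly D F2)" by (metis dvd_triv_left)
  hence dvd: "F2 dvd map_poly D F2" using c by (rule dvd_smult_cancel)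
  have "map_poly D F2 = 0"
  proof (rule ccontr)
    assume nz: "map_poly D F2 \<noteq> 0"
    hence "Polynomial.degree (map_poly D F2) = Polynomial.degree F2"
      using dvd_imp_degree_le[OF dvd] degree_map_poly_D[of F2] by linarith
    hence "Polynomial.lead_coeff (map_poly D F2) = D 1" using F2(2) by (simp add: coeff_map_poly_D)
    thus False using nz D_1 by simp
  qed
  hence "D (coeff F2 i) = 0" for i using coeff_map_poly_D[of F2 i] by simp
  then obtain G where G: "F2 = frob_poly G" using poly_eq_frob_polyI by blast
  have degG: "Polynomial.degree G = Polynomial.degree F" using F2(1) by (simp add: G degree_frob_poly)
  have G0: "G \<noteq> 0" using degG F(1) by auto
  have "poly_coprime F2 (pderiv F2)"
  proof -
    obtain s t where st: "s * F + t * pderiv F = 1" using F(2) by (auto simp: poly_coprime_def)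
    have "pcompose s r * F1 + pcompose t r * pcompose (pderiv F) r = pcompose (s * F + t * pderiv F) r"
      by (simp add: F1_def pcompose_add pcompose_mult)
    hence one: "pcompose s r * F1 + pcompose t r * pcompose (pderiv F) r = 1" by (simp only: st pcompose_1)
    have "pderiv F1 = pcompose (pderiv F) r * [:\<gamma>:]"
      unfolding F1_def pderiv_pcompose by (simp add: r_def pderiv_pCons)
    hence "smult c (pderiv F2) = smult \<gamma> (pcompose (pderiv F) r)"
      by (simp add: F12 pderiv_smult)
    hence "pcompose (pderiv F) r = smult (c / \<gamma>) (pderiv F2)"
      using \<gamma> by (metis divide_inverse_commute left_inverse smult_1_left smult_smult)
    hence "smult c (pcompose s r) * F2 + smult (c / \<gamma>) (pcompose t r) * pderiv F2 = 1"
      using one by (simp add: F12)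
    thus ?thesis unfolding poly_coprime_def by blast
  qed
  hence copG: "poly_coprime G (pderiv G)" using G G0 poly_coprime_unfrob by simp
  show ?thesis
    using that[of c G] c F12 G degG copG sol unfolding F1_def r_def \<gamma>_def by blast
qed

text \<open>Elements beating the bound of \<open>separable_bound\<close> must solve
  \<open>D f = P f\<close> with \<open>P\<close> of degree at most 1; two of them give the
  substitution. A bound for \<open>G\<close> would carry over to \<open>F\<close> through
  \<open>F f = c * G g ^ p\<close>.\<close>

lemma unbounded_descent:
  assumes F: "2 \<le> Polynomial.degree F" "poly_coprime F (pderiv F)" "\<not> bounded_by_support F"
  obtains f0 \<gamma> c G where "\<gamma> \<noteq> 0" "c \<noteq> 0" "pcompose F [:f0, \<gamma>:] = smult c (frob_poly G)"
    "Polynomial.degree G = Polynomial.degree F" "poly_coprime G (pderiv G)" "\<not> bounded_by_support G"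
proof -
  obtain A B where AB: "A * F + B * pderiv F = 1" using F(2) by (auto simp: poly_coprime_def)
  have deg0: "0 < Polynomial.degree F" using F(1) by simp
  obtain P Q where PQ: "Polynomial.degree P < Polynomial.degree F" "map_poly D F + pderiv F * P = F * Q"
    using interpolating_poly_exists[OF AB deg0] by blast
  obtain C where C: "\<And>f. poly F f \<noteq> 0 \<Longrightarrow> D f \<noteq> poly P f \<or> 2 \<le> Polynomial.degree P \<Longrightarrow>
    height k f \<le> degsupp (poly F f) + C"
    using separable_bound[OF refl F(1) AB PQ] by blast
  have large: "\<exists>f. poly F f \<noteq> 0 \<and> degsupp (poly F f) + C' < height k f" for C'
    using bounded_by_support_additive[of F C'] F(3) by (meson not_le)
  obtain f0 where f0: "poly F f0 \<noteq> 0" "degsupp (poly F f0) + C < height k f0" using large by blast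
  \<comment> \<open>A height above that of \<open>f0\<close> ensures
    \<open>f1 \<noteq> f0\<close>.\<close>
  obtain f1 where f1: "poly F f1 \<noteq> 0" "degsupp (poly F f1) + (C + height k f0) < height k f1" using large by blast
  have "\<not> (D f0 \<noteq> poly P f0 \<or> 2 \<le> Polynomial.degree P)" using C[OF f0(1)] f0(2) by linarith
  moreover have "\<not> (D f1 \<noteq> poly P f1 \<or> 2 \<le> Polynomial.degree P)" using C[OF f1(1)] f1(2) by linarith
  ultimately have sol: "D f0 = poly P f0" "D f1 = poly P f1" and degP: "Polynomial.degree P \<le> 1" by auto
  have ne: "f0 \<noteq> f1" using f1(2) by auto
  obtain c G where G: "c \<noteq> 0" "pcompose F [:f0, f1 - f0:] = smult c (frob_poly G)"
    "Polynomial.degree G = Polynomial.degree F" "poly_coprime G (pderiv G)"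
    "\<And>f. D f = poly P f \<Longrightarrow> \<exists>g. f = f0 + (f1 - f0) * g ^ p"
  proof (rule linear_case_reduction[OF deg0 F(2) degP PQ(2) sol ne], goal_cases)
    case (1 c G)
    show ?case by (rule 1(1)[OF 1(2-)])
  qed
  define \<gamma> where "\<gamma> = f1 - f0"
  have "bounded_by_support F" if bG: "bounded_by_support G"
  proof -
    obtain C2 where C2: "\<And>g. poly G g \<noteq> 0 \<Longrightarrow> height k g \<le> C2 * (1 + degsupp (poly G g))"
      using bG unfolding bounded_by_support_def by blast
    define T where "T = [:f0:] + monom \<gamma> p"
    have degT: "Polynomial.degree T \<le> p" unfolding T_def
      by (intro degree_add_le degree_monom_le) simp
    obtain C1 where C1: "\<And>g. height k (poly T g) \<le> Polynomial.degree T * height k g + C1"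
      using height_poly_le[of T] by blast
    define M where "M = C + 1 + (p * C2 * (1 + degsupp c) + C1)"
    have "height k f \<le> M * (1 + degsupp (poly F f))" if Ff: "poly F f \<noteq> 0" for f
    proof (cases "D f = poly P f")
      case False
      hence "height k f \<le> degsupp (poly F f) + C" using C Ff by blast
      also have "\<dots> \<le> (C + 1) * (1 + degsupp (poly F f))" by simp
      also have "\<dots> \<le> M * (1 + degsupp (poly F f))" by (intro mult_le_mono1) (simp add: M_def)
      finally show ?thesis .
    next
      case True
      then obtain g where g: "f = f0 + \<gamma> * g ^ p" using G(5) by (auto simp: \<gamma>_def)
      have "poly F f = poly (pcompose F [:f0, \<gamma>:]) (g ^ p)" by (simp add: poly_pcompose g mult.commute)
      hence Fg: "poly F f = c * poly G g ^ p" by (simp add: G(2) \<gamma>_def frob_poly_eval)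
      have Gg: "poly G g \<noteq> 0" using Ff Fg p_pos by auto
      \<comment> \<open>Taking \<open>p\<close>-th powers does not change the support, so only the
        support of the fixed factor \<open>c\<close> intervenes.\<close>
      have "degsupp (poly G g) \<le> degsupp (poly F f) + degsupp c"
      proof (rule degsupp_mono_sum)
        fix v assume v: "v \<in> PD" "v (poly G g) \<noteq> 0"
        hence pv: "prime_divisor k v" by simp
        have "v (poly F f) = v c + int p * v (poly G g)"
          using Gg G(1) by (simp add: Fg v_mult[OF pv] v_power[OF pv])
        moreover have "int p * v (poly G g) \<noteq> 0" using v(2) p_pos by simp
        ultimately show "v (poly F f) \<noteq> 0 \<or> v c \<noteq> 0" by linarith
      qed
      hence s: "1 + degsupp (poly G g) \<le> (1 + degsupp c) * (1 + degsupp (poly F f))" by simp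
      have "f = poly T g" by (simp add: T_def poly_monom g)
      hence "height k f \<le> Polynomial.degree T * height k g + C1" using C1 by simp
      also have "\<dots> \<le> p * (C2 * ((1 + degsupp c) * (1 + degsupp (poly F f)))) + C1"
      proof (intro add_mono mult_le_mono degT order_refl)
        show "height k g \<le> C2 * ((1 + degsupp c) * (1 + degsupp (poly F f)))"
          using C2[OF Gg] mult_le_mono2[OF s, of C2] by linarith
      qed
      also have "\<dots> \<le> (p * C2 * (1 + degsupp c) + C1) * (1 + degsupp (poly F f))"
      proof -
        have "C1 \<le> C1 * (1 + degsupp (poly F f))" by simp
        moreover have "(p * C2 * (1 + degsupp c) + C1) * (1 + degsupp (poly F f))
            = p * (C2 * ((1 + degsupp c) * (1 + degsupp (poly F f)))) + C1 * (1 + degsupp (poly F f))"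
          by (simp only: distrib_right[of _ C1] mult.assoc)
        ultimately show ?thesis by linarith
      qed
      also have "\<dots> \<le> M * (1 + degsupp (poly F f))" by (intro mult_le_mono1) (simp add: M_def)
      finally show ?thesis .
    qed
    thus ?thesis unfolding bounded_by_support_def by blast
  qed
  hence "\<not> bounded_by_support G" using F(3) by blast
  thus ?thesis using that[of "f1 - f0" c f0 G] G(1-4) ne by auto
qed

end

section \<open>Roots in the algebraic closure\<close>

abbreviation tac :: "'a::field poly \<Rightarrow> 'a alg_closure poly" where "tac \<equiv> map_poly to_ac"

lemma coeff_tac: "coeff (tac F) i = to_ac (coeff F i)"
  by (simp add: coeff_map_poly)

lemma tac_add: "tac (F + G) = tac F + tac G"
  by (simp add: poly_eq_iff coeff_tac)

lemma tac_mult: "tac (F * G) = tac F * tac G"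
  by (simp add: poly_eq_iff coeff_tac coeff_mult to_ac_sum)

lemma tac_smult: "tac (smult c F) = smult (to_ac c) (tac F)"
  by (simp add: poly_eq_iff coeff_tac)

lemma tac_pderiv: "tac (pderiv F) = pderiv (tac F)"
  by (simp add: poly_eq_iff coeff_tac coeff_pderiv)

lemma tac_pCons: "tac (pCons a F) = pCons (to_ac a) (tac F)"
  by (simp add: map_poly_pCons)

lemma degree_tac: "Polynomial.degree (tac F) = Polynomial.degree F"
  by (rule degree_map_poly) simp

lemma tac_eq_0_iff: "tac F = 0 \<longleftrightarrow> F = 0"
  by (simp add: poly_eq_iff coeff_tac)

lemma poly_tac_sum: "Polynomial.degree F \<le> n \<Longrightarrow> poly (tac F) x = (\<Sum>i\<le>n. to_ac (coeff F i) * x ^ i)"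
  using poly_eq_sum_atMost[of "tac F" n x] by (simp add: degree_tac coeff_tac)

lemma tac_pcompose_linear: "poly (tac (pcompose F [:a, b:])) x = poly (tac F) (to_ac a + to_ac b * x)"
  by (induction F) (simp_all add: pcompose_pCons tac_add tac_mult tac_smult tac_pCons algebra_simps)

text \<open>A multiple root would be a common root of \<open>F\<close> and \<open>F'\<close>,
  against the Bezout identity.\<close>

lemma separable_if_coprime:
  assumes "F \<noteq> 0" "poly_coprime F (pderiv F)"
  shows "separable_poly F"
  unfolding separable_poly_def rsquarefree_def
proof (intro conjI allI)
  show "tac F \<noteq> 0" using assms(1) by (simp add: tac_eq_0_iff)
  fix a
  show "Polynomial.order a (tac F) = 0 \<or> Polynomial.order a (tac F) = 1"
  proof (rule ccontr)
    assume "\<not> ?thesis"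
    hence "[:- a, 1:] ^ 2 dvd [:- a, 1:] ^ Polynomial.order a (tac F)"
      by (intro le_imp_power_dvd) linarith
    hence "[:- a, 1:] ^ 2 dvd tac F" using order_1 dvd_trans by blast
    then obtain S where "tac F = [:- a, 1:] ^ 2 * S" unfolding dvd_def by blast
    hence S: "tac F = [:- a, 1:] * ([:- a, 1:] * S)" by (simp only: power2_eq_square mult.assoc)
    have double: "poly (M * (M * S)) a = 0" "poly (pderiv (M * (M * S))) a = 0" if "poly M a = 0" for M
      by (simp_all add: pderiv_mult that)
    have "poly (tac F) a = 0" "poly (tac (pderiv F)) a = 0"
      unfolding tac_pderiv S by (rule double; simp)+
    moreover obtain s t where st: "s * F + t * pderiv F = 1" using assms(2) by (auto simp: poly_coprime_def)
    have "poly (tac s) a * poly (tac F) a + poly (tac t) a * poly (tac (pderiv F)) a = poly (tac 1) a"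
      unfolding st[symmetric] by (simp add: tac_add tac_mult)
    moreover have "tac 1 = (1 :: 'a alg_closure poly)"
      by (simp add: poly_eq_iff coeff_tac coeff_1)
    ultimately show False by simp
  qed
qed

text \<open>The ring generated by three roots is spanned by at most \<open>n ^ 3\<close> monomials.\<close>

lemma ratio_of_roots_relation:
  fixes G :: "'k::field poly" and b1 b2 b3 :: "'k alg_closure"
  assumes n: "n = Polynomial.degree G" "0 < n"
    and roots: "poly (tac G) b1 = 0" "poly (tac G) b2 = 0" "poly (tac G) b3 = 0" and ne: "b1 \<noteq> b3"
  shows "\<exists>R. R \<noteq> 0 \<and> Polynomial.degree R \<le> n ^ 3 \<and> poly (tac R) ((b1 - b2) / (b1 - b3)) = 0"
proof -
  interpret vs: vector_space "\<lambda>(c :: 'k) (x :: 'k alg_closure). to_ac c * x"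
    by unfold_locales (auto simp: algebra_simps)
  define mon where "mon i j l = b1 ^ i * b2 ^ j * b3 ^ l" for i j l :: nat
  define S where "S = (\<lambda>(i, j, l). mon i j l) ` ({..<n} \<times> {..<n} \<times> {..<n})"
  have S: "finite S" "card S \<le> n ^ 3"
  proof -
    have "card S \<le> card ({..<n} \<times> {..<n} \<times> {..<n})" unfolding S_def by (rule card_image_le) simp
    thus "card S \<le> n ^ 3" by (simp add: card_cartesian_product power3_eq_cube)
  qed (simp add: S_def)
  have monS: "mon i j l \<in> vs.span S" if "i < n" "j < n" "l < n" for i j l
    using that by (intro vs.span_base) (force simp: S_def)
  have red: "\<exists>r. b ^ n = (\<Sum>a<n. to_ac (r a) * b ^ a)" if b: "poly (tac G) b = 0" for b
  proof -
    define l where "l = Polynomial.lead_coeff G"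
    have l: "l \<noteq> 0" using n by (auto simp: l_def)
    have "(\<Sum>i\<le>n. to_ac (coeff G i) * b ^ i) = 0" using b poly_tac_sum[of G n b] n by simp
    also have "{..n} = insert n {..<n}" by auto
    finally have "to_ac l * b ^ n = - (\<Sum>i<n. to_ac (coeff G i) * b ^ i)"
      by (simp add: l_def n eq_neg_iff_add_eq_0)
    hence "b ^ n = (\<Sum>i<n. to_ac (- coeff G i / l) * b ^ i)"
      using l by (simp add: field_simps sum_divide_distrib[symmetric] sum_negf sum_distrib_left)
    thus ?thesis by (intro exI[of _ "\<lambda>i. - coeff G i / l"])
  qed
  \<comment> \<open>The assumption \<open>gen\<close> isolates the power of \<open>b\<close> in a
    monomial, so that one argument serves all three roots; only \<open>b ^ n\<close> has to be
    rewritten.\<close>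
  have mult: "b * x \<in> vs.span S"
    if b: "poly (tac G) b = 0" and x: "x \<in> vs.span S"
      and gen: "\<And>i j l. i < n \<Longrightarrow> j < n \<Longrightarrow> l < n \<Longrightarrow> \<exists>e M. e < n \<and> mon i j l = b ^ e * M \<and> (\<forall>e'<n. b ^ e' * M \<in> vs.span S)"
    for b x
    using x
  proof (rule vs.span_induct)
    show "vs.subspace {x. b * x \<in> vs.span S}"
    proof (rule vs.subspaceI)
      show "0 \<in> {x. b * x \<in> vs.span S}" by (simp add: vs.span_zero)
      show "x + y \<in> {x. b * x \<in> vs.span S}" if "x \<in> {x. b * x \<in> vs.span S}" "y \<in> {x. b * x \<in> vs.span S}" for x y
        using that vs.span_add by (simp add: distrib_left)
      show "to_ac c * x \<in> {x. b * x \<in> vs.span S}" if "x \<in> {x. b * x \<in> vs.span S}" for c x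
        using that vs.span_scale[of "b * x" S c] by (simp add: mult.left_commute)
    qed
    fix x assume "x \<in> S"
    then obtain i j l where ijl: "i < n" "j < n" "l < n" "x = mon i j l" by (auto simp: S_def)
    then obtain e M where e: "e < n" "x = b ^ e * M" "\<And>e'. e' < n \<Longrightarrow> b ^ e' * M \<in> vs.span S"
      using gen by metis
    show "b * x \<in> vs.span S"
    proof (cases "Suc e < n")
      case True
      thus ?thesis using e(3)[OF True] e(2) by (simp add: mult.assoc)
    next
      case False
      hence "b * x = b ^ n * M" using e by (metis less_antisym mult.assoc not_less_eq power_Suc)
      also obtain r where "b ^ n = (\<Sum>a<n. to_ac (r a) * b ^ a)" using red[OF b] by blast
      hence "b ^ n * M = (\<Sum>a<n. to_ac (r a) * (b ^ a * M))" by (simp add: sum_distrib_right mult.assoc)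
      also have "\<dots> \<in> vs.span S" by (intro vs.span_sum vs.span_scale e(3)) auto
      finally show ?thesis .
    qed
  qed
  have m1: "b1 * x \<in> vs.span S" if "x \<in> vs.span S" for x
  proof (rule mult[OF roots(1) that])
    fix i j l assume *: "i < n" "j < n" "l < n"
    show "\<exists>e M. e < n \<and> mon i j l = b1 ^ e * M \<and> (\<forall>e'<n. b1 ^ e' * M \<in> vs.span S)"
      using * monS by (intro exI[of _ i] exI[of _ "b2 ^ j * b3 ^ l"]) (auto simp: mon_def mult_ac)
  qed
  have m2: "b2 * x \<in> vs.span S" if "x \<in> vs.span S" for x
  proof (rule mult[OF roots(2) that])
    fix i j l assume *: "i < n" "j < n" "l < n"
    show "\<exists>e M. e < n \<and> mon i j l = b2 ^ e * M \<and> (\<forall>e'<n. b2 ^ e' * M \<in> vs.span S)"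
      using * monS by (intro exI[of _ j] exI[of _ "b1 ^ i * b3 ^ l"]) (auto simp: mon_def mult_ac)
  qed
  have m3: "b3 * x \<in> vs.span S" if "x \<in> vs.span S" for x
  proof (rule mult[OF roots(3) that])
    fix i j l assume *: "i < n" "j < n" "l < n"
    show "\<exists>e M. e < n \<and> mon i j l = b3 ^ e * M \<and> (\<forall>e'<n. b3 ^ e' * M \<in> vs.span S)"
      using * monS by (intro exI[of _ l] exI[of _ "b1 ^ i * b2 ^ j"]) (auto simp: mon_def mult_ac)
  qed
  define u where "u = b1 - b2"
  define w where "w = b1 - b3"
  have w0: "w \<noteq> 0" using ne by (simp add: w_def)
  have mu: "u ^ i * x \<in> vs.span S" if "x \<in> vs.span S" for x i
  proof (induction i)
    case (Suc i)
    have "u ^ Suc i * x = b1 * (u ^ i * x) - b2 * (u ^ i * x)" by (simp add: u_def algebra_simps)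
    thus ?case using vs.span_diff[OF m1[OF Suc] m2[OF Suc]] by simp
  qed (use that in simp)
  have mw: "w ^ i * x \<in> vs.span S" if "x \<in> vs.span S" for x i
  proof (induction i)
    case (Suc i)
    have "w ^ Suc i * x = b1 * (w ^ i * x) - b3 * (w ^ i * x)" by (simp add: w_def algebra_simps)
    thus ?case using vs.span_diff[OF m1[OF Suc] m3[OF Suc]] by simp
  qed (use that in simp)
  define N where "N = n ^ 3"
  \<comment> \<open>Powers of \<open>u / w\<close> homogenized to degree \<open>N\<close>: these
    \<open>N + 1\<close> elements lie in a span of at most \<open>N\<close> generators, and dividing
    a dependence by \<open>w ^ N\<close> gives \<open>R\<close>.\<close>
  define e where "e i = u ^ i * w ^ (N - i)" for i
  have one: "1 \<in> vs.span S" using monS[of 0 0 0] n by (simp add: mon_def)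
  have eS: "e i \<in> vs.span S" for i
    unfolding e_def using mu[OF mw[OF one, of "N - i"], of i] by simp
  have "\<exists>r. (\<exists>i\<le>N. r i \<noteq> 0) \<and> (\<Sum>i\<le>N. to_ac (r i) * e i) = 0"
  \<comment> \<open>Linear dependence refers to sets, so a repeated value is treated as a relation
    of its own.\<close>
  proof (cases "inj_on e {..N}")
    case True
    have "vs.dependent (e ` {..N})"
    proof (rule ccontr)
      assume "\<not> vs.dependent (e ` {..N})"
      hence "card (e ` {..N}) \<le> card S"
        using vs.independent_span_bound[OF S(1), of "e ` {..N}"] eS by auto
      thus False using True S(2) by (simp add: card_image N_def)
    qed
    then obtain r where r: "\<exists>x\<in>e ` {..N}. r x \<noteq> 0" "(\<Sum>x\<in>e ` {..N}. to_ac (r x) * x) = 0"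
      using vs.dependent_finite[of "e ` {..N}"] by auto
    thus ?thesis using True by (intro exI[of _ "\<lambda>i. r (e i)"]) (auto simp: sum.reindex)
  next
    case False
    then obtain i j where ij: "i \<le> N" "j \<le> N" "i \<noteq> j" "e i = e j" by (auto simp: inj_on_def)
    define r where "r l = (if l = i then 1 else 0) - (if l = j then 1 else (0 :: 'k))" for l
    have "(\<Sum>l\<le>N. to_ac (r l) * e l) = (\<Sum>l\<le>N. (if l = i then e i else 0) - (if l = j then e j else 0))"
      by (intro sum.cong) (auto simp: r_def)
    also have "\<dots> = 0" using ij by (simp add: sum_subtractf)
    finally show ?thesis using ij by (intro exI[of _ r]) (auto simp: r_def intro!: exI[of _ i])
  qed
  then obtain r where r: "\<exists>i\<le>N. r i \<noteq> 0" "(\<Sum>i\<le>N. to_ac (r i) * e i) = 0" by blast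
  define R where "R = (\<Sum>i\<le>N. monom (r i) i)"
  have coeffR: "coeff R i = (if i \<le> N then r i else 0)" for i by (simp add: R_def coeff_sum)
  have degR: "Polynomial.degree R \<le> N" by (rule degree_le) (simp add: coeffR)
  have "R \<noteq> 0" using r(1) coeffR by (metis coeff_0)
  moreover have "poly (tac R) (u / w) = 0"
  proof -
    have "poly (tac R) (u / w) = (\<Sum>i\<le>N. to_ac (r i) * (u / w) ^ i)"
      unfolding poly_tac_sum[OF degR] by (intro sum.cong) (auto simp: coeffR)
    also have "\<dots> = (\<Sum>i\<le>N. to_ac (r i) * e i / w ^ N)"
    proof (intro sum.cong refl)
      fix i assume "i \<in> {..N}"
      hence "w ^ N = w ^ (N - i) * w ^ i" by (simp flip: power_add)
      thus "to_ac (r i) * (u / w) ^ i = to_ac (r i) * e i / w ^ N"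
        using w0 by (simp add: e_def field_simps)
    qed
    also have "\<dots> = 0" using r(2) by (simp flip: sum_divide_distrib)
    finally show ?thesis .
  qed
  ultimately show ?thesis using degR unfolding u_def w_def N_def by blast
qed

context derivation_field
begin

section \<open>The root ratio along the descent\<close>

lemma ac_prime_char: "prime CHAR('k alg_closure)" "p = CHAR('k alg_closure)"
  using prime_p char_p by (simp_all only: CHAR_alg_closure)

lemma ac_frob_add: "(x + y :: 'k alg_closure) ^ p = x ^ p + y ^ p"
  by (rule freshmans_dream[OF ac_prime_char])

lemma ac_frob_diff: "(x - y :: 'k alg_closure) ^ p = x ^ p - y ^ p"
  using ac_frob_add[of "x - y" y] by (simp add: algebra_simps)

lemma poly_tac_frob_poly: "poly (tac (frob_poly G)) (x ^ p) = poly (tac G) x ^ p"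
proof -
  have "poly (tac G) x ^ p = (\<Sum>i\<le>Polynomial.degree G. (to_ac (coeff G i) * x ^ i) ^ p)"
    unfolding poly_tac_sum[OF order_refl] by (rule freshmans_dream_sum[OF ac_prime_char])
  also have "\<dots> = poly (tac (frob_poly G)) (x ^ p)"
    using poly_tac_sum[of "frob_poly G" "Polynomial.degree G" "x ^ p"]
    by (simp add: degree_frob_poly coeff_frob_poly power_mult_distrib power_mult[symmetric] mult.commute)
  finally show ?thesis ..
qed

text \<open>The ratio is invariant under affine substitutions, and the roots of the twist of
  \<open>G\<close> are the \<open>p\<close>-th powers of roots of \<open>G\<close>.\<close>

lemma root_ratio_descent:
  assumes \<gamma>: "\<gamma> \<noteq> 0" "c \<noteq> 0" and F: "pcompose F [:f0, \<gamma>:] = smult c (frob_poly G)"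
    and a: "poly (tac F) a1 = 0" "poly (tac F) a2 = 0" "poly (tac F) a3 = 0" "a1 \<noteq> a3"
  obtains b1 b2 b3 where "poly (tac G) b1 = 0" "poly (tac G) b2 = 0" "poly (tac G) b3 = 0" "b1 \<noteq> b3"
    "((b1 - b2) / (b1 - b3)) ^ p = (a1 - a2) / (a1 - a3)"
proof -
  have root: "\<exists>b. b ^ p = (a - to_ac f0) / to_ac \<gamma> \<and> poly (tac G) b = 0" if "poly (tac F) a = 0" for a
  proof -
    obtain b where b: "b ^ p = (a - to_ac f0) / to_ac \<gamma>" using nth_root_exists[OF p_pos] by blast
    have "a = to_ac f0 + to_ac \<gamma> * b ^ p" using \<gamma> by (simp add: b)
    hence "poly (tac (smult c (frob_poly G))) (b ^ p) = 0"
      using that F tac_pcompose_linear[of F f0 \<gamma> "b ^ p"] by simp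
    hence "poly (tac G) b = 0" using \<gamma> p_pos by (simp add: tac_smult poly_tac_frob_poly)
    thus ?thesis using b by blast
  qed
  obtain b1 where b1: "b1 ^ p = (a1 - to_ac f0) / to_ac \<gamma>" "poly (tac G) b1 = 0" using root[OF a(1)] by blast
  obtain b2 where b2: "b2 ^ p = (a2 - to_ac f0) / to_ac \<gamma>" "poly (tac G) b2 = 0" using root[OF a(2)] by blast
  obtain b3 where b3: "b3 ^ p = (a3 - to_ac f0) / to_ac \<gamma>" "poly (tac G) b3 = 0" using root[OF a(3)] by blast
  have \<gamma>': "to_ac \<gamma> \<noteq> 0" using \<gamma> by simp
  have d: "(b1 - b2) ^ p = (a1 - a2) / to_ac \<gamma>" "(b1 - b3) ^ p = (a1 - a3) / to_ac \<gamma>"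
    by (simp_all add: ac_frob_diff b1 b2 b3 diff_divide_distrib)
  have "((b1 - b2) / (b1 - b3)) ^ p = (a1 - a2) / (a1 - a3)"
    unfolding power_divide d using \<gamma>' by simp
  moreover have "b1 \<noteq> b3"
  proof
    assume "b1 = b3"
    hence "a1 = a3" using b1 b3 \<gamma>' by simp
    thus False using a(4) by blast
  qed
  ultimately show ?thesis using that b1 b2 b3 by blast
qed

text \<open>The degree never changes along the descent; this keeps the degree bound of
  \<open>ratio_of_roots_relation\<close> uniform in \<open>j\<close>.\<close>

lemma unbounded_infinite_descent:
  assumes F: "2 \<le> Polynomial.degree F" "poly_coprime F (pderiv F)" "\<not> bounded_by_support F"
    and a: "poly (tac F) a1 = 0" "poly (tac F) a2 = 0" "poly (tac F) a3 = 0" "a1 \<noteq> a3"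
  shows "\<exists>G b1 b2 b3. Polynomial.degree G = Polynomial.degree F \<and> poly_coprime G (pderiv G) \<and>
    \<not> bounded_by_support G \<and> poly (tac G) b1 = 0 \<and> poly (tac G) b2 = 0 \<and> poly (tac G) b3 = 0 \<and> b1 \<noteq> b3 \<and>
    ((b1 - b2) / (b1 - b3)) ^ (p ^ j) = (a1 - a2) / (a1 - a3)"
proof (induction j)
  case 0
  show ?case using F a by (intro exI[of _ F] exI[of _ a1] exI[of _ a2] exI[of _ a3]) auto
next
  case (Suc j)
  then obtain G b1 b2 b3 where G: "Polynomial.degree G = Polynomial.degree F" "poly_coprime G (pderiv G)"
    "\<not> bounded_by_support G" and b: "poly (tac G) b1 = 0" "poly (tac G) b2 = 0" "poly (tac G) b3 = 0" "b1 \<noteq> b3"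
    and r: "((b1 - b2) / (b1 - b3)) ^ (p ^ j) = (a1 - a2) / (a1 - a3)" by blast
  obtain f0 \<gamma> c H where H: "\<gamma> \<noteq> 0" "c \<noteq> 0" "pcompose G [:f0, \<gamma>:] = smult c (frob_poly H)"
    "Polynomial.degree H = Polynomial.degree G" "poly_coprime H (pderiv H)" "\<not> bounded_by_support H"
    using unbounded_descent[of G] G F(1) by metis
  obtain d1 d2 d3 where d: "poly (tac H) d1 = 0" "poly (tac H) d2 = 0" "poly (tac H) d3 = 0" "d1 \<noteq> d3"
    "((d1 - d2) / (d1 - d3)) ^ p = (b1 - b2) / (b1 - b3)"
    using root_ratio_descent[OF H(1,2,3) b] by metis
  have "((d1 - d2) / (d1 - d3)) ^ (p ^ Suc j) = (a1 - a2) / (a1 - a3)"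
    unfolding power_Suc power_mult d(5) r ..
  thus ?case using G H d by (intro exI[of _ H] exI[of _ d1] exI[of _ d2] exI[of _ d3]) auto
qed

lemma frob_pow_diff: "(x - y :: 'k) ^ (p ^ j) = x ^ (p ^ j) - y ^ (p ^ j)"
proof (induction j)
  case (Suc j)
  have "z ^ p ^ Suc j = (z ^ p ^ j) ^ p" for z :: 'k by (simp add: power_mult[symmetric] mult.commute)
  thus ?case by (simp only: Suc frob_diff)
qed simp

text \<open>A nonzero value would be divisible by some \<open>p ^ j\<close> larger than its absolute
  value.\<close>

lemma infinitely_p_divisible_no_poles:
  assumes "\<And>j. j \<ge> j0 \<Longrightarrow> \<exists>a. x = a ^ (p ^ j)" and v: "prime_divisor k v"
  shows "v x = 0"
proof (rule ccontr)
  assume nz: "v x \<noteq> 0"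
  define j where "j = max j0 (nat \<bar>v x\<bar>)"
  obtain a where "x = a ^ (p ^ j)" using assms(1)[of j] by (auto simp: j_def)
  hence eq: "v x = int (p ^ j) * v a" by (simp only: v_power[OF v])
  hence "v a \<noteq> 0" using nz by auto
  hence "1 \<le> \<bar>v a\<bar>" by linarith
  hence "int (p ^ j) * 1 \<le> int (p ^ j) * \<bar>v a\<bar>" by (intro mult_left_mono) auto
  also have "\<dots> = \<bar>v x\<bar>" unfolding eq abs_mult by simp
  finally have "int (p ^ j) \<le> \<bar>v x\<bar>" by simp
  moreover have "j < p ^ j"
    using less_exp[of j] power_mono[of 2 p j] p_gt_1 by linarith
  moreover have "\<bar>v x\<bar> \<le> int j" by (simp add: j_def)
  ultimately show False by linarith
qed

text \<open>The elements of \<open>K\<close> without poles form a finite field. Coefficients of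
  value 0 everywhere belong to it, so \<mu> is algebraic over a finite field.\<close>

lemma torsion_if_constant_relation:
  fixes \<mu> :: "'k alg_closure"
  assumes "R \<noteq> 0" "poly (tac R) \<mu> = 0" and c: "\<And>i v. prime_divisor k v \<Longrightarrow> v (coeff R i) = 0"
  shows "torsion \<mu>"
proof -
  define K0 where "K0 = RR (\<lambda>_. 0)"
  have fin: "finite K0" unfolding K0_def by (rule finite_RR_0[of v0]) (simp add: v0)
  have mem: "x \<in> K0 \<longleftrightarrow> (\<forall>v\<in>PD. val_ge v x 0)" for x by (simp add: K0_def RR_def)
  have zero: "v x = 0" if "x \<in> K0" "v \<in> PD" for x v
    using that torsion_if_no_poles[of x] torsion_value_0[of k v x] mem by auto
  interpret C: const_field "to_ac ` K0" "card (to_ac ` K0)"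
  proof
    show "finite (to_ac ` K0)" using fin by simp
    show "0 \<in> to_ac ` K0" by (rule image_eqI[of _ _ 0]) (simp_all add: mem)
    show "1 \<in> to_ac ` K0" by (rule image_eqI[of _ _ 1]) (auto simp: mem val_ge_1)
  next
    fix x y assume "x \<in> to_ac ` K0" "y \<in> to_ac ` K0"
    then obtain x' y' where xy: "x = to_ac x'" "y = to_ac y'" "x' \<in> K0" "y' \<in> K0" by blast
    have "x' + y' \<in> K0" using xy by (auto simp: mem intro: val_ge_add)
    thus "x + y \<in> to_ac ` K0" unfolding xy(1,2) to_ac_add[symmetric] by (rule imageI)
    have "val_ge v (x' * y') (0 + 0)" if "v \<in> PD" for v
      using xy that by (intro val_ge_mult) (auto simp: mem)
    hence "x' * y' \<in> K0" by (simp add: mem)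
    thus "x * y \<in> to_ac ` K0" unfolding xy(1,2) to_ac_mult[symmetric] by (rule imageI)
  next
    fix x assume "x \<in> to_ac ` K0"
    then obtain x' where x: "x = to_ac x'" "x' \<in> K0" by blast
    have "- x' \<in> K0" using x by (auto simp: mem val_ge_uminus)
    thus "- x \<in> to_ac ` K0" unfolding x(1) to_ac_minus[symmetric] by (rule imageI)
    have "inverse x' \<in> K0" unfolding mem
    proof
      fix v assume v: "v \<in> PD"
      hence "v (inverse x') = - v x'" by (intro v_inverse) simp
      thus "val_ge v (inverse x') 0" using zero[OF x(2) v] by (simp add: val_ge_def)
    qed
    thus "inverse x \<in> to_ac ` K0" unfolding x(1) to_ac_inverse[symmetric] by (rule imageI)
  qed simp
  have "coeff (tac R) i \<in> to_ac ` K0" for i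
  proof -
    have "val_ge v (coeff R i) 0" if "v \<in> PD" for v
      using c[of v i] that by (intro val_ge_self) simp
    thus ?thesis unfolding coeff_tac by (intro imageI) (simp add: mem)
  qed
  thus ?thesis using C.torsion_if_algebraic[of "tac R" \<mu>] assms(1,2) by (simp add: tac_eq_0_iff)
qed

text \<open>
  The minimal polynomials of \<open>\<mu>\<close> over the fields of \<open>p ^ j\<close>-th powers have bounded degree, hence are
  eventually constant, and elements that are \<open>p ^ j\<close>-th powers for all \<open>j\<close> have neither zeros nor poles.
\<close>

lemma torsion_if_p_divisible:
  fixes \<mu> :: "'k alg_closure"
  assumes "\<And>j. \<exists>R x. R \<noteq> 0 \<and> Polynomial.degree R \<le> N \<and> poly (tac R) x = 0 \<and> x ^ (p ^ j) = \<mu>"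
  shows "torsion \<mu>"
proof -
  \<comment> \<open>Annihilating polynomials of \<mu> over the field of \<open>p ^ j\<close>-th
    powers; twisting a relation for a \<open>p ^ j\<close>-th root of \<mu> produces one.\<close>
  define Z where "Z j = {T. T \<noteq> 0 \<and> Polynomial.degree T \<le> N \<and> poly (tac T) \<mu> = 0 \<and>
    (\<forall>i. \<exists>a. coeff T i = a ^ (p ^ j))}" for j
  have iter: "coeff ((frob_poly ^^ j) R) i = coeff R i ^ (p ^ j)"
    "Polynomial.degree ((frob_poly ^^ j) R) = Polynomial.degree R"
    "poly (tac ((frob_poly ^^ j) R)) (x ^ (p ^ j)) = poly (tac R) x ^ (p ^ j)" for j R i x
  proof (induction j)
    case (Suc j)
    { case 1 show ?case using Suc(1) by (simp add: coeff_frob_poly power_mult[symmetric] mult.commute) }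
    { case 2 show ?case using Suc(2) by (simp add: degree_frob_poly) }
    { case 3 
      have e: "z ^ (p ^ Suc j) = (z ^ p ^ j) ^ p" for z :: "'k alg_closure"
        by (simp add: power_mult[symmetric] mult.commute)
      show ?case unfolding e using Suc(3) by (simp add: poly_tac_frob_poly) }
  qed simp_all
  have Zne: "\<exists>T. T \<in> Z j" for j
  proof -
    obtain R x where R: "R \<noteq> 0" "Polynomial.degree R \<le> N" "poly (tac R) x = 0" "x ^ (p ^ j) = \<mu>"
      using assms[of j] by blast
    have "(frob_poly ^^ j) R \<noteq> 0"
    proof
      assume "(frob_poly ^^ j) R = 0"
      hence "Polynomial.lead_coeff R ^ (p ^ j) = 0" using iter(1)[of j R "Polynomial.degree R"] by simp
      thus False using R(1) by simp
    qed
    moreover have "poly (tac ((frob_poly ^^ j) R)) \<mu> = 0"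
      using iter(3)[of j R x] R(3,4) p_pos by simp
    ultimately have "(frob_poly ^^ j) R \<in> Z j" using R(2) iter(1,2)[of j R] by (auto simp: Z_def)
    thus ?thesis by blast
  qed
  have Z_anti: "Z j' \<subseteq> Z j" if "j \<le> j'" for j j'
  proof
    fix T assume T: "T \<in> Z j'"
    have "\<exists>a. coeff T i = a ^ (p ^ j)" for i
    proof -
      obtain a where a: "coeff T i = a ^ (p ^ j')" using T by (auto simp: Z_def)
      have "a ^ (p ^ j') = (a ^ (p ^ (j' - j))) ^ (p ^ j)"
        using that by (simp add: power_mult[symmetric] power_add[symmetric])
      thus ?thesis using a by metis
    qed
    thus "T \<in> Z j" using T by (simp add: Z_def)
  qed
  define m where "m j = (LEAST d. \<exists>T\<in>Z j. Polynomial.degree T = d)" for j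
  have m_ex: "\<exists>T\<in>Z j. Polynomial.degree T = m j" for j
    unfolding m_def by (rule LeastI_ex) (use Zne in blast)
  have m_le: "m j \<le> Polynomial.degree T" if "T \<in> Z j" for j T
    unfolding m_def by (rule Least_le) (use that in blast)
  have monic: "\<exists>T\<in>Z j. Polynomial.degree T = m j \<and> Polynomial.lead_coeff T = 1" for j
  proof -
    obtain T where T: "T \<in> Z j" "Polynomial.degree T = m j" using m_ex by blast
    define l where "l = Polynomial.lead_coeff T"
    have "T \<noteq> 0" using T(1) by (simp add: Z_def)
    hence l: "l \<noteq> 0" by (simp add: l_def)
    obtain b where b: "l = b ^ (p ^ j)" using T by (auto simp: Z_def l_def)
    have "\<exists>a. inverse l * coeff T i = a ^ (p ^ j)" for i
    proof -
      obtain a where "coeff T i = a ^ (p ^ j)" using T by (auto simp: Z_def)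
      thus ?thesis using b by (intro exI[of _ "inverse b * a"]) (simp add: power_mult_distrib power_inverse)
    qed
    hence "smult (inverse l) T \<in> Z j" using T l by (auto simp: Z_def tac_smult)
    thus ?thesis using T l by (intro bexI[of _ "smult (inverse l) T"]) (auto simp: l_def)
  qed
  have mN: "m j \<le> N" for j using m_ex[of j] by (auto simp: Z_def)
  have "finite (range m)" using mN by (intro finite_subset[of "range m" "{..N}"]) auto
  hence "Max (range m) \<in> range m" by (intro Max_in) auto
  \<comment> \<open>The least degrees are bounded by \<open>N\<close>, so their maximum is attained;
    as \<open>Z\<close> shrinks, they stay constant from \<open>j0\<close> on.\<close>
  then obtain j0 where j0: "m j0 = Max (range m)" by auto
  have m_max: "m j \<le> m j0" for j unfolding j0 using \<open>finite (range m)\<close> by (intro Max_ge) auto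
  obtain T where T: "T \<in> Z j0" "Polynomial.degree T = m j0" "Polynomial.lead_coeff T = 1" using monic by blast
  have "\<exists>a. coeff T i = a ^ (p ^ j)" if j: "j0 \<le> j" for i j
  proof -
    obtain U where U: "U \<in> Z j" "Polynomial.degree U = m j" "Polynomial.lead_coeff U = 1" using monic by blast
    have U0: "U \<in> Z j0" using Z_anti[OF j] U(1) by blast
    have mj: "m j = m j0" using m_max[of j] m_le[OF U0] U(2) by linarith
    \<comment> \<open>Two monic polynomials of the same least degree differ by something of smaller
      degree, so they coincide; thus \<open>T\<close> itself has coefficients that are
      \<open>p ^ j\<close>-th powers.\<close>
    have "U - T = 0"
    proof (rule ccontr)
      assume ne: "U - T \<noteq> 0"
      have degle: "Polynomial.degree (U - T) \<le> m j0" using U(2) T(2) mj by (intro degree_diff_le) auto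
      moreover have "coeff (U - T) (m j0) = 0" using U(2,3) T(2,3) mj by simp
      ultimately have lt: "Polynomial.degree (U - T) < m j0"
        using ne by (metis leading_coeff_0_iff le_neq_implies_less)
      have "\<exists>a. coeff (U - T) i = a ^ (p ^ j0)" for i
      proof -
        obtain a b where "coeff U i = a ^ (p ^ j0)" "coeff T i = b ^ (p ^ j0)"
          using U0 T(1) by (auto simp: Z_def) metis
        thus ?thesis by (intro exI[of _ "a - b"]) (simp add: frob_pow_diff)
      qed
      moreover have "poly (tac (U - T)) \<mu> = 0"
      proof -
        have "tac U = tac (U - T) + tac T" by (simp flip: tac_add)
        thus ?thesis using U0 T(1) by (simp add: Z_def)
      qed
      ultimately have "U - T \<in> Z j0" using ne degle mN[of j0] by (auto simp: Z_def)
      thus False using m_le lt by fastforce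
    qed
    hence "T = U" by simp
    thus ?thesis using U(1) by (simp add: Z_def)
  qed
  hence "v (coeff T i) = 0" if "prime_divisor k v" for i v
    using infinitely_p_divisible_no_poles[of j0 "coeff T i" v] that by blast
  thus ?thesis using T(1) by (intro torsion_if_constant_relation[of T]) (auto simp: Z_def)
qed

text \<open>The split is on the Bezout identity for \<open>F\<close> and \<open>F'\<close> instead
  of on \<open>separable_poly\<close>. Its failure is settled inside \<open>K\<close>; where it
  holds \<open>F\<close> is separable, so the three roots are available.\<close>

theorem bounded_by_support_main:
  assumes F: "F \<noteq> 0" "squarefree F"
    and alt: "\<not> separable_poly F \<or> (\<exists>a1 a2 a3. a1 \<noteq> a2 \<and> a1 \<noteq> a3 \<and>
      poly (tac F) a1 = 0 \<and> poly (tac F) a2 = 0 \<and> poly (tac F) a3 = 0 \<and> \<not> torsion ((a1 - a2) / (a1 - a3)))"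
  shows "bounded_by_support F"
proof (cases "poly_coprime F (pderiv F)")
  case False
  thus ?thesis using not_coprime_bounded_by_support F by blast
next
  case cop: True
  then obtain a1 a2 a3 where a: "a1 \<noteq> a2" "a1 \<noteq> a3" "poly (tac F) a1 = 0" "poly (tac F) a2 = 0" "poly (tac F) a3 = 0"
    and nt: "\<not> torsion ((a1 - a2) / (a1 - a3))"
    using alt separable_if_coprime[OF F(1)] by blast
  have deg2: "2 \<le> Polynomial.degree F"
  proof -
    have "card {a1, a2} \<le> card {x. poly (tac F) x = 0}"
      using a poly_roots_finite[of "tac F"] F by (intro card_mono) (auto simp: tac_eq_0_iff)
    also have "\<dots> \<le> Polynomial.degree (tac F)" by (rule card_poly_roots_bound) (simp add: tac_eq_0_iff F)
    finally show ?thesis using a(1) by (simp add: degree_tac)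
  qed
  show ?thesis
  proof (rule ccontr)
    assume nb: "\<not> bounded_by_support F"
    have "torsion ((a1 - a2) / (a1 - a3))"
    proof (rule torsion_if_p_divisible)
      fix j
      obtain G b1 b2 b3 where G: "Polynomial.degree G = Polynomial.degree F"
        "poly (tac G) b1 = 0" "poly (tac G) b2 = 0" "poly (tac G) b3 = 0" "b1 \<noteq> b3"
        "((b1 - b2) / (b1 - b3)) ^ (p ^ j) = (a1 - a2) / (a1 - a3)"
        using unbounded_infinite_descent[OF deg2 cop nb a(3,4,5,2), of j] by blast
      have "0 < Polynomial.degree F" using deg2 by simp
      from ratio_of_roots_relation[OF G(1)[symmetric] this G(2-5)] G(6)
      show "\<exists>R x. R \<noteq> 0 \<and> Polynomial.degree R \<le> Polynomial.degree F ^ 3 \<and> poly (tac R) x = 0 \<and>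
        x ^ (p ^ j) = (a1 - a2) / (a1 - a3)" by blast
    qed
    thus False using nt by blast
  qed
qed

end

section \<open>Function fields over finite fields\<close>

context const_field
begin

lemma kpoly_const: "c \<in> k \<Longrightarrow> kpoly [:c:]"
  using k_0 by (auto simp: coeff_pCons split: nat.split)

lemma kpoly_1: "kpoly 1"
  using k_0 k_1 by (auto simp: coeff_1)

lemma kpoly_prod: "(\<And>i. i \<in> I \<Longrightarrow> kpoly (P i)) \<Longrightarrow> kpoly (prod P I)"
proof (induction I rule: infinite_finite_induct)
  case (insert i I)
  thus ?case unfolding prod.insert[OF insert.hyps] by (intro kpoly_mult) auto
next
  case (infinite I)
  show ?case unfolding prod.infinite[OF infinite(1)] by (rule kpoly_1)
next
  case empty
  show ?case unfolding prod.empty by (rule kpoly_1)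
qed

text \<open>Two different monomials take the same value at \<open>x\<close>, so evaluation at
  \<open>x\<close> is not injective.\<close>

lemma torsion_imp_algebraic_over:
  assumes "torsion x"
  shows "algebraic_over k x"
proof -
  interpret T: field "type_ring :: 'k ring" by (rule field_from_type_algebra)
  have sub: "subring k (type_ring :: 'k ring)"
    by (rule T.subringI) (auto simp: k_1 k_uminus k_mult k_add)
  obtain i j where ij: "i < j" "x ^ i = x ^ j" using assms by (auto simp: torsion_def)
  have pow: "y [^]\<^bsub>type_ring\<^esub> (n :: nat) = y ^ n" for y :: 'k and n
    by (induction n) (auto simp: mult.commute)
  have mon: "T.monom 1 n \<in> carrier (k [X]\<^bsub>type_ring\<^esub>)" for n
    using T.monom_is_polynomial[OF sub, of 1 n] k_1 by (simp add: univ_poly_def)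
  have ev: "T.eval (T.monom 1 n) x = x ^ n" for n
    using T.eval_monom[of 1 x n] by (simp add: pow)
  have ne: "T.monom (1 :: 'k) i \<noteq> T.monom 1 j" using ij(1) by (simp add: T.monom_def)
  have "\<not> inj_on (\<lambda>p. T.eval p x) (carrier (k [X]\<^bsub>type_ring\<^esub>))"
  proof
    assume "inj_on (\<lambda>p. T.eval p x) (carrier (k [X]\<^bsub>type_ring\<^esub>))"
    from inj_onD[OF this _ mon[of i] mon[of j]] show False using ne ev ij(2) by simp
  qed
  thus ?thesis by (simp add: algebraic_over_def over_def T.transcendental_def)
qed

lemma const_field_to_ac: "const_field (to_ac ` k) q"
proof
  show "card (to_ac ` k) = q" using card_k inj_to_ac by (metis card_image inj_on_subset subset_UNIV)
  show "0 \<in> to_ac ` k" "1 \<in> to_ac ` k" using k_0 k_1 by (metis imageI to_ac_0, metis imageI to_ac_1)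
qed (use finite_k k_add k_uminus k_mult k_inverse in
  \<open>auto simp flip: to_ac_add to_ac_mult to_ac_minus to_ac_inverse\<close>)

end

section \<open>The growth condition for finite extensions of k(t)\<close>

lemma combine_type_ring:
  "length Ks = length Vs \<Longrightarrow> ring.combine (type_ring :: 'a::field ring) Ks Vs = (\<Sum>i<length Vs. Ks ! i * Vs ! i)"
proof (induction Ks Vs rule: list_induct2)
  case Nil
  interpret T: field "type_ring :: 'a ring" by (rule field_from_type_algebra)
  show ?case by simp
next
  case (Cons a Ks b Vs)
  interpret T: field "type_ring :: 'a ring" by (rule field_from_type_algebra)
  show ?case using Cons.IH by (simp add: sum.lessThan_Suc_shift del: sum.lessThan_Suc)
qed

text \<open>\<open>K\<close> as a space over \<open>k(t)\<close> generated by the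
  \<open>u i\<close>, with the fractions in \<open>t\<close> written out.\<close>

locale function_field_basis = const_field k q for k :: "'k::field set" and q +
  fixes t :: 'k and n :: nat and u :: "nat \<Rightarrow> 'k"
  assumes span: "\<exists>A B. (\<forall>i<n. kpoly (A i) \<and> kpoly (B i) \<and> poly (B i) t \<noteq> 0) \<and>
    z = (\<Sum>i<n. poly (A i) t / poly (B i) t * u i)"
begin

text \<open>Pieces of bounded degree of the \<open>k[t]\<close>-module generated by the
  \<open>u i\<close>; their size grows at most like \<open>q ^ (n * l)\<close>.\<close>

definition lattice :: "nat \<Rightarrow> 'k set"
  where "lattice l = {\<Sum>i<n. poly (P i) t * u i | P. \<forall>i<n. kpoly (P i) \<and> Polynomial.degree (P i) \<le> l}"

lemma latticeI: "(\<And>i. i < n \<Longrightarrow> kpoly (P i) \<and> Polynomial.degree (P i) \<le> l) \<Longrightarrow>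
    z = (\<Sum>i<n. poly (P i) t * u i) \<Longrightarrow> z \<in> lattice l"
  unfolding lattice_def by blast

lemma latticeD:
  "z \<in> lattice l \<Longrightarrow> \<exists>P. (\<forall>i<n. kpoly (P i)) \<and> (\<forall>i<n. Polynomial.degree (P i) \<le> l) \<and>
    z = (\<Sum>i<n. poly (P i) t * u i)"
  unfolding lattice_def by blast

lemma card_lattice: "finite (lattice l) \<and> card (lattice l) \<le> (q ^ Suc l) ^ n"
proof -
  define K where "K = {P. kpoly P \<and> Polynomial.degree P < Suc l}"
  have K: "finite K" "card K \<le> q ^ Suc l" unfolding K_def using kpolys_bound by blast+
  have sub: "lattice l \<subseteq> (\<lambda>P. \<Sum>i<n. poly (P i) t * u i) ` ({..<n} \<rightarrow>\<^sub>E K)"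
  proof
    fix z assume "z \<in> lattice l"
    then obtain P where P: "\<And>i. i < n \<Longrightarrow> kpoly (P i)" "\<And>i. i < n \<Longrightarrow> Polynomial.degree (P i) \<le> l"
      "z = (\<Sum>i<n. poly (P i) t * u i)" using latticeD by metis
    have "restrict P {..<n} \<in> {..<n} \<rightarrow>\<^sub>E K" using P(1,2) by (auto simp: K_def less_Suc_eq_le)
    moreover have "z = (\<Sum>i<n. poly (restrict P {..<n} i) t * u i)" unfolding P(3) by (intro sum.cong) auto
    ultimately show "z \<in> (\<lambda>P. \<Sum>i<n. poly (P i) t * u i) ` ({..<n} \<rightarrow>\<^sub>E K)" by blast
  qed
  have fin: "finite ({..<n} \<rightarrow>\<^sub>E K)" using K(1) by (intro finite_PiE) auto
  have "card (lattice l) \<le> card ({..<n} \<rightarrow>\<^sub>E K)" using surj_card_le[OF fin sub] .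
  also have "\<dots> = card K ^ n" by (simp add: card_PiE)
  also have "\<dots> \<le> (q ^ Suc l) ^ n" using K(2) by (rule power_mono) simp
  finally show ?thesis using finite_surj[OF fin sub] by blast
qed

lemma lattice_0: "0 \<in> lattice l"
  using k_0 by (intro latticeI[of "\<lambda>_. 0"]) auto

lemma lattice_add:
  assumes "x \<in> lattice l" "y \<in> lattice l"
  shows "x + y \<in> lattice l"
proof -
  obtain P where P: "\<And>i. i < n \<Longrightarrow> kpoly (P i)" "\<And>i. i < n \<Longrightarrow> Polynomial.degree (P i) \<le> l"
    "x = (\<Sum>i<n. poly (P i) t * u i)" using latticeD[OF assms(1)] by blast
  obtain Q where Q: "\<And>i. i < n \<Longrightarrow> kpoly (Q i)" "\<And>i. i < n \<Longrightarrow> Polynomial.degree (Q i) \<le> l"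
    "y = (\<Sum>i<n. poly (Q i) t * u i)" using latticeD[OF assms(2)] by blast
  show "x + y \<in> lattice l"
  proof (rule latticeI[of "\<lambda>i. P i + Q i"])
    show "x + y = (\<Sum>i<n. poly (P i + Q i) t * u i)"
      unfolding P(3) Q(3) by (simp add: distrib_right sum.distrib)
  qed (use P Q in \<open>auto intro: k_add degree_add_le\<close>)
qed

lemma lattice_sum: "(\<And>i. i \<in> I \<Longrightarrow> f i \<in> lattice l) \<Longrightarrow> sum f I \<in> lattice l"
  by (induction I rule: infinite_finite_induct) (auto intro: lattice_0 lattice_add)

lemma lattice_mult:
  assumes "kpoly d" "Polynomial.degree d \<le> c" "x \<in> lattice l"
  shows "poly d t * x \<in> lattice (l + c)"
proof -
  obtain P where P: "\<And>i. i < n \<Longrightarrow> kpoly (P i)" "\<And>i. i < n \<Longrightarrow> Polynomial.degree (P i) \<le> l"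
    "x = (\<Sum>i<n. poly (P i) t * u i)" using latticeD[OF assms(3)] by blast
  show ?thesis
  proof (rule latticeI[of "\<lambda>i. d * P i"])
    fix i assume i: "i < n"
    have "Polynomial.degree (d * P i) \<le> Polynomial.degree d + Polynomial.degree (P i)" by (rule degree_mult_le)
    also have "\<dots> \<le> l + c" using assms(2) P(2)[OF i] by simp
    finally show "kpoly (d * P i) \<and> Polynomial.degree (d * P i) \<le> l + c"
      using kpoly_mult[OF assms(1) P(1)[OF i]] by blast
  next
    show "poly d t * x = (\<Sum>i<n. poly (d * P i) t * u i)"
      unfolding P(3) by (simp add: sum_distrib_left mult.assoc)
  qed
qed

lemma lattice_mono: "l \<le> l' \<Longrightarrow> lattice l \<subseteq> lattice l'"
  unfolding lattice_def by (blast intro: le_trans)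

lemma denominator_exists: "\<exists>d c. kpoly d \<and> poly d t \<noteq> 0 \<and> poly d t * z \<in> lattice c"
proof -
  obtain A B where AB: "\<And>i. i < n \<Longrightarrow> kpoly (A i)" "\<And>i. i < n \<Longrightarrow> kpoly (B i)"
    "\<And>i. i < n \<Longrightarrow> poly (B i) t \<noteq> 0" and z: "z = (\<Sum>i<n. poly (A i) t / poly (B i) t * u i)"
    using span[of z] by blast
  define d where "d = (\<Prod>i<n. B i)"
  define E where "E i = (\<Prod>j\<in>{..<n} - {i}. B j) * A i" for i
  have E: "poly d t * (poly (A i) t / poly (B i) t) = poly (E i) t" if "i < n" for i
  proof -
    have "d = B i * (\<Prod>j\<in>{..<n} - {i}. B j)" unfolding d_def using that by (intro prod.remove) auto
    thus ?thesis using AB(3)[OF that] by (simp add: E_def)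
  qed
  define c where "c = (\<Sum>i<n. Polynomial.degree (E i))"
  have "poly d t * z \<in> lattice c"
  proof (rule latticeI[of E])
    fix i assume i: "i < n"
    have "kpoly (E i)" unfolding E_def using AB i by (intro kpoly_mult kpoly_prod) auto
    moreover have "Polynomial.degree (E i) \<le> c" unfolding c_def using i by (intro member_le_sum) auto
    ultimately show "kpoly (E i) \<and> Polynomial.degree (E i) \<le> c" by blast
  next
    show "poly d t * z = (\<Sum>i<n. poly (E i) t * u i)"
      unfolding z sum_distrib_left by (intro sum.cong refl) (simp add: E[symmetric] mult.assoc)
  qed
  moreover have "kpoly d" unfolding d_def using AB by (intro kpoly_prod) auto
  moreover have "poly d t \<noteq> 0" unfolding d_def poly_prod using AB by auto
  ultimately show ?thesis by blast
qed

lemma common_denominator_exists: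
  assumes "finite W"
  shows "\<exists>d c. kpoly d \<and> poly d t \<noteq> 0 \<and> (\<forall>w\<in>W. poly d t * w \<in> lattice c)"
  using assms
proof (induction W)
  case empty
  show ?case using kpoly_1 by (intro exI[of _ 1]) auto
next
  case (insert w W)
  then obtain d c where d: "kpoly d" "poly d t \<noteq> 0" "\<forall>w\<in>W. poly d t * w \<in> lattice c" by blast
  obtain d' c' where d': "kpoly d'" "poly d' t \<noteq> 0" "poly d' t * w \<in> lattice c'"
    using denominator_exists by blast
  define b where "b = c + c' + Polynomial.degree d + Polynomial.degree d'"
  have "poly (d * d') t * w' \<in> lattice b" if "w' \<in> insert w W" for w'
  proof (cases "w' = w")
    case True
    have "poly d t * (poly d' t * w) \<in> lattice (c' + Polynomial.degree d)"
      by (rule lattice_mult[OF d(1) order_refl d'(3)])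
    also have "\<dots> \<subseteq> lattice b" by (rule lattice_mono) (simp add: b_def)
    finally show ?thesis using True by (simp add: mult.assoc)
  next
    case False
    hence "poly d' t * (poly d t * w') \<in> lattice (c + Polynomial.degree d')"
      using that d(3) by (intro lattice_mult[OF d'(1) order_refl]) auto
    also have "\<dots> \<subseteq> lattice b" by (rule lattice_mono) (simp add: b_def)
    finally show ?thesis by (simp add: mult_ac)
  qed
  moreover have "kpoly (d * d')" using d d' by (intro kpoly_mult)
  moreover have "poly (d * d') t \<noteq> 0" using d d' by simp
  ultimately show ?case by blast
qed

text \<open>\<open>D\<close> clears the denominators of multiplication by \<open>x\<close> on the
  generators, so multiplying by \<open>D\<close> or by \<open>D * x\<close> raises degrees by at
  most \<open>c\<close>. Scaling by \<open>D ^ J\<close> and by a common denominator of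
  \<open>W\<close> puts all expansions into \<open>lattice (b + J * c)\<close>; the rate
  \<open>q ^ (n * c)\<close> depends on \<open>x\<close> only.\<close>

lemma expansions_growth:
  fixes x :: 'k
  shows "\<exists>Q. \<forall>W. finite W \<longrightarrow> (\<exists>B. \<forall>J. card ((\<lambda>w. \<Sum>j\<le>J. x ^ j * w j) ` ({..J} \<rightarrow>\<^sub>E W)) \<le> B * Q ^ J)"
proof -
  obtain d c0 where d: "kpoly d" "poly d t \<noteq> 0" "\<forall>w\<in>(\<lambda>i. x * u i) ` {..<n}. poly d t * w \<in> lattice c0"
    using common_denominator_exists[of "(\<lambda>i. x * u i) ` {..<n}"] by auto
  define D where "D = poly d t"
  define c where "c = c0 + Polynomial.degree d"
  have D1: "D * z \<in> lattice (l + c)" if "z \<in> lattice l" for z l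
    unfolding D_def using that by (intro lattice_mult[OF d(1)]) (simp_all add: c_def)
  have D2: "D * x * z \<in> lattice (l + c)" if z: "z \<in> lattice l" for z l
  proof -
    obtain P where P: "\<And>i. i < n \<Longrightarrow> kpoly (P i)" "\<And>i. i < n \<Longrightarrow> Polynomial.degree (P i) \<le> l"
      "z = (\<Sum>i<n. poly (P i) t * u i)" using latticeD[OF z] by blast
    have "D * x * z = (\<Sum>i<n. poly (P i) t * (D * (x * u i)))"
      unfolding P(3) sum_distrib_left by (intro sum.cong refl) (simp add: mult_ac)
    also have "\<dots> \<in> lattice (c0 + l)"
      using P(1,2) d(3) by (intro lattice_sum lattice_mult) (auto simp: D_def)
    also have "\<dots> \<subseteq> lattice (l + c)" by (rule lattice_mono) (simp add: c_def)
    finally show ?thesis .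
  qed
  have D2j: "(D * x) ^ j * z \<in> lattice (l + j * c)" if "z \<in> lattice l" for z l j
  proof (induction j)
    case (Suc j)
    from D2[OF this] show ?case by (simp add: mult.assoc add_ac)
  qed (use that in simp)
  have D1j: "D ^ j * z \<in> lattice (l + j * c)" if "z \<in> lattice l" for z l j
  proof (induction j)
    case (Suc j)
    from D1[OF this] show ?case by (simp add: mult.assoc add_ac)
  qed (use that in simp)
  have "\<exists>B. \<forall>J. card ((\<lambda>w. \<Sum>j\<le>J. x ^ j * w j) ` ({..J} \<rightarrow>\<^sub>E W)) \<le> B * (q ^ (n * c)) ^ J" if W: "finite W" for W
  proof -
    obtain e b where e: "kpoly e" "poly e t \<noteq> 0" "\<forall>w\<in>W. poly e t * w \<in> lattice b"
      using common_denominator_exists[OF W] by blast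
    have "card ((\<lambda>w. \<Sum>j\<le>J. x ^ j * w j) ` ({..J} \<rightarrow>\<^sub>E W)) \<le> q ^ (n * Suc b) * (q ^ (n * c)) ^ J" for J
    proof -
      define V where "V = (\<lambda>w. \<Sum>j\<le>J. x ^ j * w j) ` ({..J} \<rightarrow>\<^sub>E W)"
      define g where "g y = D ^ J * poly e t * y" for y
      have "inj_on g V" using d(2) e(2) by (auto simp: inj_on_def g_def D_def)
      moreover have "g ` V \<subseteq> lattice (b + J * c)"
      proof
        fix y assume "y \<in> g ` V"
        then obtain w where w: "w \<in> {..J} \<rightarrow>\<^sub>E W" "y = g (\<Sum>j\<le>J. x ^ j * w j)" by (auto simp: V_def)
        have "y = (\<Sum>j\<le>J. D ^ (J - j) * ((D * x) ^ j * (poly e t * w j)))"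
          unfolding w(2) g_def sum_distrib_left
        proof (intro sum.cong refl)
          fix j assume "j \<in> {..J}"
          hence "D ^ J = D ^ (J - j) * D ^ j" by (simp flip: power_add)
          thus "D ^ J * poly e t * (x ^ j * w j) = D ^ (J - j) * ((D * x) ^ j * (poly e t * w j))"
            by (simp add: power_mult_distrib mult_ac)
        qed
        also have "\<dots> \<in> lattice (b + J * c)"
        proof (rule lattice_sum)
          fix j assume j: "j \<in> {..J}"
          have "poly e t * w j \<in> lattice b" using w(1) e(3) j by (auto simp: PiE_iff)
          hence "D ^ (J - j) * ((D * x) ^ j * (poly e t * w j)) \<in> lattice (b + j * c + (J - j) * c)"
            by (intro D1j D2j)
          moreover have "b + j * c + (J - j) * c = b + J * c"
            using j by (simp add: add_mult_distrib[symmetric])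
          ultimately show "D ^ (J - j) * ((D * x) ^ j * (poly e t * w j)) \<in> lattice (b + J * c)" by simp
        qed
        finally show "y \<in> lattice (b + J * c)" .
      qed
      ultimately have "card V \<le> card (lattice (b + J * c))" using card_lattice by (intro card_inj_on_le) auto
      also have "\<dots> \<le> (q ^ Suc (b + J * c)) ^ n" using card_lattice by blast
      also have "\<dots> = q ^ (n * Suc b) * (q ^ (n * c)) ^ J"
        by (simp only: power_mult[symmetric] power_add[symmetric]) (simp add: algebra_simps)
      finally show ?thesis unfolding V_def .
    qed
    thus ?thesis by blast
  qed
  thus ?thesis by blast
qed

end

lemma const_field_if_subfield:
  assumes "subfield k type_ring" "finite k" "card k = q"
  shows "const_field (k :: 'k::field set) q"
proof -
  interpret T: field "type_ring :: 'k ring" by (rule field_from_type_algebra)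
  note sub = subfieldE(1)[OF assms(1)]
  show ?thesis
  proof
    fix x assume x: "x \<in> k"
    show "- x \<in> k" using subringE(5)[OF sub x] by simp
    show "inverse x \<in> k"
      using T.subfield_m_inv(1)[OF assms(1), of x] x by (cases "x = 0") auto
  qed (use assms(2,3) subringE[OF sub] in auto)
qed

lemma growth_field_if_function_field:
  assumes ff: "function_field_over k" and k: "finite k" "card k = q"
  shows "growth_field (k :: 'k::field set) q"
proof -
  interpret T: field "type_ring :: 'k ring" by (rule field_from_type_algebra)
  interpret const_field k q
    using const_field_if_subfield ff k by (auto simp: function_field_over_def)
  obtain t where fd: "T.finite_dimension (generate_field type_ring (insert t k)) UNIV"
    using ff by (auto simp: function_field_over_def)
  define L where "L = generate_field type_ring (insert t k)"
  have L: "subfield L (type_ring :: 'k ring)" unfolding L_def by (rule T.generate_field_is_subfield) simp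
  have frac: "\<exists>A B. kpoly A \<and> kpoly B \<and> poly B t \<noteq> 0 \<and> h = poly A t / poly B t" if "h \<in> L" for h
    using that unfolding L_def
  proof (induction rule: generate_field.induct)
    case one
    show ?case using kpoly_1 by (intro exI[of _ 1]) auto
  next
    case (incl h)
    show ?case
    proof (cases "h = t")
      case True
      have "kpoly [:0, 1:]" using k_0 k_1 by (auto simp: coeff_pCons split: nat.split)
      thus ?thesis using True kpoly_1 by (intro exI[of _ "[:0, 1:]"] exI[of _ 1]) auto
    next
      case False
      hence "kpoly [:h:]" using incl by (intro kpoly_const) auto
      thus ?thesis using kpoly_1 by (intro exI[of _ "[:h:]"] exI[of _ 1]) auto
    qed
  next
    case (a_inv h)
    then obtain A B where AB: "kpoly A" "kpoly B" "poly B t \<noteq> 0" "h = poly A t / poly B t" by blast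
    have "kpoly (- A)" using AB(1) k_uminus by simp
    thus ?case using AB by (intro exI[of _ "- A"] exI[of _ B]) auto
  next
    case (m_inv h)
    then obtain A B where AB: "kpoly A" "kpoly B" "poly B t \<noteq> 0" "h = poly A t / poly B t" by blast
    thus ?case using m_inv(2) by (intro exI[of _ B] exI[of _ A]) auto
  next
    case (eng_add h1 h2)
    then obtain A B A' B' where AB: "kpoly A" "kpoly B" "poly B t \<noteq> 0" "h1 = poly A t / poly B t"
      "kpoly A'" "kpoly B'" "poly B' t \<noteq> 0" "h2 = poly A' t / poly B' t" by blast
    have "kpoly (A * B')" "kpoly (A' * B)" "kpoly (B * B')" using AB by (auto intro!: kpoly_mult[rule_format])
    moreover from this have "kpoly (A * B' + A' * B)" using k_add by simp
    moreover have "h1 + h2 = poly (A * B' + A' * B) t / poly (B * B') t"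
      unfolding AB(4,8) using AB(3,7) by (simp add: add_frac_eq)
    moreover have "poly (B * B') t \<noteq> 0" using AB(3,7) by simp
    ultimately show ?case unfolding type_ring_simps by blast
  next
    case (eng_mult h1 h2)
    then obtain A B A' B' where AB: "kpoly A" "kpoly B" "poly B t \<noteq> 0" "h1 = poly A t / poly B t"
      "kpoly A'" "kpoly B'" "poly B' t \<noteq> 0" "h2 = poly A' t / poly B' t" by blast
    have "kpoly (A * A')" "kpoly (B * B')" using AB by (auto intro!: kpoly_mult[rule_format])
    thus ?case using AB by (intro exI[of _ "A * A'"] exI[of _ "B * B'"]) auto
  qed
  obtain n where "T.dimension n L UNIV" using fd unfolding L_def by (rule T.finite_dimensionE')
  then obtain Vs where Vs: "T.independent L Vs" "T.Span L Vs = UNIV" using T.exists_base[OF L] by blast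
  interpret function_field_basis k q t "length Vs" "\<lambda>i. Vs ! i"
  proof
    fix z
    have "z \<in> T.Span L Vs" using Vs(2) by simp
    then obtain Ks where Ks: "set Ks \<subseteq> L" "length Ks = length Vs" "z = T.combine Ks Vs"
      using T.Span_mem_iff_length_version[OF L, of Vs] by auto
    have "\<forall>i<length Vs. \<exists>A B. kpoly A \<and> kpoly B \<and> poly B t \<noteq> 0 \<and> Ks ! i = poly A t / poly B t"
      using Ks(1,2) by (intro allI impI frac) auto
    then obtain A B where AB: "\<And>i. i < length Vs \<Longrightarrow> kpoly (A i) \<and> kpoly (B i) \<and> poly (B i) t \<noteq> 0"
      "\<And>i. i < length Vs \<Longrightarrow> Ks ! i = poly (A i) t / poly (B i) t" by metis
    have "z = (\<Sum>i<length Vs. poly (A i) t / poly (B i) t * Vs ! i)"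
      unfolding Ks(3) combine_type_ring[OF Ks(2)] by (intro sum.cong) (auto simp: AB(2))
    thus "\<exists>A B. (\<forall>i<length Vs. kpoly (A i) \<and> kpoly (B i) \<and> poly (B i) t \<noteq> 0) \<and>
      z = (\<Sum>i<length Vs. poly (A i) t / poly (B i) t * Vs ! i)" using AB(1) by blast
  qed
  show ?thesis by unfold_locales (rule expansions_growth)
qed

text \<open>Translation by 1 permutes \<open>k\<close>; comparing the sums over \<open>k\<close>
  gives \<open>of_nat q = 0\<close>.\<close>

lemma (in const_field) CHAR_eq_if_card_prime_power:
  assumes "prime p" "q = p ^ r"
  shows "CHAR('k) = p"
proof -
  have "bij_betw (\<lambda>x. x + 1) k k"
    by (rule bij_betwI[where g = "\<lambda>x. x - 1"]) (auto intro: k_add k_diff k_1)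
  hence "(\<Sum>x\<in>k. x + 1) = (\<Sum>x\<in>k. x)" by (rule sum.reindex_bij_betw)
  hence "of_nat q = (0 :: 'k)" using card_k by (simp add: sum.distrib)
  hence dvd: "CHAR('k) dvd p ^ r" using assms(2) of_nat_eq_0_iff_char_dvd by blast
  have "p ^ r \<noteq> 0" using assms(1) by simp
  hence "0 < CHAR('k)" using dvd by (intro gr0I) auto
  hence prime: "prime CHAR('k)" by (rule prime_CHAR_semidom)
  hence "CHAR('k) dvd p" using dvd prime_dvd_power by blast
  thus ?thesis using prime assms(1) primes_dvd_imp_eq by blast
qed

lemma (in growth_field) degsupp_le_max_degree:
  obtains C where "\<And>y. degsupp y \<le> C * q ^ max_degree k y"
proof -
  obtain C where C: "\<And>n. finite {v\<in>PD. deg v \<le> n}" "\<And>n. (\<Sum>v\<in>{v\<in>PD. deg v \<le> n}. deg v) \<le> C * q ^ n"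
    using places_of_bounded_degree by blast
  have "degsupp y \<le> C * q ^ max_degree k y" for y
  proof -
    have "deg v \<le> max_degree k y" if "v \<in> divisor_support k y" for v
      unfolding max_degree_def using that finite_divisor_support by (intro Max_ge) auto
    hence "divisor_support k y \<subseteq> {v\<in>PD. deg v \<le> max_degree k y}" by (auto simp: divisor_support_def)
    hence "degsupp y \<le> (\<Sum>v\<in>{v\<in>PD. deg v \<le> max_degree k y}. deg v)"
      unfolding degsupp_def using C(1) by (intro sum_mono2) auto
    thus ?thesis using C(2) le_trans by blast
  qed
  thus ?thesis using that by blast
qed

text \<open>\<open>C + 1\<close> keeps the logarithm meaningful for \<open>C = 0\<close>, and the
  additional 1 makes the inequality strict.\<close>

lemma elog_bound:
  assumes q: "2 \<le> q" and h: "h \<le> C * q ^ d"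
  shows "elog q h - ereal (log (real q) (real C + 1) + 1) < ereal (real d)"
proof (cases "h = 0")
  case False
  have "real h \<le> real C * real q ^ d" using h by (metis of_nat_le_iff of_nat_mult of_nat_power)
  also have "\<dots> \<le> (real C + 1) * real q ^ d" by (intro mult_right_mono) auto
  finally have "log (real q) (real h) \<le> log (real q) ((real C + 1) * real q ^ d)"
    using q False by (intro log_mono) auto
  also have "\<dots> = log (real q) (real C + 1) + real d"
    using q by (simp add: log_mult log_nat_power)
  finally show ?thesis using False by (simp add: elog_def)
qed (simp add: elog_def)

theorem theorem1p1:
  fixes p q r :: nat
    and k :: "'k::field set"
    and F :: "'k poly"
  assumes "prime p" and "0 < r" and "q = p ^ r"
    and "function_field_over k" and "card k = q"
    and "F \<noteq> 0" and "squarefree F"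
    and "\<not> separable_poly F \<or>
         (\<exists>a1 a2 a3 :: 'k alg_closure.
            a1 \<noteq> a2 \<and> a1 \<noteq> a3 \<and> a2 \<noteq> a3 \<and>
            poly (map_poly to_ac F) a1 = 0 \<and>
            poly (map_poly to_ac F) a2 = 0 \<and>
            poly (map_poly to_ac F) a3 = 0 \<and>
            (a1 - a2) / (a1 - a3) \<notin> constants_closure k)"
  shows "\<exists>c::real. \<forall>f::'k. \<not> is_constant k (poly F f) \<longrightarrow>
           ereal (real (max_degree k (poly F f))) > elog q (height k f) - ereal c"
proof -
  have "0 < q" using assms(1,3) prime_gt_0_nat by simp
  hence fin: "finite k" using assms(5) by (intro card_ge_0_finite) simp
  interpret growth_field k q by (rule growth_field_if_function_field[OF assms(4) fin assms(5)])
  have "\<exists>C. \<forall>f. \<not> is_constant k (poly F f) \<longrightarrow> height k f \<le> C * q ^ max_degree k (poly F f)"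
  \<comment> \<open>Without places every height is an empty sum; otherwise some place
    \<open>v0\<close> is available for constructing \<open>D\<close>.\<close>
  proof (cases "PD = {}")
    case True
    hence "height k f = 0" for f unfolding height_def by (intro sum.neutral) auto
    thus ?thesis by simp
  next
    case False
    then obtain v0 where v0: "prime_divisor k v0" by blast
    interpret char_field k q p v0
      using assms(1,3) v0 CHAR_eq_if_card_prime_power by unfold_locales auto
    obtain D :: "'k \<Rightarrow> 'k" where D: "\<And>x y. D (x + y) = D x + D y" "\<And>x y. D (x * y) = D x * y + x * D y"
      "\<And>x. D x = 0 \<longleftrightarrow> (\<exists>a. x = a ^ p)" using derivation_exists by blast
    interpret derivation_field k q p v0 D by unfold_locales (rule D)+
    have nt: "\<not> torsion a" if "a \<notin> constants_closure k" for a
      using that const_field.torsion_imp_algebraic_over[OF const_field_to_ac]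
      by (auto simp: constants_closure_def)
    have "bounded_by_support F"
      by (rule bounded_by_support_main[OF assms(6,7)]) (use assms(8) nt in blast)
    then obtain C1 where C1: "\<And>f. poly F f \<noteq> 0 \<Longrightarrow> height k f \<le> C1 * (1 + degsupp (poly F f))"
      unfolding bounded_by_support_def by blast
    obtain C2 where C2: "\<And>y. degsupp y \<le> C2 * q ^ max_degree k y" using degsupp_le_max_degree by blast
    have "height k f \<le> C1 * (1 + C2) * q ^ max_degree k (poly F f)" if "\<not> is_constant k (poly F f)" for f
    proof -
      have "poly F f \<noteq> 0"
        using that torsion_imp_algebraic_over[OF torsion_0] by (auto simp: is_constant_def)
      hence "height k f \<le> C1 * (1 + degsupp (poly F f))" by (rule C1)
      also have "1 + degsupp (poly F f) \<le> (1 + C2) * q ^ max_degree k (poly F f)"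
      proof -
        have "1 \<le> q ^ max_degree k (poly F f)" using \<open>0 < q\<close> by simp
        thus ?thesis using C2[of "poly F f"] by (simp add: distrib_right)
      qed
      finally show ?thesis by (simp only: mult.assoc) simp
    qed
    thus ?thesis by blast
  qed
  thus ?thesis using elog_bound[OF q_ge_2] by blast
qed

end
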